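(* Let $p(\cdot):\mathbb{R}^n\to[1,\infty]$ be a measurable function with $p_-\ge 1$ and $p_+<\infty$. Then $p(\cdot)\in\mathcal{A}_\infty$ if and only if there exists $t\in(0,1)$ such that the median maximal operator $m_t$ is bounded on $L^{p(\cdot)}$.
   Context: Cubes are cubes in $\mathbb{R}^n$ with sides parallel to the coordinate axes. For a measurable exponent $p(\cdot):\mathbb{R}^n\to[1,\infty]$, write $p_-:=\operatorname{ess\,inf}_{\mathbb{R}^n}p$ and $p_+:=\operatorname{ess\,sup}_{\mathbb{R}^n}p$. The space $L^{p(\cdot)}$ consists of the real-valued measurable functions $f$ on $\mathbb{R}^n$ with $$\|f\|_{L^{p(\cdot)}}:=\inf\Big\{\lambda>0:\int_{\mathbb{R}^n}\big(|f(x)|/\lambda\big)^{p(x)}dx\le 1\Big\}<\infty .$$ For $\lambda\in(0,1)$, a cube $Q$ and a measurable function $f$, the value of the non-increasing rearrangement of $f\chi_Q$ at $\lambda|Q|$ is $$(f\chi_Q)^*(\lambda|Q|):=\inf\{\alpha>0:|\{x\in Q:|f(x)|>\alpha\}|\le\lambda|Q|\},$$ and the $\lambda$-median maximal operator is $$m_\lambda f(x):=\sup_{Q\ni x}(f\chi_Q)^*(\lambda|Q|),$$ the supremum being over all cubes $Q$ containing $x$. "Bounded on $L^{p(\cdot)}$" means that there is a constant $C>0$ with $\|m_\lambda f\|_{L^{p(\cdot)}}\le C\|f\|_{L^{p(\cdot)}}$ for all $f\in L^{p(\cdot)}$. Definition of $\mathcal{A}_\infty$: $p(\cdot)\in\mathcal{A}_\infty$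 if there exist $\lambda\in(0,1)$ and $C>0$ such that for any family $\mathcal{F}$ of pairwise disjoint cubes, any non-negative sequence $\{t_Q\}_{Q\in\mathcal{F}}$, and any measurable subsets $E_Q\subset Q$, $Q\in\mathcal{F}$, with $|E_Q|\ge\lambda|Q|$, $$\Big\|\sum_{Q\in\mathcal{F}}t_Q\chi_Q\Big\|_{L^{p(\cdot)}}\le C\Big\|\sum_{Q\in\mathcal{F}}t_Q\chi_{E_Q}\Big\|_{L^{p(\cdot)}} .$$ *)

theory Defs
  imports "HOL-Analysis.Analysis" "HOL-Probability.Essential_Supremum"
begin

text \<open>
  A cube is a product of bounded intervals of the same positive length. Each interval may or may
  not contain each of its endpoints, so open, closed and half-open cubes are all included.
\<close>

definition is_cube :: "(real^'n) set \<Rightarrow> bool" where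
  "is_cube Q \<longleftrightarrow> (\<exists>a l I. l > 0 \<and>
     (\<forall>i. {a $ i <..< a $ i + l} \<subseteq> I i \<and> I i \<subseteq> {a $ i .. a $ i + l}) \<and>
     Q = {x. \<forall>i. x $ i \<in> I i})"

text \<open>The dual of the library's \<open>esssup\<close>, which is \<open>Limsup\<close> along the same filter.\<close>

definition essinf :: "'a measure \<Rightarrow> ('a \<Rightarrow> ennreal) \<Rightarrow> ennreal" where
  "essinf M f = Liminf (ae_filter M) f"

text \<open>
  The power \<open>a\<^sup>p\<close> for \<open>a \<in> [0,\<infinity>]\<close> and \<open>p \<in> [1,\<infinity>]\<close>, with the usual convention that
  \<open>a\<^sup>\<infinity>\<close> is \<open>0\<close> for \<open>a \<le> 1\<close> and \<open>\<infinity>\<close> for \<open>a > 1\<close>.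
\<close>

definition ennpow :: "ennreal \<Rightarrow> ennreal \<Rightarrow> ennreal" where
  "ennpow a p =
     (if p = \<infinity> then (if a \<le> 1 then 0 else \<infinity>)
      else if a = \<infinity> then \<infinity>
      else ennreal (enn2real a powr enn2real p))"

text \<open>
  The Luxemburg norm of a function with values in \<open>[0,\<infinity>]\<close>; this generality is needed because a
  maximal function may take the value \<open>\<infinity>\<close>. The norm is \<open>\<infinity>\<close> (the infimum of the empty set)
  if no \<open>\<mu>\<close> is admissible.
\<close>

definition Lp_ext_norm :: "(real^'n \<Rightarrow> ennreal) \<Rightarrow> (real^'n \<Rightarrow> ennreal) \<Rightarrow> ennreal" where
  "Lp_ext_norm p g =
     Inf {ennreal \<mu> | \<mu>. \<mu> > 0 \<and> (\<integral>\<^sup>+x. ennpow (g x / ennreal \<mu>) (p x) \<partial>lebesgue) \<le> 1}"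

definition Lp_norm :: "(real^'n \<Rightarrow> ennreal) \<Rightarrow> (real^'n \<Rightarrow> real) \<Rightarrow> ennreal" where
  "Lp_norm p f = Lp_ext_norm p (\<lambda>x. ennreal \<bar>f x\<bar>)"

definition Lp_space :: "(real^'n \<Rightarrow> ennreal) \<Rightarrow> (real^'n \<Rightarrow> real) set" where
  "Lp_space p = {f \<in> borel_measurable lebesgue. Lp_norm p f < \<infinity>}"

text \<open>The value \<open>(f \<chi>\<^sub>Q)\<^sup>*(r |Q|)\<close> of the non-increasing rearrangement.\<close>

definition rearr :: "real \<Rightarrow> (real^'n \<Rightarrow> real) \<Rightarrow> (real^'n) set \<Rightarrow> ennreal" where
  "rearr r f Q =
     Inf {ennreal \<alpha> | \<alpha>. \<alpha> > 0 \<and>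
       emeasure lebesgue {x \<in> Q. \<bar>f x\<bar> > \<alpha>} \<le> ennreal r * emeasure lebesgue Q}"

definition median_max :: "real \<Rightarrow> (real^'n \<Rightarrow> real) \<Rightarrow> real^'n \<Rightarrow> ennreal" where
  "median_max r f x = (SUP Q \<in> {Q. is_cube Q \<and> x \<in> Q}. rearr r f Q)"

definition median_max_bounded :: "real \<Rightarrow> (real^'n \<Rightarrow> ennreal) \<Rightarrow> bool" where
  "median_max_bounded r p \<longleftrightarrow>
     (\<exists>C>0. \<forall>f \<in> Lp_space p. Lp_ext_norm p (median_max r f) \<le> ennreal C * Lp_norm p f)"

text \<open>
  The family \<open>F\<close> may be infinite; as its members are pairwise disjoint, at most one term of each
  sum is nonzero at any given point, so the sums below always converge.
\<close>

definition A_infty :: "(real^'n \<Rightarrow> ennreal) \<Rightarrow> bool" where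
  "A_infty p \<longleftrightarrow>
     (\<exists>r C. 0 < r \<and> r < 1 \<and> C > 0 \<and>
       (\<forall>(F :: (real^'n) set set) (t :: (real^'n) set \<Rightarrow> real) (E :: (real^'n) set \<Rightarrow> (real^'n) set).
          (\<forall>Q\<in>F. is_cube Q) \<longrightarrow> disjoint F \<longrightarrow> (\<forall>Q\<in>F. t Q \<ge> 0) \<longrightarrow>
          (\<forall>Q\<in>F. E Q \<in> sets lebesgue \<and> E Q \<subseteq> Q \<and>
                  emeasure lebesgue (E Q) \<ge> ennreal r * emeasure lebesgue Q) \<longrightarrow>
          Lp_norm p (\<lambda>x. \<Sum>\<^sub>\<infinity>Q\<in>F. t Q * indicator Q x)
            \<le> ennreal C * Lp_norm p (\<lambda>x. \<Sum>\<^sub>\<infinity>Q\<in>F. t Q * indicator (E Q) x)))"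

end

theory Submission
  imports Defs
begin

text \<open>
  If \<open>m\<^sub>t\<close> is bounded, put \<open>r = (1 + t) / 2\<close> and \<open>f = \<Sum> t\<^sub>Q \<chi>\<^bsub>E\<^sub>Q\<^esub>\<close> with \<open>|E\<^sub>Q| \<ge> r |Q|\<close>; then
  \<open>m\<^sub>t f \<ge> t\<^sub>Q\<close> on \<open>Q\<close>, which is the condition \<open>A\<^sub>\<infinity>\<close>.

  For the converse let \<open>q\<close> be a real representative of \<open>p\<close>, fix a dyadic grid and cover
  \<open>{m f > 2\<^sup>k}\<close> by the maximal cells \<open>R\<close> in which \<open>{|f| > 2\<^sup>k}\<close> has density at least \<open>lam\<close>. If
  \<open>c \<integral>\<^sub>R s\<^sup>q \<le> \<integral>\<^sub>E s\<^sup>q\<close> with \<open>s = 2\<^sup>k\<close> and \<open>E = R \<inter> {|f| > s}\<close> for all these cells and all \<open>k\<close>, then the sum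
  over \<open>k\<close> is a geometric series bounded by \<open>\<integral> |f|\<^sup>q\<close>. It remains to bound the cells that
  violate such an inequality (they have a defect at the level \<open>s\<close>). By \<open>A\<^sub>\<infinity>\<close>, tested with constant
  coefficients only, disjoint cells with a defect at a common level have small total mass \<open>\<integral> s\<^sup>q\<close>:
  otherwise one could increase \<open>s\<close> until the inequality \<open>A\<^sub>\<infinity>\<close> fails. Hence a cell of mass
  comparable to one has no defect, and comparing powers of the weight \<open>s\<^sup>q\<close> excludes
  defects at the levels between \<open>1\<close> and \<open>s\<close>. At a level \<open>t < 1\<close>, a reverse Hoelder inequality outside the
  defective subcells shows that a defective cell gets at least half of its mass from subcells
  that have a defect at a higher level. Iterating this up to the level \<open>t powr (1 / \<theta>)\<close> for some \<open>\<theta> > 1\<close> gains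
  a power of \<open>t\<close>, so that the defective cells of all levels \<open>2\<^sup>k < 1\<close> are summable. Arbitrary cubes
  reduce to finitely many grids by the one-third trick.
\<close>

section \<open>Cubes and dyadic cells\<close>

text \<open>The condition, tested at one level \<open>s\<close>, speaks only about sets of mass at
  most one and of density \<open>r\<close>, which may be close to 1. So the density is lowered
  beforehand, for cells, and the results on defects carry the bound 1 on the mass. A change of level
  is a change of power: \<open>(u powr \<beta>) powr q x = (u powr q x) powr \<beta>\<close>. For
  \<open>\<beta> \<le> 1\<close> the averages of these powers are controlled by the average of the
  weight alone. Above level 1, raising a level moves it away from 1, so the original level comes
  back with \<open>\<beta> \<le> 1\<close> and causes no trouble. Below 1, raising moves towards 1,
  the way back has \<open>\<beta> > 1\<close>, and only a reverse Hoelder inequality can supply it.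
  Where that inequality fails, the iteration is needed. The factor 16 between successive levels,
  visible in \<open>gap\<close>, is chosen against the constant 4 lost per step: after about
  \<open>log 16 (u / t)\<close> steps the loss is of order \<open>sqrt (u / t)\<close>, which the
  final gain \<open>t / u\<close> outweighs.\<close>

declare emeasure_completion [simp del]

lemma emeasure_disjoint_Union_le:
  assumes "countable F" "disjoint F" "sets N = sets M" "X \<in> sets M" "Y \<in> sets M"
    and "\<And>S. S \<in> F \<Longrightarrow> S \<in> sets M"
    and "\<And>S. S \<in> F \<Longrightarrow> emeasure M (S \<inter> X) \<le> c * emeasure N (S \<inter> Y)"
  shows "emeasure M (\<Union>F \<inter> X) \<le> c * emeasure N (\<Union>F \<inter> Y)"
proof -
  have *: "emeasure L (\<Union>F \<inter> Z) = (\<integral>\<^sup>+S. emeasure L (S \<inter> Z) \<partial>count_space F)"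
    if "sets L = sets M" "Z \<in> sets M" for L Z
  proof -
    have "\<Union>F \<inter> Z = (\<Union>S\<in>F. S \<inter> Z)" by blast
    moreover have "disjoint_family_on (\<lambda>S. S \<inter> Z) F"
      using assms(2) by (auto simp: disjoint_family_on_def disjoint_def pairwise_def disjnt_def)
    moreover have "S \<inter> Z \<in> sets L" if "S \<in> F" for S
      using assms(6)[OF that] \<open>Z \<in> sets M\<close> \<open>sets L = sets M\<close> by auto
    ultimately show ?thesis
      using assms(1) by (simp only: emeasure_UN_countable)
  qed
  show ?thesis
    using assms by (simp add: * flip: nn_integral_cmult)
       (rule nn_integral_mono, simp)
qed

definition hcube :: "real^'n \<Rightarrow> real \<Rightarrow> (real^'n) set" where
  "hcube a l = {x. \<forall>i. a $ i \<le> x $ i \<and> x $ i < a $ i + l}"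

lemma is_cube_hcube: "0 < l \<Longrightarrow> is_cube (hcube a l)"
  unfolding is_cube_def hcube_def
  by (intro exI[of _ a] exI[of _ l] exI[of _ "\<lambda>i. {a$i ..< a$i + l}"]) auto

lemma emeasure_box_side:
  fixes a :: "real^'n"
  assumes "0 < l"
  shows "emeasure lborel (box a (\<chi> i. a $ i + l)) = ennreal (l ^ CARD('n))"
    and "emeasure lborel (cbox a (\<chi> i. a $ i + l)) = ennreal (l ^ CARD('n))"
proof -
  have ne: "cbox a (\<chi> i. a $ i + l) \<noteq> {}"
    using assms by (auto simp: cbox_interval less_eq_vec_def intro!: exI[of _ a])
  have "measure lborel (cbox a (\<chi> i. a $ i + l)) = l ^ CARD('n)"
    using content_cbox_cart[OF ne] by simp
  then show 2: "emeasure lborel (cbox a (\<chi> i. a $ i + l)) = ennreal (l ^ CARD('n))"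
    using emeasure_lborel_cbox_finite[of a "\<chi> i. a $ i + l"] by (simp add: emeasure_eq_ennreal_measure)
  have "emeasure lborel (box a (\<chi> i. a $ i + l)) = emeasure lborel (cbox a (\<chi> i. a $ i + l))"
    by (auto simp: emeasure_lborel_box_eq emeasure_lborel_cbox_eq)
  with 2 show "emeasure lborel (box a (\<chi> i. a $ i + l)) = ennreal (l ^ CARD('n))" by simp
qed

text \<open>The faces are negligible and Lebesgue measure is complete, so the choice of end points
  affects neither measurability nor volume.\<close>

lemma cube_between_boxes:
  fixes a :: "real^'n"
  assumes "0 < l" "box a (\<chi> i. a $ i + l) \<subseteq> Q" "Q \<subseteq> cbox a (\<chi> i. a $ i + l)"
  shows "Q \<in> sets lebesgue" "emeasure lebesgue Q = ennreal (l ^ CARD('n))"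
proof -
  let ?b = "box a (\<chi> i. a $ i + l)" and ?c = "cbox a (\<chi> i. a $ i + l)"
  have "negligible (?c - ?b)"
    using negligible_frontier_interval by blast
  then have "negligible (Q - ?b)"
    by (rule negligible_subset) (use assms in auto)
  then have "Q - ?b \<in> sets lebesgue" by (rule negligible_imp_sets)
  then have "?b \<union> (Q - ?b) \<in> sets lebesgue" by (intro sets.Un) auto
  also have "?b \<union> (Q - ?b) = Q" using assms by auto
  finally show Q: "Q \<in> sets lebesgue" .
  have "emeasure lebesgue ?b \<le> emeasure lebesgue Q"
    by (rule emeasure_mono) (use assms Q in simp_all)
  moreover have "emeasure lebesgue Q \<le> emeasure lebesgue ?c"
    by (rule emeasure_mono) (use assms Q in simp_all)
  ultimately show "emeasure lebesgue Q = ennreal (l ^ CARD('n))"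
    using emeasure_box_side[OF assms(1), of a] by (intro antisym) (simp_all add: emeasure_completion)
qed

lemma is_cube_boxE:
  fixes Q :: "(real^'n) set"
  assumes "is_cube Q"
  obtains a l where "0 < l" "box a (\<chi> i. a $ i + l) \<subseteq> Q" "Q \<subseteq> cbox a (\<chi> i. a $ i + l)"
proof -
  obtain a l I where *: "l > 0"
     "\<forall>i. {a $ i <..< a $ i + l} \<subseteq> I i \<and> I i \<subseteq> {a $ i .. a $ i + l}"
     "Q = {x. \<forall>i. x $ i \<in> I i}"
    using assms unfolding is_cube_def by blast
  show ?thesis
  proof (rule that)
    show "box a (\<chi> i. a $ i + l) \<subseteq> Q" "Q \<subseteq> cbox a (\<chi> i. a $ i + l)"
      using *(2,3) by (fastforce simp: mem_box_cart)+
  qed (rule *(1))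
qed

lemma is_cube_measure:
  fixes Q :: "(real^'n) set"
  assumes "is_cube Q"
  shows "Q \<in> sets lebesgue" "0 < emeasure lebesgue Q" "emeasure lebesgue Q < \<infinity>"
proof -
  obtain a l where "0 < l" "box a (\<chi> i. a $ i + l) \<subseteq> Q" "Q \<subseteq> cbox a (\<chi> i. a $ i + l)"
    using is_cube_boxE[OF assms] .
  then show "Q \<in> sets lebesgue" "0 < emeasure lebesgue Q" "emeasure lebesgue Q < \<infinity>"
    by (simp_all add: cube_between_boxes)
qed

lemma countable_disjoint_cubes:
  fixes F :: "(real^'n) set set"
  assumes "disjoint F" "\<And>Q. Q \<in> F \<Longrightarrow> is_cube Q"
  shows "countable F"
proof (rule countable_disjoint_nonempty_interior_subsets)
  show "pairwise disjnt F" using assms(1) by (simp add: disjoint_def pairwise_def disjnt_def)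
  fix Q assume Q: "Q \<in> F" "interior Q = {}"
  obtain a l where al: "0 < l" "box a (\<chi> i. a $ i + l) \<subseteq> Q"
    using is_cube_boxE[OF assms(2)[OF Q(1)]] by metis
  then have "(\<chi> i. a $ i + l/2) \<in> box a (\<chi> i. a $ i + l)"
    by (auto simp: mem_box_cart)
  moreover have "box a (\<chi> i. a $ i + l) \<subseteq> interior Q"
    using al by (simp add: interior_maximal open_box)
  ultimately show "Q = {}" using Q by auto
qed

lemma hcube_measure:
  fixes a :: "real^'n"
  assumes "0 < l"
  shows "hcube a l \<in> sets lebesgue" "emeasure lebesgue (hcube a l) = ennreal (l ^ CARD('n))"
proof -
  have "box a (\<chi> i. a $ i + l) \<subseteq> hcube a l" "hcube a l \<subseteq> cbox a (\<chi> i. a $ i + l)"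
    by (auto simp: mem_box_cart hcube_def less_imp_le)
  from cube_between_boxes[OF assms this] show "hcube a l \<in> sets lebesgue"
    "emeasure lebesgue (hcube a l) = ennreal (l ^ CARD('n))" by auto
qed

section \<open>Dyadic cells with a coarsest generation, and their maximal subfamilies\<close>

locale dyadic_grid =
  fixes b :: "real^'n" and h :: real
  assumes h_pos: "0 < h"
begin

definition idx :: "nat \<Rightarrow> real^'n \<Rightarrow> 'n \<Rightarrow> int" where
  "idx j x i = \<lfloor>(x $ i - b $ i) * 2 ^ j / h\<rfloor>"

definition cell :: "nat \<Rightarrow> real^'n \<Rightarrow> (real^'n) set" where
  "cell j x = {y. idx j y = idx j x}"

text \<open>Generations start at 0, so sides never exceed \<open>h\<close>. Hence every family of
  cells has maximal members covering its union; large cubes are reached by varying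
  \<open>h\<close>.\<close>

definition cells :: "(real^'n) set set" where
  "cells = {cell j x | j x. True}"

definition corner :: "nat \<Rightarrow> real^'n \<Rightarrow> real^'n" where
  "corner j x = (\<chi> i. b $ i + of_int (idx j x i) * (h / 2 ^ j))"

lemma cell_self [simp]: "x \<in> cell j x"
  by (simp add: cell_def)

lemma cell_in_cells [simp]: "cell j x \<in> cells"
  by (auto simp: cells_def)

lemma cell_eq: "y \<in> cell j x \<Longrightarrow> cell j y = cell j x"
  by (simp add: cell_def)

lemma idx_half: "idx j x i = idx (Suc j) x i div 2"
proof -
  have "(x $ i - b $ i) * 2 ^ Suc j / h = 2 * ((x $ i - b $ i) * 2 ^ j / h)" by simp
  then show ?thesis
    unfolding idx_def
    using floor_divide_real_eq_div[of 2 "(x $ i - b $ i) * 2 ^ Suc j / h"] by simp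
qed

lemma cell_Suc_subset: "cell (Suc j) x \<subseteq> cell j x"
proof -
  have "idx j y = idx j x" if "idx (Suc j) y = idx (Suc j) x" for y
    using that by (intro ext) (simp only: idx_half[of j])
  then show ?thesis unfolding cell_def by blast
qed

lemma cell_antimono: "j \<le> j' \<Longrightarrow> cell j' x \<subseteq> cell j x"
  by (rule lift_Suc_antimono_le[of "\<lambda>j. cell j x"]) (rule cell_Suc_subset)

lemma cell_hcube: "cell j x = hcube (corner j x) (h / 2 ^ j)"
proof -
  have "idx j y i = m \<longleftrightarrow> b $ i + of_int m * (h / 2 ^ j) \<le> y $ i \<and> y $ i < b $ i + of_int m * (h / 2 ^ j) + h / 2 ^ j"
    for y i m
    unfolding idx_def floor_eq_iff using h_pos by (auto simp: field_simps)
  then show ?thesis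
    unfolding cell_def hcube_def corner_def by (auto simp: fun_eq_iff)
qed

lemma emeasure_cell: "emeasure lebesgue (cell j x) = ennreal ((h / 2 ^ j) ^ CARD('n))"
  unfolding cell_hcube using h_pos by (simp add: hcube_measure)

lemma is_cube_cells: "P \<in> cells \<Longrightarrow> is_cube P"
  unfolding cells_def using h_pos by (auto simp: cell_hcube intro!: is_cube_hcube)

lemma cells_measure:
  assumes "P \<in> cells"
  shows "P \<in> sets lebesgue" "0 < emeasure lebesgue P" "emeasure lebesgue P < \<infinity>"
  using is_cube_measure[OF is_cube_cells[OF assms]] by auto

lemma emeasure_cell_Suc: "emeasure lebesgue (cell j x) = 2 ^ CARD('n) * emeasure lebesgue (cell (Suc j) x)"
proof -
  have "(h / 2 ^ j) ^ CARD('n) = 2 ^ CARD('n) * (h / 2 ^ Suc j) ^ CARD('n)"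
    by (simp add: power_mult_distrib flip: power_mult_distrib)
  then show ?thesis
    unfolding emeasure_cell using h_pos by (simp add: ennreal_mult'' flip: ennreal_power)
qed

lemma countable_cells: "countable cells"
proof -
  have "cells \<subseteq> (\<lambda>(j, m). {y. idx j y = m}) ` UNIV"
    by (auto simp: cells_def cell_def image_iff)
  moreover have "countable (UNIV :: (nat \<times> ('n \<Rightarrow> int)) set)" by simp
  ultimately show ?thesis
    by (meson countable_image countable_subset)
qed

lemma cell_small:
  assumes "open U" "x \<in> U"
  shows "\<exists>j\<ge>J. cell j x \<subseteq> U"
proof -
  obtain e where e: "e > 0" "ball x e \<subseteq> U" using assms openE by blast
  have "(\<lambda>j. real CARD('n) * (h * (1/2) ^ j)) \<longlonglongrightarrow> real CARD('n) * (h * 0)"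
    by (intro tendsto_intros LIMSEQ_realpow_zero) auto
  then have "(\<lambda>j. real CARD('n) * (h * (1/2) ^ j)) \<longlonglongrightarrow> 0" by simp
  from order_tendstoD(2)[OF this e(1)] have "\<forall>\<^sub>F j in sequentially. real CARD('n) * (h * (1/2) ^ j) < e" .
  moreover have "\<forall>\<^sub>F j in sequentially. j \<ge> J" by (rule eventually_ge_at_top)
  ultimately have "\<forall>\<^sub>F j in sequentially. j \<ge> J \<and> real CARD('n) * (h * (1/2) ^ j) < e"
    by eventually_elim auto
  then obtain j where j: "j \<ge> J" "real CARD('n) * (h * (1/2) ^ j) < e"
    using eventually_happens'[OF sequentially_bot] by blast
  have "cell j x \<subseteq> ball x e"
  proof
    fix y assume y: "y \<in> cell j x"
    have "\<bar>(x - y) $ i\<bar> \<le> h * (1/2) ^ j" for i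
      using y cell_self[of x j] unfolding cell_hcube hcube_def
      by (auto simp: power_divide abs_le_iff dest!: spec[of _ i]) 
    then have "norm (x - y) \<le> (\<Sum>i\<in>(UNIV::'n set). h * (1/2) ^ j)"
      using norm_le_l1_cart[of "x - y"] by (meson order_trans sum_mono)
    also have "\<dots> < e" using j by simp
    finally show "y \<in> ball x e" by (simp add: dist_norm)
  qed
  with j e show ?thesis by blast
qed

text \<open>The maximal members of a family of cells: around each point, the one of least generation.\<close>

definition tops :: "(real^'n) set set \<Rightarrow> (real^'n) set set" where
  "tops S = {cell (LEAST j. cell j x \<in> S) x | x. x \<in> \<Union>S}"

context
  fixes S assumes S: "S \<subseteq> cells"
begin

lemma tops_point:
  assumes "x \<in> \<Union>S"
  shows "cell (LEAST j. cell j x \<in> S) x \<in> S"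
proof -
  obtain P where "P \<in> S" "x \<in> P" using assms by auto
  then obtain j where "P = cell j x" using S cell_eq unfolding cells_def by blast
  then show ?thesis using \<open>P \<in> S\<close> by (auto intro: LeastI)
qed

lemma tops_subset: "tops S \<subseteq> S"
  unfolding tops_def using tops_point by auto

lemma Union_tops: "\<Union>(tops S) = \<Union>S"
proof
  show "\<Union>S \<subseteq> \<Union>(tops S)"
    unfolding tops_def using cell_self by blast
qed (use tops_subset in auto)

lemma tops_max:
  assumes M: "M \<in> tops S" and P: "P \<in> S" "P \<inter> M \<noteq> {}"
  shows "P \<subseteq> M"
proof -
  obtain x where x: "M = cell (LEAST j. cell j x \<in> S) x" "x \<in> \<Union>S"
    using M by (auto simp: tops_def)
  obtain y where y: "y \<in> P" "y \<in> M" using P by auto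
  then obtain j where j: "P = cell j y" using S P cell_eq unfolding cells_def by blast
  let ?k = "LEAST j. cell j x \<in> S"
  have *: "cell i y = cell i x" if "i \<le> ?k" for i
  proof -
    have "y \<in> cell i x" using cell_antimono[OF that, of x] y(2) x(1) by blast
    then show ?thesis by (rule cell_eq)
  qed
  have "?k \<le> j"
  proof (rule ccontr)
    assume "\<not> ?k \<le> j"
    then have "cell j x \<in> S" using * j P by auto
    then have "?k \<le> j" by (rule Least_le)
    with \<open>\<not> ?k \<le> j\<close> show False by simp
  qed
  then show ?thesis using cell_antimono[of ?k j y] *[of ?k] j x by auto
qed

lemma tops_disjoint: "disjoint (tops S)"
proof (rule disjointI)
  fix P Q assume PQ: "P \<in> tops S" "Q \<in> tops S" "P \<noteq> Q"
  then have "P \<in> S" "Q \<in> S" using tops_subset by auto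
  then show "P \<inter> Q = {}"
    using tops_max[OF PQ(1), of Q] tops_max[OF PQ(2), of P] PQ(3) by (auto simp: Int_commute)
qed

lemma tops_countable: "countable (tops S)"
  using countable_subset[OF order_trans[OF tops_subset S] countable_cells] .

lemma tops_cells: "M \<in> tops S \<Longrightarrow> M \<in> cells"
  using S tops_subset by auto

text \<open>The source of the stopping-time estimates: the parent violates the condition that
  defines \<open>S\<close>. Strictness of \<open>M \<subset> R\<close> guarantees that there is a
  parent inside \<open>R\<close>.\<close>

lemma tops_parent:
  assumes M: "M \<in> tops S" and R: "R \<in> cells" "M \<subset> R"
  obtains j x where "M = cell (Suc j) x" "cell j x \<subseteq> R" "cell j x \<notin> S"
proof -
  obtain x where x: "M = cell (LEAST j. cell j x \<in> S) x" "x \<in> \<Union>S"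
    using M by (auto simp: tops_def)
  have "x \<in> M" using x(1) by simp
  then obtain i where i: "R = cell i x"
    using R cell_eq unfolding cells_def by blast
  let ?k = "LEAST j. cell j x \<in> S"
  have "i < ?k"
    using cell_antimono[of ?k i x] R x(1) i by (meson leI psubsetE)
  then obtain j where j: "?k = Suc j" "i \<le> j"
    by (cases ?k) auto
  have "cell j x \<notin> S" using not_less_Least[of j "\<lambda>j. cell j x \<in> S"] j by auto
  with that[of j x] show ?thesis using x j i cell_antimono by auto
qed

end

end

section \<open>Differentiation along cells and the reverse Hoelder inequality\<close>

context dyadic_grid
begin

text \<open>One half of Lebesgue differentiation, for weights that need not be integrable. On a set
  of positive finite measure where \<open>w\<close> is at least \<open>M + 1 / (n + 1)\<close> while
  all small cells have average at most \<open>M\<close>, maximal cells inside a slightly larger open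
  set give contradictory bounds for the weighted mass.\<close>

lemma AE_cell_average_greater:
  fixes w :: "real^'n \<Rightarrow> ennreal" and M :: real
  assumes w [measurable]: "w \<in> borel_measurable lebesgue" and M: "0 < M"
  shows "AE x in lebesgue. ennreal M < w x \<longrightarrow>
    (\<exists>j\<ge>J. ennreal M * emeasure lebesgue (cell j x) < emeasure (density lebesgue w) (cell j x))"
proof -
  let ?W = "density lebesgue w"
  define S where "S = {cell j x | j x. J \<le> j \<and> ennreal M * emeasure lebesgue (cell j x) < emeasure ?W (cell j x)}"
  define Z where "Z = {x. ennreal M < w x} - \<Union>S"
  have "S \<subseteq> cells" by (auto simp: S_def)
  then have US: "\<Union>S \<in> sets lebesgue"
    using countable_cells cells_measure(1) by (intro sets.countable_Union) (auto intro: countable_subset)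
  have "{x \<in> space lebesgue. ennreal M < w x} \<in> sets lebesgue" by measurable
  then have Zs: "Z \<in> sets lebesgue" using US by (auto simp: Z_def)
  define Zn where "Zn n = Z \<inter> {x. ennreal (M + 1 / real (Suc n)) \<le> w x} \<inter> cball 0 (real n)" for n
  have Zn_sets: "Zn n \<in> sets lebesgue" for n
  proof -
    have "{x \<in> space lebesgue. ennreal (M + 1 / real (Suc n)) \<le> w x} \<in> sets lebesgue" by measurable
    then show ?thesis using Zs by (auto simp: Zn_def)
  qed
  have Zn_null: "emeasure lebesgue (Zn n) = 0" for n
  proof (rule ccontr)
    assume ne: "emeasure lebesgue (Zn n) \<noteq> 0"
    have "emeasure lebesgue (Zn n) \<le> emeasure lebesgue (cball (0::real^'n) (real n))"
      by (rule emeasure_mono) (auto simp: Zn_def)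
    also have "\<dots> < \<infinity>"
      using fmeasurableD2[OF lmeasurable_cball[of "0::real^'n" "real n"]] by (simp add: less_top)
    finally have fin: "emeasure lebesgue (Zn n) < \<infinity>" .
    then obtain z where z: "emeasure lebesgue (Zn n) = ennreal z" "0 < z"
      using ne by (cases "emeasure lebesgue (Zn n)") (auto simp: less_le)
    \<comment> \<open>With this excess of the open set, \<open>M * (z + e)\<close> is exactly
      \<open>(M + 1 / (n + 1)) * z\<close>, the lower bound for the weighted mass of
      \<open>Zn n\<close>.\<close>
    define e where "e = z * (1 / real (Suc n)) / M"
    have e: "0 < e" using z M by (simp add: e_def)
    obtain U where U: "open U" "Zn n \<subseteq> U" "U - Zn n \<in> lmeasurable" "emeasure lebesgue (U - Zn n) < ennreal e"
      using sets_lebesgue_outer_open[OF Zn_sets e] by blast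
    have Us: "U \<in> sets lebesgue" using U(1) by (simp add: borel_open)
    have "emeasure lebesgue U = emeasure lebesgue (Zn n) + emeasure lebesgue (U - Zn n)"
      using U Zn_sets Us by (subst plus_emeasure) (auto simp: Un_absorb1)
    also have "\<dots> < ennreal z + ennreal e"
      using U(4) unfolding z(1) by (simp add: ennreal_add_left_cancel_less)
    finally have U_less: "emeasure lebesgue U < ennreal (z + e)" using z e by simp
    define S' where "S' = {cell j x | j x. J \<le> j \<and> x \<in> Zn n \<and> cell j x \<subseteq> U}"
    have S': "S' \<subseteq> cells" by (auto simp: S'_def)
    have cover: "Zn n \<subseteq> \<Union>S'"
    proof
      fix x assume x: "x \<in> Zn n"
      then obtain j where "J \<le> j" "cell j x \<subseteq> U" using cell_small[of U x J] U by blast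
      then have "cell j x \<in> S'" using x by (auto simp: S'_def)
      then show "x \<in> \<Union>S'" using cell_self[of x j] by blast
    qed
    have US': "\<Union>S' \<in> sets lebesgue"
      using countable_cells cells_measure(1) S' by (intro sets.countable_Union) (auto intro: countable_subset)
    have "emeasure ?W (\<Union>(tops S') \<inter> UNIV) \<le> ennreal M * emeasure lebesgue (\<Union>(tops S') \<inter> UNIV)"
    proof (rule emeasure_disjoint_Union_le)
      show "countable (tops S')" "disjoint (tops S')"
        using tops_countable[OF S'] tops_disjoint[OF S'] by simp_all
      fix P assume "P \<in> tops S'"
      then have P: "P \<in> S'" using tops_subset[OF S'] by auto
      then show "P \<in> sets ?W" using S' cells_measure by auto
      obtain j x where jx: "P = cell j x" "J \<le> j" "x \<in> Zn n" using P by (auto simp: S'_def)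
      then have "x \<notin> \<Union>S" by (auto simp: Zn_def Z_def)
      then have "P \<notin> S" using jx cell_self by blast
      then have "\<not> ennreal M * emeasure lebesgue P < emeasure ?W P"
        using jx(1,2) unfolding S_def by blast
      then show "emeasure ?W (P \<inter> UNIV) \<le> ennreal M * emeasure lebesgue (P \<inter> UNIV)"
        by (simp add: not_less)
    qed auto
    then have "emeasure ?W (\<Union>S') \<le> ennreal M * emeasure lebesgue (\<Union>S')"
      by (simp add: Union_tops[OF S'])
    also have "\<dots> \<le> ennreal M * emeasure lebesgue U"
      using Us by (intro mult_left_mono emeasure_mono) (auto simp: S'_def)
    also have "\<dots> < ennreal M * ennreal (z + e)"
      using U_less M by (intro ennreal_mult_strict_left_mono) auto
    also have "ennreal M * ennreal (z + e) = ennreal ((M + 1 / real (Suc n)) * z)"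
    proof -
      have "M * (z + e) = (M + 1 / real (Suc n)) * z"
      proof -
        have "M * (z + z * r / M) = (M + r) * z" for r using M by (simp add: field_simps)
        then show ?thesis unfolding e_def .
      qed
      then show ?thesis using M z e by (subst ennreal_mult[symmetric]) simp_all
    qed
    also have "\<dots> = ennreal (M + 1 / real (Suc n)) * emeasure lebesgue (Zn n)"
      using M z by (simp add: ennreal_mult)
    also have "\<dots> = (\<integral>\<^sup>+x. ennreal (M + 1 / real (Suc n)) * indicator (Zn n) x \<partial>lebesgue)"
      using Zn_sets by (simp add: nn_integral_cmult_indicator)
    also have "\<dots> \<le> (\<integral>\<^sup>+x. w x * indicator (Zn n) x \<partial>lebesgue)"
      by (intro nn_integral_mono) (auto simp: Zn_def indicator_def)
    also have "\<dots> = emeasure ?W (Zn n)"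
      using Zn_sets by (simp add: emeasure_density)
    also have "\<dots> \<le> emeasure ?W (\<Union>S')"
      using cover US' by (intro emeasure_mono) auto
    finally show False by simp
  qed
  have Z_eq: "Z = (\<Union>n. Zn n)"
  proof
    show "Z \<subseteq> (\<Union>n. Zn n)"
    proof
      fix x assume x: "x \<in> Z"
      then have "ennreal M < w x" by (auto simp: Z_def)
      then obtain r where r: "ennreal M < r" "r < w x" using dense by blast
      then obtain r' where r': "r = ennreal r'" "0 \<le> r'" by (cases r) auto
      have "M < r'" using r(1) r' M by (simp add: ennreal_less_iff)
      then obtain n where n: "inverse (real (Suc n)) < r' - M" using reals_Archimedean[of "r' - M"] by auto
      obtain m where m: "norm x \<le> real m" using real_arch_simple by blast
      define k where "k = max n m"
      have "1 / real (Suc k) \<le> 1 / real (Suc n)" by (auto simp: k_def field_simps)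
      then have "M + 1 / real (Suc k) \<le> r'" using n by (simp add: inverse_eq_divide)
      then have "ennreal (M + 1 / real (Suc k)) \<le> r" using r' by (simp add: ennreal_leI)
      then have "x \<in> Zn k" using x r m by (auto simp: Zn_def k_def)
      then show "x \<in> (\<Union>n. Zn n)" by blast
    qed
  qed (auto simp: Zn_def)
  have "Z \<in> null_sets lebesgue"
    unfolding Z_eq using Zn_null Zn_sets by (intro null_sets_UN) auto
  then have "AE x in lebesgue. x \<notin> Z" by (rule AE_not_in)
  then show ?thesis
  proof (rule AE_mp, intro AE_I2 impI)
    fix x assume x: "x \<notin> Z" "ennreal M < w x"
    then obtain P where P: "P \<in> S" "x \<in> P" by (auto simp: Z_def)
    then obtain j y where "P = cell j y" "J \<le> j" "ennreal M * emeasure lebesgue P < emeasure ?W P"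
      by (auto simp: S_def)
    with P cell_eq[of x j y] show "\<exists>j\<ge>J. ennreal M * emeasure lebesgue (cell j x) < emeasure ?W (cell j x)"
      by auto
  qed
qed


text \<open>
  The family \<open>S\<close> consists of exceptional cells. The level sets
  \<open>\<Omega> i\<close> consist of the cells on which the average of \<open>y\<close> exceeds \<open>A ^ i\<close>; by maximality such a cell
  has average at most \<open>2 ^ n * A ^ i\<close>, so the next level set occupies at most half of it.
\<close>

lemma reverse_Hoelder_outside:
  fixes y :: "real^'n \<Rightarrow> real"
  defines "W \<equiv> density lebesgue (\<lambda>x. ennreal (y x))"
  assumes y [measurable]: "y \<in> borel_measurable lebesgue" and y_pos: "\<And>x. 0 < y x"
    and c: "0 < c" "c \<le> 1" and R: "R \<in> cells" and WR: "emeasure W R = emeasure lebesgue R"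
    and S: "S \<subseteq> cells"
    and good: "\<And>P E. P \<in> cells \<Longrightarrow> P \<subseteq> R \<Longrightarrow> \<not> (\<exists>M\<in>S. P \<subseteq> M) \<Longrightarrow> E \<in> sets lebesgue \<Longrightarrow> E \<subseteq> P \<Longrightarrow>
        emeasure lebesgue P \<le> 2 * emeasure lebesgue E \<Longrightarrow> ennreal c * emeasure W P \<le> emeasure W E"
    and th: "1 \<le> \<theta>" "(2 ^ Suc CARD('n)) powr (\<theta> - 1) \<le> 1 + c / 4"
  shows "(\<integral>\<^sup>+x. ennreal (y x powr \<theta>) * indicator (R - \<Union>S) x \<partial>lebesgue) \<le> 2 * emeasure lebesgue R"
proof -
  \<comment> \<open>A parent has \<open>2 ^ CARD('n)\<close> times the volume; the additional factor
    2 keeps the next level set within half of a cell.\<close>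
  define A :: real where "A = 2 ^ Suc CARD('n)"
  have A1: "1 < A" unfolding A_def by (rule one_less_power) auto
  have setsW [simp]: "sets W = sets lebesgue" by (simp add: W_def)
  have Rfin: "emeasure lebesgue R < \<infinity>" and Rs: "R \<in> sets lebesgue" using cells_measure[OF R] by auto
  \<comment> \<open>Cells inside a member of \<open>S\<close> are excluded, cells that contain
    members of \<open>S\<close> are not. This condition is inherited by larger cells, so a parent
    outside \<open>T i\<close> must fail the condition on the average.\<close>
  define T where "T i = {P \<in> cells. P \<subseteq> R \<and> \<not> (\<exists>M\<in>S. P \<subseteq> M) \<and> ennreal (A ^ i) * emeasure lebesgue P < emeasure W P}" for i
  define \<Omega> where "\<Omega> i = \<Union>(T i)" for i
  have Tc: "T i \<subseteq> cells" for i by (auto simp: T_def)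
  have Om_sets [measurable]: "\<Omega> i \<in> sets lebesgue" for i
    unfolding \<Omega>_def using countable_cells cells_measure(1) Tc
    by (intro sets.countable_Union) (auto intro: countable_subset)
  have Om_R: "\<Omega> i \<subseteq> R" for i by (auto simp: \<Omega>_def T_def)
  have T_mono: "T (Suc i) \<subseteq> T i" for i
  proof
    fix P assume "P \<in> T (Suc i)"
    moreover have "ennreal (A ^ i) * emeasure lebesgue P \<le> ennreal (A ^ Suc i) * emeasure lebesgue P"
      using A1 by (intro mult_right_mono ennreal_leI power_increasing) auto
    ultimately show "P \<in> T i" by (auto simp: T_def intro: le_less_trans)
  qed
  have step: "emeasure W (P \<inter> \<Omega> (Suc i)) \<le> ennreal (1 - c) * emeasure W P"
    if P: "P \<in> tops (T i)" and i: "1 \<le> i" for P i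
  proof -
    have PT: "P \<in> T i" using P tops_subset[OF Tc] by blast
    then have Pc: "P \<in> cells" "P \<subseteq> R" and free: "\<not> (\<exists>M\<in>S. P \<subseteq> M)" by (auto simp: T_def)
    note Pm = cells_measure[OF Pc(1)]
    have "R \<notin> T i"
      using WR A1 ennreal_leI[of 1 "A ^ i"] mult_right_mono[of 1 "ennreal (A ^ i)" "emeasure lebesgue R"]
      by (auto simp: T_def not_less)
    then have "P \<subset> R" using PT Pc by auto
    then obtain j x where jx: "P = cell (Suc j) x" "cell j x \<subseteq> R" "cell j x \<notin> T i"
      using tops_parent[OF Tc P R] by blast
    have Pj: "P \<subseteq> cell j x" using jx cell_Suc_subset by auto
    then have "\<not> (\<exists>M\<in>S. cell j x \<subseteq> M)" using free by blast
    then have "emeasure W (cell j x) \<le> ennreal (A ^ i) * emeasure lebesgue (cell j x)"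
      using jx(2,3) by (auto simp: T_def not_less)
    also have "\<dots> = ennreal (A ^ i) * (2 ^ CARD('n) * emeasure lebesgue P)"
      unfolding jx(1) by (subst emeasure_cell_Suc) simp
    finally have "emeasure W (cell j x) \<le> ennreal (A ^ i) * (2 ^ CARD('n) * emeasure lebesgue P)" .
    moreover have "emeasure W P \<le> emeasure W (cell j x)"
      using Pj cells_measure(1)[of "cell j x"] by (intro emeasure_mono) auto
    ultimately have WP: "emeasure W P \<le> ennreal (A ^ i) * (2 ^ CARD('n) * emeasure lebesgue P)"
      by simp
    let ?G = "P \<inter> \<Omega> (Suc i)"
    have Gs: "?G \<in> sets lebesgue" using Pm by auto
    define Q where "Q = {Q \<in> tops (T (Suc i)). Q \<subseteq> P}"
    have G_eq: "?G = \<Union>Q"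
    proof
      show "?G \<subseteq> \<Union>Q"
      proof
        fix x assume x: "x \<in> ?G"
        then have "x \<in> \<Union>(tops (T (Suc i)))" by (simp add: Union_tops[OF Tc] \<Omega>_def)
        then obtain M where M: "M \<in> tops (T (Suc i))" "x \<in> M" by blast
        then have "M \<in> T i" using tops_subset[OF Tc] T_mono by blast
        then have "M \<subseteq> P" using tops_max[OF Tc P] x M by blast
        with M show "x \<in> \<Union>Q" by (auto simp: Q_def)
      qed
    qed (use Union_tops[OF Tc] in \<open>auto simp: Q_def \<Omega>_def\<close>)
    have "emeasure lebesgue (\<Union>Q \<inter> UNIV) \<le> ennreal (1 / A ^ Suc i) * emeasure W (\<Union>Q \<inter> UNIV)"
    proof (rule emeasure_disjoint_Union_le)
      show "countable Q" using tops_countable[OF Tc] by (auto simp: Q_def)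
      show "disjoint Q" using tops_disjoint[OF Tc, of "Suc i"] by (auto simp: Q_def disjoint_def)
      fix M assume "M \<in> Q"
      then have M: "M \<in> T (Suc i)" using tops_subset[OF Tc] by (auto simp: Q_def)
      then show "M \<in> sets lebesgue" using Tc cells_measure by blast
      have "ennreal (1 / A ^ Suc i) * (ennreal (A ^ Suc i) * emeasure lebesgue M) \<le> ennreal (1 / A ^ Suc i) * emeasure W M"
        using M by (intro mult_left_mono) (auto simp: T_def)
      moreover have "ennreal (1 / A ^ Suc i) * (ennreal (A ^ Suc i) * emeasure lebesgue M) = emeasure lebesgue M"
        using A1 by (simp add: mult.assoc[symmetric] flip: ennreal_mult)
      ultimately show "emeasure lebesgue (M \<inter> UNIV) \<le> ennreal (1 / A ^ Suc i) * emeasure W (M \<inter> UNIV)"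
        by simp
    qed auto
    then have "emeasure lebesgue ?G \<le> ennreal (1 / A ^ Suc i) * emeasure W ?G" by (simp add: G_eq)
    also have "\<dots> \<le> ennreal (1 / A ^ Suc i) * emeasure W P"
      using Pm by (intro mult_left_mono emeasure_mono) auto
    also have "\<dots> \<le> ennreal (1 / A ^ Suc i) * (ennreal (A ^ i) * (2 ^ CARD('n) * emeasure lebesgue P))"
      using WP by (intro mult_left_mono) auto
    also have "\<dots> = ennreal (1 / A ^ Suc i * A ^ i * 2 ^ CARD('n)) * emeasure lebesgue P"
    proof -
      have two: "(2::ennreal) ^ CARD('n) = ennreal (2 ^ CARD('n))" by (simp flip: ennreal_power)
      have "ennreal a * (ennreal b * (ennreal c * p)) = ennreal (a * b * c) * p"
        if "0 \<le> a" "0 \<le> b" "0 \<le> c" for a b c p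
        using that by (simp add: ennreal_mult mult.assoc)
      then show ?thesis unfolding two using A1 by simp
    qed
    also have "1 / A ^ Suc i * A ^ i * 2 ^ CARD('n) = 1 / 2"
      using A1 by (simp add: A_def)
    finally have G_half: "emeasure lebesgue ?G \<le> ennreal (1/2) * emeasure lebesgue P" .
    have split: "emeasure L P = emeasure L ?G + emeasure L (P - ?G)" if "sets L = sets lebesgue" for L
      using plus_emeasure[of ?G L "P - ?G"] Gs Pm that by (simp add: Un_absorb1)
    have "emeasure W P \<le> emeasure W R" using Pc Rs by (intro emeasure_mono) auto
    then have WPfin: "emeasure W P < \<infinity>" using WR Rfin by simp
    have "emeasure lebesgue P \<le> 2 * emeasure lebesgue (P - ?G)"
    proof -
      have "p \<le> 2 * v" if uv: "u \<le> ennreal (1/2) * p" "p = u + v" "p < \<infinity>" for p u v :: ennreal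
      proof -
        obtain a b where ab: "u = ennreal a" "v = ennreal b" "0 \<le> a" "0 \<le> b"
          using uv(2,3) by (cases u; cases v) auto
        then have p: "p = ennreal (a + b)" using uv by simp
        have "ennreal a \<le> ennreal (1/2 * (a + b))"
          using uv(1) ab unfolding p by (subst ennreal_mult) auto
        then have "a \<le> b" using ab by (simp add: ennreal_le_iff)
        then have "ennreal (a + b) \<le> ennreal (2 * b)" by (intro ennreal_leI) simp
        then show ?thesis using ab p by (simp add: ennreal_mult)
      qed
      from this[OF G_half split[of lebesgue]] show ?thesis using Pm(3) by simp
    qed
    \<comment> \<open>\<open>P - ?G\<close> has at least half of the volume of \<open>P\<close>, so
      \<open>good\<close> applies to it, and the fraction \<open>c\<close> of the weighted mass
      never reaches the next level set.\<close>
    then have "ennreal c * emeasure W P \<le> emeasure W (P - ?G)"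
      using Pm Gs by (intro good[OF Pc free]) auto
    then show ?thesis
      using split[of W] WPfin c
      by (cases "emeasure W ?G"; cases "emeasure W (P - ?G)")
         (auto simp: ennreal_mult[symmetric] ennreal_plus[symmetric] algebra_simps simp del: ennreal_plus)
  qed
  have decay: "emeasure W (\<Omega> (Suc i)) \<le> ennreal ((1 - c) ^ i) * emeasure lebesgue R" for i
  proof (induction i)
    case 0
    then show ?case using emeasure_mono[OF Om_R, of W 1] Rs WR by simp
  next
    case (Suc i)
    have "emeasure W (\<Union>(tops (T (Suc i))) \<inter> \<Omega> (Suc (Suc i))) \<le> ennreal (1 - c) * emeasure W (\<Union>(tops (T (Suc i))) \<inter> UNIV)"
      using tops_countable[OF Tc] tops_disjoint[OF Tc] step[of _ "Suc i"] tops_cells[OF Tc] cells_measure(1)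
      by (intro emeasure_disjoint_Union_le) auto
    moreover have "\<Union>(tops (T (Suc i))) \<inter> \<Omega> (Suc (Suc i)) = \<Omega> (Suc (Suc i))"
      using T_mono Union_tops[OF Tc] by (auto simp: \<Omega>_def)
    ultimately have "emeasure W (\<Omega> (Suc (Suc i))) \<le> ennreal (1 - c) * emeasure W (\<Omega> (Suc i))"
      by (simp add: Union_tops[OF Tc] \<Omega>_def)
    also have "\<dots> \<le> ennreal (1 - c) * (ennreal ((1 - c) ^ i) * emeasure lebesgue R)"
      by (intro mult_left_mono Suc) auto
    also have "\<dots> = ennreal ((1 - c) ^ Suc i) * emeasure lebesgue R"
      using c by (simp add: ennreal_mult mult.assoc)
    finally show ?case .
  qed
  obtain j0 x0 where jx0: "R = cell j0 x0" using R by (auto simp: cells_def)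
  have "AE x in lebesgue. \<forall>i. ennreal (A ^ i) < ennreal (y x) \<longrightarrow>
      (\<exists>j\<ge>j0. ennreal (A ^ i) * emeasure lebesgue (cell j x) < emeasure W (cell j x))"
    unfolding W_def AE_all_countable using A1 by (intro allI AE_cell_average_greater) auto
  then have AE: "AE x in lebesgue. x \<in> R - \<Union>S \<longrightarrow> (\<forall>i. A ^ i < y x \<longrightarrow> x \<in> \<Omega> i)"
  proof (rule AE_mp, intro AE_I2 impI allI)
    fix x i
    assume *: "\<forall>i. ennreal (A ^ i) < ennreal (y x) \<longrightarrow>
      (\<exists>j\<ge>j0. ennreal (A ^ i) * emeasure lebesgue (cell j x) < emeasure W (cell j x))"
      and x: "x \<in> R - \<Union>S" and "A ^ i < y x"
    then have "ennreal (A ^ i) < ennreal (y x)" using A1 by (simp add: ennreal_less_iff)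
    then obtain j where j: "j \<ge> j0" "ennreal (A ^ i) * emeasure lebesgue (cell j x) < emeasure W (cell j x)"
      using * by blast
    have "cell j x \<subseteq> R" using cell_antimono[OF j(1), of x] x cell_eq[of x j0 x0] jx0 by auto
    moreover have "\<not> (\<exists>M\<in>S. cell j x \<subseteq> M)" using x cell_self[of x j] by blast
    ultimately have "cell j x \<in> T i" using j by (auto simp: T_def)
    then show "x \<in> \<Omega> i" using cell_self[of x j] unfolding \<Omega>_def by blast
  qed
  \<comment> \<open>One more level multiplies the bound for \<open>y x powr (\<theta> - 1)\<close>
    by at most \<open>q\<close>, while the mass decays by \<open>1 - c\<close>. With this
    \<open>q\<close> the ratio \<open>q * (1 - c)\<close> is at most \<open>1 - 3 * c / 4\<close>,
    and the series contributes at most \<open>q / 3\<close>.\<close>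
  define q where "q = 1 + c / 4"
  have q: "1 < q" using c by (simp add: q_def)
  have "1 - q * (1 - c) = 3 * c / 4 + c * c / 4" by (simp add: q_def field_simps)
  then have d: "3 * c / 4 \<le> 1 - q * (1 - c)" using c by simp
  \<comment> \<open>\<open>q ^ Suc k\<close> is \<open>q\<close> plus the increments
    \<open>(q - 1) * q ^ Suc i\<close> for \<open>i < k\<close>. Increment \<open>i\<close> is
    charged to \<open>\<Omega> (Suc i)\<close>, which contains almost every point of
    \<open>R - \<Union>S\<close> with \<open>A ^ Suc i < y x\<close>.\<close>
  let ?g = "\<lambda>x. ennreal q * (ennreal (y x) * indicator R x) +
      (\<Sum>i. ennreal ((q - 1) * q ^ Suc i) * (ennreal (y x) * indicator (\<Omega> (Suc i)) x))"
  have "AE x in lebesgue. ennreal (y x powr \<theta>) * indicator (R - \<Union>S) x \<le> ?g x"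
    using AE
  proof (rule AE_mp, intro AE_I2 impI)
    fix x assume *: "x \<in> R - \<Union>S \<longrightarrow> (\<forall>i. A ^ i < y x \<longrightarrow> x \<in> \<Omega> i)"
    show "ennreal (y x powr \<theta>) * indicator (R - \<Union>S) x \<le> ?g x"
    proof (cases "x \<in> R - \<Union>S")
      case True
      define k where "k = (LEAST k. y x \<le> A ^ Suc k)"
      obtain k0 where "y x < A ^ k0" using real_arch_pow[OF A1] by blast
      then have "y x \<le> A ^ Suc k0" using A1 power_increasing[of k0 "Suc k0" A] by linarith
      then have k: "y x \<le> A ^ Suc k" unfolding k_def by (rule LeastI)
      have Om: "x \<in> \<Omega> (Suc i)" if "i < k" for i
        using not_less_Least[of i "\<lambda>k. y x \<le> A ^ Suc k"] that * True by (auto simp: k_def)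
      have "y x powr \<theta> = y x * y x powr (\<theta> - 1)"
        using y_pos[of x] by (simp add: powr_diff)
      also have "\<dots> \<le> y x * (A ^ Suc k) powr (\<theta> - 1)"
        using y_pos[of x] k th A1 by (intro mult_left_mono powr_mono2) (auto simp: less_imp_le)
      also have "(A ^ Suc k) powr (\<theta> - 1) = (A powr (\<theta> - 1)) ^ Suc k"
      proof -
        have "(A ^ m) powr s = (A powr s) ^ m" for m s
          using A1 by (induction m) (auto simp: powr_mult)
        then show ?thesis .
      qed
      also have "y x * \<dots> \<le> y x * q ^ Suc k"
        using y_pos[of x] th A1 by (intro mult_left_mono power_mono) (auto simp: A_def q_def less_imp_le)
      also have "q ^ Suc k = q + (\<Sum>i<k. (q - 1) * q ^ Suc i)"
        by (induction k) (auto simp: algebra_simps)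
      finally have "ennreal (y x powr \<theta>) \<le> ennreal (y x * (q + (\<Sum>i<k. (q - 1) * q ^ Suc i)))"
        by (rule ennreal_leI)
      also have "\<dots> = ennreal q * ennreal (y x) + (\<Sum>i<k. ennreal ((q - 1) * q ^ Suc i) * ennreal (y x))"
        using q y_pos[of x]
        by (simp add: distrib_left sum_distrib_left sum_nonneg mult.commute less_imp_le flip: ennreal_mult sum_ennreal)
      also have "(\<Sum>i<k. ennreal ((q - 1) * q ^ Suc i) * ennreal (y x)) =
          (\<Sum>i<k. ennreal ((q - 1) * q ^ Suc i) * (ennreal (y x) * indicator (\<Omega> (Suc i)) x))"
        using Om by (intro sum.cong) auto
      also have "\<dots> \<le> (\<Sum>i. ennreal ((q - 1) * q ^ Suc i) * (ennreal (y x) * indicator (\<Omega> (Suc i)) x))"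
        by (intro sum_le_suminf) auto
      finally show ?thesis using True by (simp add: add_left_mono)
    qed simp
  qed
  then have "(\<integral>\<^sup>+x. ennreal (y x powr \<theta>) * indicator (R - \<Union>S) x \<partial>lebesgue) \<le> (\<integral>\<^sup>+x. ?g x \<partial>lebesgue)"
    by (rule nn_integral_mono_AE)
  also have "\<dots> = ennreal q * emeasure W R + (\<Sum>i. ennreal ((q - 1) * q ^ Suc i) * emeasure W (\<Omega> (Suc i)))"
    using Rs by (simp add: nn_integral_add nn_integral_cmult nn_integral_suminf W_def emeasure_density)
  also have "\<dots> \<le> ennreal q * emeasure lebesgue R +
      (\<Sum>i. ennreal ((q - 1) * q * (q * (1 - c)) ^ i) * emeasure lebesgue R)"
  proof (intro add_mono suminf_le)
    fix i
    have "ennreal ((q - 1) * q ^ Suc i) * emeasure W (\<Omega> (Suc i)) \<le>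
      ennreal ((q - 1) * q ^ Suc i) * (ennreal ((1 - c) ^ i) * emeasure lebesgue R)"
      by (intro mult_left_mono decay) auto
    also have "\<dots> = ennreal ((q - 1) * q * (q * (1 - c)) ^ i) * emeasure lebesgue R"
    proof -
      have m: "ennreal a * (ennreal b * r) = ennreal (a * b) * r" if "0 \<le> a" "0 \<le> b" for a b r
        using that by (simp add: ennreal_mult mult.assoc)
      have "(q - 1) * q ^ Suc i * (1 - c) ^ i = (q - 1) * q * (q * (1 - c)) ^ i"
        by (simp add: power_mult_distrib)
      then show ?thesis
        using m[of "(q - 1) * q ^ Suc i" "(1 - c) ^ i"] q c by (simp only:) simp
    qed
    finally show "ennreal ((q - 1) * q ^ Suc i) * emeasure W (\<Omega> (Suc i)) \<le> \<dots>" .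
  qed (use WR in auto)
  also have "(\<Sum>i. ennreal ((q - 1) * q * (q * (1 - c)) ^ i) * emeasure lebesgue R) =
      (\<Sum>i. ennreal ((q - 1) * q * (q * (1 - c)) ^ i)) * emeasure lebesgue R"
    by (rule ennreal_suminf_multc)
  also have "(\<Sum>i. ennreal ((q - 1) * q * (q * (1 - c)) ^ i)) = ennreal ((q - 1) * q * (1 / (1 - q * (1 - c))))"
  proof (rule suminf_ennreal_eq)
    have "q * (1 - c) < 1" "0 \<le> q * (1 - c)"
      using c q d by auto
    then show "(\<lambda>i. (q - 1) * q * (q * (1 - c)) ^ i) sums ((q - 1) * q * (1 / (1 - q * (1 - c))))"
      by (intro sums_mult geometric_sums) auto
    show "0 \<le> (q - 1) * q * (q * (1 - c)) ^ i" for i using q c by auto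
  qed
  also have "ennreal q * emeasure lebesgue R + ennreal ((q - 1) * q * (1 / (1 - q * (1 - c)))) * emeasure lebesgue R
      \<le> 2 * emeasure lebesgue R"
  proof -
    have "(q - 1) * q * (1 / (1 - q * (1 - c))) = c / 4 * q / (1 - q * (1 - c))"
      by (simp add: q_def)
    also have "\<dots> \<le> c / 4 * q / (3 * c / 4)"
      using d c q by (intro frac_le) auto
    also have "\<dots> = q / 3" using c by simp
    finally have "q + (q - 1) * q * (1 / (1 - q * (1 - c))) \<le> 2" using c by (simp add: q_def)
    then have "ennreal (q + (q - 1) * q * (1 / (1 - q * (1 - c)))) \<le> ennreal 2" by (rule ennreal_leI)
    moreover have "0 \<le> (q - 1) * q * (1 / (1 - q * (1 - c)))" using d c q by auto
    ultimately have "ennreal q + ennreal ((q - 1) * q * (1 / (1 - q * (1 - c)))) \<le> 2" using q by simp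
    from mult_right_mono[OF this, of "emeasure lebesgue R"] show ?thesis by (simp add: distrib_right)
  qed
  finally show ?thesis .
qed

end

section \<open>The modular on sets\<close>

text \<open>The measure of \<open>A\<close> is the modular of the function equal to \<open>s\<close>
  on \<open>A\<close> and 0 elsewhere. In this form additivity over disjoint cells is available at
  each level.\<close>

definition rho :: "(real^'n \<Rightarrow> real) \<Rightarrow> real \<Rightarrow> (real^'n) measure" where
  "rho q s = density lebesgue (\<lambda>x. ennreal (s powr q x))"

lemma sets_rho [simp]: "sets (rho q s) = sets lebesgue"
  by (simp add: rho_def)

lemma space_rho [simp]: "space (rho q s) = UNIV"
  by (simp add: rho_def)

locale exponent =
  fixes q :: "real^'n \<Rightarrow> real" and pp :: real
  assumes q_meas [measurable]: "q \<in> borel_measurable lebesgue"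
    and q_ge1: "1 \<le> q x" and q_le: "q x \<le> pp"
begin

lemma pp_ge1: "1 \<le> pp"
  using q_ge1 q_le order_trans by blast

lemma emeasure_rho:
  "A \<in> sets lebesgue \<Longrightarrow> emeasure (rho q s) A = (\<integral>\<^sup>+x. ennreal (s powr q x) * indicator A x \<partial>lebesgue)"
  by (simp add: rho_def emeasure_density)

lemma rho_scale:
  assumes "0 \<le> s" "1 \<le> k" "A \<in> sets lebesgue"
  shows "emeasure (rho q (k * s)) A \<le> ennreal (k powr pp) * emeasure (rho q s) A"
    and "ennreal k * emeasure (rho q s) A \<le> emeasure (rho q (k * s)) A"
proof -
  have 1: "ennreal ((k * s) powr q x) \<le> ennreal (k powr pp) * ennreal (s powr q x)"
    and 2: "ennreal k * ennreal (s powr q x) \<le> ennreal ((k * s) powr q x)" for x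
  proof -
    have "k powr q x \<le> k powr pp" using q_le assms by (intro powr_mono) auto
    moreover have "k powr 1 \<le> k powr q x" using q_ge1 assms by (intro powr_mono) auto
    ultimately show "ennreal ((k * s) powr q x) \<le> ennreal (k powr pp) * ennreal (s powr q x)"
      "ennreal k * ennreal (s powr q x) \<le> ennreal ((k * s) powr q x)"
      using assms by (auto simp: powr_mult intro!: ennreal_leI mult_right_mono simp flip: ennreal_mult)
  qed
  have "emeasure (rho q (k * s)) A \<le> (\<integral>\<^sup>+x. ennreal (k powr pp) * (ennreal (s powr q x) * indicator A x) \<partial>lebesgue)"
    using assms 1 by (auto simp: emeasure_rho indicator_def intro!: nn_integral_mono)
  also have "\<dots> = ennreal (k powr pp) * emeasure (rho q s) A"
    using assms by (simp add: emeasure_rho nn_integral_cmult)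
  finally show "emeasure (rho q (k * s)) A \<le> ennreal (k powr pp) * emeasure (rho q s) A" .
  have "ennreal k * emeasure (rho q s) A = (\<integral>\<^sup>+x. ennreal k * (ennreal (s powr q x) * indicator A x) \<partial>lebesgue)"
    using assms by (simp add: emeasure_rho nn_integral_cmult)
  also have "\<dots> \<le> emeasure (rho q (k * s)) A"
    using assms 2 by (auto simp: emeasure_rho indicator_def intro!: nn_integral_mono)
  finally show "ennreal k * emeasure (rho q s) A \<le> emeasure (rho q (k * s)) A" .
qed

lemma rho_le_ratio:
  assumes "0 < t" "t \<le> u" "A \<in> sets lebesgue"
  shows "emeasure (rho q t) A \<le> ennreal (t / u) * emeasure (rho q u) A"
proof -
  have "ennreal (u / t) * emeasure (rho q t) A \<le> emeasure (rho q u) A"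
    using rho_scale(2)[of t "u / t" A] assms by simp
  then have "ennreal (t / u) * (ennreal (u / t) * emeasure (rho q t) A) \<le> ennreal (t / u) * emeasure (rho q u) A"
    by (rule mult_left_mono) simp
  also have "ennreal (t / u) * (ennreal (u / t) * emeasure (rho q t) A) = emeasure (rho q t) A"
    using assms by (simp add: mult.assoc[symmetric] flip: ennreal_mult)
  finally show ?thesis .
qed

lemma rho_mono:
  assumes "0 \<le> t" "t \<le> u" "A \<in> sets lebesgue"
  shows "emeasure (rho q t) A \<le> emeasure (rho q u) A"
proof -
  have "t powr q x \<le> u powr q x" for x
    using assms q_ge1[of x] by (intro powr_mono2) auto
  then show ?thesis
    using assms by (auto simp: emeasure_rho intro!: nn_integral_mono mult_right_mono ennreal_leI)
qed

lemma rho_finite: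
  assumes "0 \<le> s" "A \<in> sets lebesgue" "emeasure lebesgue A < \<infinity>"
  shows "emeasure (rho q s) A < \<infinity>"
proof -
  have "s powr q x \<le> 1 + s powr pp" for x
  proof (cases "s \<le> 1")
    case True
    then have "s powr q x \<le> 1" using assms q_ge1[of x] by (intro powr_le1) auto
    then show ?thesis by (simp add: add_increasing2)
  next
    case False
    then have "s powr q x \<le> s powr pp" using q_le by (intro powr_mono) auto
    then show ?thesis by simp
  qed
  then have "ennreal (s powr q x) \<le> ennreal (1 + s powr pp)" for x by (rule ennreal_leI)
  then have "emeasure (rho q s) A \<le> (\<integral>\<^sup>+x. ennreal (1 + s powr pp) * indicator A x \<partial>lebesgue)"
    unfolding emeasure_rho[OF assms(2)] by (intro nn_integral_mono mult_right_mono) auto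
  also have "\<dots> = ennreal (1 + s powr pp) * emeasure lebesgue A"
    using assms by (simp add: nn_integral_cmult_indicator)
  also have "\<dots> < \<infinity>" using assms by (simp add: ennreal_mult_less_top)
  finally show ?thesis .
qed

lemma rho_pos:
  assumes "0 < s" "A \<in> sets lebesgue" "0 < emeasure lebesgue A"
  shows "0 < emeasure (rho q s) A"
proof (rule ccontr)
  assume "\<not> 0 < emeasure (rho q s) A"
  then have "A \<in> null_sets (rho q s)" using assms by auto
  then have "AE x in lebesgue. x \<in> A \<longrightarrow> ennreal (s powr q x) = 0"
    unfolding rho_def by (subst (asm) null_sets_density_iff) auto
  then have "AE x in lebesgue. x \<notin> A" using assms by simp
  then have "A \<in> null_sets lebesgue" using assms(2) by (simp add: AE_iff_null_sets)
  then show False using assms(3) by auto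
qed

end

section \<open>The condition \<open>A\<^sub>\<infinity>\<close> for sets of small density\<close>

text \<open>\<open>A_infty\<close> with all coefficients equal to \<open>s\<close> and
  \<open>E Q = A \<inter> Q\<close>. By homogeneity of the norm the constant moves into the level
  \<open>s / C\<close>, and only modulars are left in the statement.\<close>

definition set_A_infty :: "(real^'n \<Rightarrow> real) \<Rightarrow> real \<Rightarrow> real \<Rightarrow> bool" where
  "set_A_infty q r C \<longleftrightarrow> (\<forall>F A s. (\<forall>Q\<in>F. is_cube Q) \<longrightarrow> disjoint F \<longrightarrow> A \<in> sets lebesgue \<longrightarrow> 0 < s \<longrightarrow>
     (\<forall>Q\<in>F. ennreal r * emeasure lebesgue Q \<le> emeasure lebesgue (A \<inter> Q)) \<longrightarrow>
     emeasure (rho q s) (A \<inter> \<Union>F) \<le> 1 \<longrightarrow> emeasure (rho q (s / C)) (\<Union>F) \<le> 1)"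

text \<open>Linear interpolation of the lower corner from \<open>a + d\<close> to \<open>a\<close>
  and of the side from \<open>l / 2\<close> to \<open>l\<close>. Per step the lower ends move down
  by \<open>d $ k / (N + 1)\<close> and the upper ends up by
  \<open>(l / 2 - d $ k) / (N + 1)\<close>, so the bounds on \<open>d\<close> give nesting.\<close>

lemma hcube_chain:
  fixes a d :: "real^'n" and l :: real and N :: nat
  defines "J \<equiv> \<lambda>i. hcube (\<chi> k. a $ k + (1 - real i / real (Suc N)) * d $ k) (l * (1/2 + real i / (2 * real (Suc N))))"
  assumes l: "0 < l" and d: "\<And>k. 0 \<le> d $ k \<and> d $ k \<le> l / 2"
  shows "J i \<subseteq> J (Suc i)" "J 0 = hcube (a + d) (l / 2)" "J (Suc N) = hcube a l" "is_cube (J i)"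
proof -
  define n where "n = real (Suc N)"
  have n: "0 < n" and nS: "real (Suc N) = n" "real (Suc (Suc N)) = n + 1" "real (Suc i) = real i + 1"
    by (simp_all add: n_def)
  show "J i \<subseteq> J (Suc i)"
  proof
    fix x assume x: "x \<in> J i"
    have "a $ k + (1 - real (Suc i) / real (Suc N)) * d $ k \<le> x $ k \<and>
      x $ k < a $ k + (1 - real (Suc i) / real (Suc N)) * d $ k + l * (1/2 + real (Suc i) / (2 * real (Suc N)))" for k
    proof -
      have "a $ k + (1 - real i / real (Suc N)) * d $ k \<le> x $ k \<and>
        x $ k < a $ k + (1 - real i / real (Suc N)) * d $ k + l * (1/2 + real i / (2 * real (Suc N)))"
        using x by (auto simp: J_def hcube_def)
      moreover have "(1 - real i / real (Suc N)) * d $ k = (1 - real (Suc i) / real (Suc N)) * d $ k + d $ k / real (Suc N)"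
        using n by (simp add: field_simps nS del: of_nat_Suc)
      moreover have "l * (1/2 + real (Suc i) / (2 * real (Suc N))) = l * (1/2 + real i / (2 * real (Suc N))) + l / 2 / real (Suc N)"
        using n by (simp add: field_simps nS del: of_nat_Suc)
      moreover have "0 \<le> d $ k / real (Suc N)"
        using d[of k] by simp
      moreover have "d $ k / real (Suc N) \<le> l / 2 / real (Suc N)"
        using d[of k] by (intro divide_right_mono) auto
      ultimately show ?thesis by linarith
    qed
    then show "x \<in> J (Suc i)" by (auto simp: J_def hcube_def)
  qed
  show "J 0 = hcube (a + d) (l / 2)" "J (Suc N) = hcube a l"
    using n by (simp_all add: J_def hcube_def nS del: of_nat_Suc)
  show "is_cube (J i)"
    unfolding J_def using l by (intro is_cube_hcube mult_pos_pos add_pos_nonneg) auto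
qed

text \<open>Consecutive sides have the ratio \<open>(N + 1 + i) / (N + 2 + i)\<close>, smallest at
  \<open>i = 0\<close>. It tends to 1 with \<open>N\<close>, whereas the volume ratio of a child to
  its parent may lie below the density that \<open>A_infty\<close> requires.\<close>

lemma chain_side_ratio:
  fixes l :: real
  assumes l: "0 < l"
  shows "(real (Suc N) / real (Suc (Suc N))) ^ m * (l * (1/2 + real (Suc i) / (2 * real (Suc N)))) ^ m
       \<le> (l * (1/2 + real i / (2 * real (Suc N)))) ^ m"
proof -
  define n where "n = real (Suc N)"
  have n: "0 < n" and nS: "real (Suc N) = n" "real (Suc (Suc N)) = n + 1" "real (Suc i) = real i + 1"
    by (simp_all add: n_def)
  have "real (Suc N) / real (Suc (Suc N)) * (1/2 + real (Suc i) / (2 * real (Suc N))) \<le> 1/2 + real i / (2 * real (Suc N))"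
  proof -
    have "real (Suc N) / real (Suc (Suc N)) * (1/2 + real (Suc i) / (2 * real (Suc N))) =
        (real (Suc N) + real (Suc i)) / (2 * real (Suc (Suc N)))"
    proof -
      have "n + 1 \<noteq> 0" using n by simp
      moreover have "1/2 + z / (2 * n) = (n + z) / (2 * n)" for z using n by (simp add: field_simps)
      ultimately show ?thesis unfolding nS using n by simp
    qed
    also have "\<dots> \<le> (real (Suc N) + real i) / (2 * real (Suc N))"
      using n by (simp add: field_simps nS del: of_nat_Suc)
    also have "\<dots> = 1/2 + real i / (2 * real (Suc N))"
      using n by (simp add: field_simps nS del: of_nat_Suc)
    finally show ?thesis .
  qed
  then have "l * (real (Suc N) / real (Suc (Suc N)) * (1/2 + real (Suc i) / (2 * real (Suc N)))) \<le> l * (1/2 + real i / (2 * real (Suc N)))"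
    using l by (intro mult_left_mono) auto
  then have "(real (Suc N) / real (Suc (Suc N))) * (l * (1/2 + real (Suc i) / (2 * real (Suc N)))) \<le> l * (1/2 + real i / (2 * real (Suc N)))"
    by (simp add: mult_ac)
  then show "(real (Suc N) / real (Suc (Suc N))) ^ m * (l * (1/2 + real (Suc i) / (2 * real (Suc N)))) ^ m
       \<le> (l * (1/2 + real i / (2 * real (Suc N)))) ^ m"
    using l unfolding power_mult_distrib[symmetric] by (intro power_mono) auto
qed

section \<open>Lowering the density in the condition for cells\<close>

context dyadic_grid
begin

definition cells_A_infty :: "(real^'n \<Rightarrow> real) \<Rightarrow> real \<Rightarrow> real \<Rightarrow> bool" where
  "cells_A_infty q r C \<longleftrightarrow> (\<forall>F A s. F \<subseteq> cells \<longrightarrow> disjoint F \<longrightarrow> A \<in> sets lebesgue \<longrightarrow> 0 < s \<longrightarrow>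
     (\<forall>Q\<in>F. ennreal r * emeasure lebesgue Q \<le> emeasure lebesgue (A \<inter> Q)) \<longrightarrow>
     emeasure (rho q s) (A \<inter> \<Union>F) \<le> 1 \<longrightarrow> emeasure (rho q (s / C)) (\<Union>F) \<le> 1)"

lemma corner_Suc:
  "0 \<le> corner (Suc j) x $ k - corner j x $ k \<and> corner (Suc j) x $ k - corner j x $ k \<le> (h / 2 ^ j) / 2"
proof -
  have "idx (Suc j) x k = 2 * idx j x k \<or> idx (Suc j) x k = 2 * idx j x k + 1"
    using idx_half[of j x k] by (simp; presburger)
  then show ?thesis
    using h_pos by (auto simp: corner_def field_simps)
qed

text \<open>
  A child grows to its parent through \<open>N + 1\<close> intermediate cubes, each of which occupies at least
  the fraction \<open>r\<close> of the next one.
\<close>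

lemma parent_chain:
  fixes q :: "real^'n \<Rightarrow> real"
  assumes AI: "set_A_infty q r C" and C: "1 \<le> C"
    and N: "r \<le> (real (Suc N) / real (Suc (Suc N))) ^ CARD('n)"
    and F: "F \<subseteq> cells" "disjoint F"
    and ch: "\<And>M. M \<in> F \<Longrightarrow> M = cell (j M) (x M)"
    and s: "0 < s" and le: "emeasure (rho q s) (\<Union>M\<in>F. cell (Suc (j M)) (x M)) \<le> 1"
  shows "emeasure (rho q (s / C ^ Suc N)) (\<Union>F) \<le> 1"
proof -
  define a where "a M = corner (j M) (x M)" for M
  define d where "d M = corner (Suc (j M)) (x M) - corner (j M) (x M)" for M
  define l where "l M = h / 2 ^ j M" for M
  define J where "J M i = hcube (\<chi> k. a M $ k + (1 - real i / real (Suc N)) * d M $ k) (l M * (1/2 + real i / (2 * real (Suc N))))" for M i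
  have l: "0 < l M" and d: "0 \<le> d M $ k \<and> d M $ k \<le> l M / 2" for M k
    using h_pos corner_Suc[of "j M" "x M" k] by (auto simp: l_def d_def)
  note chain = hcube_chain[where a = "a M" and d = "d M" and l = "l M" and N = N for M, OF l d, folded J_def]
  have J_Suc: "J M i \<subseteq> J M (Suc i)" for M i by (rule chain(1))
  have J_0: "J M 0 = cell (Suc (j M)) (x M)" for M
  proof -
    have "a M + d M = corner (Suc (j M)) (x M)" "l M / 2 = h / 2 ^ Suc (j M)"
      by (simp_all add: a_def d_def l_def)
    then show ?thesis unfolding chain(2) cell_hcube by (simp only:)
  qed
  have J_N: "J M (Suc N) = M" if "M \<in> F" for M
    using chain(3)[of M] ch[OF that] by (simp add: cell_hcube a_def l_def)
  have J_mono: "i \<le> i' \<Longrightarrow> J M i \<subseteq> J M i'" for M i i'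
    by (rule lift_Suc_antimono_le[of "\<lambda>i. - J M i", simplified]) (use J_Suc in auto)
  have cF: "countable F" using F(1) countable_cells countable_subset by blast
  have Jm: "J M i \<in> sets lebesgue" for M i using is_cube_measure(1)[OF chain(4)] .
  have "i \<le> Suc N \<Longrightarrow> emeasure (rho q (s / C ^ i)) (\<Union>M\<in>F. J M i) \<le> 1" for i
  proof (induction i)
    case 0
    then show ?case using le by (simp add: J_0)
  next
    case (Suc i)
    let ?F = "(\<lambda>M. J M (Suc i)) ` F" and ?A = "\<Union>M\<in>F. J M i"
    have sub: "J M (Suc i) \<subseteq> M" if "M \<in> F" for M
      using J_mono[OF Suc.prems, of M] J_N[OF that] by simp
    have "emeasure (rho q (s / C ^ i / C)) (\<Union>?F) \<le> 1"
    proof (rule AI[unfolded set_A_infty_def, rule_format, of ?F ?A "s / C ^ i"])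
      show "is_cube Q" if "Q \<in> ?F" for Q using that chain(4) by auto
      show "disjoint ?F"
      proof (rule disjointI)
        fix P Q assume "P \<in> ?F" "Q \<in> ?F" "P \<noteq> Q"
        then obtain M M' where "M \<in> F" "M' \<in> F" "M \<noteq> M'" "P \<subseteq> M" "Q \<subseteq> M'"
          using sub by auto
        then show "P \<inter> Q = {}" using disjointD[OF F(2), of M M'] by auto
      qed
      show A: "?A \<in> sets lebesgue" using cF Jm by (intro sets.countable_UN') auto
      show "0 < s / C ^ i" using s C by simp
      show "ennreal r * emeasure lebesgue Q \<le> emeasure lebesgue (?A \<inter> Q)" if "Q \<in> ?F" for Q
      proof -
        obtain M where M: "M \<in> F" "Q = J M (Suc i)" using \<open>Q \<in> ?F\<close> by auto
        have pos: "0 < l M * (1/2 + real i / (2 * real (Suc N)))" for i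
          using l by (intro mult_pos_pos add_pos_nonneg) auto
        have "ennreal r * emeasure lebesgue Q \<le> ennreal ((real (Suc N) / real (Suc (Suc N))) ^ CARD('n)) *
            ennreal ((l M * (1/2 + real (Suc i) / (2 * real (Suc N)))) ^ CARD('n))"
          unfolding M J_def hcube_measure(2)[OF pos] using N by (intro mult_right_mono ennreal_leI) auto
        also have "\<dots> \<le> ennreal ((l M * (1/2 + real i / (2 * real (Suc N)))) ^ CARD('n))"
          using chain_side_ratio[OF l, of N "CARD('n)" M i] pos[of "Suc i"]
          by (subst ennreal_mult[symmetric]) (auto intro!: ennreal_leI zero_le_power simp: less_imp_le)
        also have "\<dots> = emeasure lebesgue (J M i)"
          unfolding J_def hcube_measure(2)[OF pos] ..
        also have "\<dots> \<le> emeasure lebesgue (?A \<inter> Q)"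
          using M J_Suc A Jm by (intro emeasure_mono) auto
        finally show ?thesis .
      qed
      have "emeasure (rho q (s / C ^ i)) (?A \<inter> \<Union>?F) \<le> emeasure (rho q (s / C ^ i)) ?A"
        using A by (intro emeasure_mono) auto
      also have "\<dots> \<le> 1" using Suc by simp
      finally show "emeasure (rho q (s / C ^ i)) (?A \<inter> \<Union>?F) \<le> 1" .
    qed
    then show ?case by (simp add: mult.commute)
  qed
  from this[of "Suc N"] show ?thesis using J_N by simp
qed

text \<open>
  The density is lowered by the factor \<open>r\<close> by passing from \<open>A\<close> to the union of the maximal cells with
  a child in which \<open>A\<close> has density above \<open>r\<close>: by maximality, the density of \<open>A\<close> in each of them is at most \<open>r\<close>.
\<close>

lemma cells_A_infty_Suc:
  fixes q :: "real^'n \<Rightarrow> real"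
  assumes AI: "set_A_infty q r C" and r: "0 < r" "r < 1" and C: "1 \<le> C"
    and N: "r \<le> (real (Suc N) / real (Suc (Suc N))) ^ CARD('n)"
    and IH: "cells_A_infty q \<mu> K" and \<mu>: "0 < \<mu>" "\<mu> \<le> 1"
  shows "cells_A_infty q (r * \<mu>) (C * C ^ Suc N * K)"
  unfolding cells_A_infty_def
proof (intro allI impI)
  fix F A s
  assume F: "F \<subseteq> cells" "disjoint F" and A [measurable]: "A \<in> sets lebesgue" and s: "0 < s"
    and dens: "\<forall>Q\<in>F. ennreal (r * \<mu>) * emeasure lebesgue Q \<le> emeasure lebesgue (A \<inter> Q)"
    and le: "emeasure (rho q s) (A \<inter> \<Union>F) \<le> 1"
  \<comment> \<open>A cell enters through a dense child and not through its own density, so failure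
    at the parent of a maximal cell bounds the density in the maximal cell itself.\<close>
  define S where "S = {S \<in> cells. (\<exists>Q\<in>F. S \<subseteq> Q) \<and>
    (\<exists>j x. S = cell j x \<and> ennreal r * emeasure lebesgue (cell (Suc j) x) < emeasure lebesgue (cell (Suc j) x \<inter> A))}"
  have Sc: "S \<subseteq> cells" by (auto simp: S_def)
  let ?U = "\<Union>(tops S)"
  have Us: "?U \<in> sets lebesgue"
    using tops_countable[OF Sc] tops_cells[OF Sc] cells_measure(1) by (intro sets.countable_Union) auto
  have dens': "ennreal \<mu> * emeasure lebesgue Q \<le> emeasure lebesgue (?U \<inter> Q)" if Q: "Q \<in> F" for Q
  proof (cases "Q \<in> S")
    case True
    then have "?U \<inter> Q = Q" using Union_tops[OF Sc] by auto
    then show ?thesis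
      using \<mu> mult_right_mono[of "ennreal \<mu>" 1 "emeasure lebesgue Q"] by (simp add: ennreal_le_1)
  next
    case False
    have Qc: "Q \<in> cells" using Q F by auto
    then have Qs: "Q \<in> sets lebesgue" using cells_measure by auto
    obtain j0 x0 where jx0: "Q = cell j0 x0" using Qc by (auto simp: cells_def)
    \<comment> \<open>Generation at least \<open>Suc j0\<close>: the parent of the dense cell, which
      belongs to \<open>S\<close>, then still lies in \<open>Q\<close>.\<close>
    have "AE x in lebesgue. ennreal r < indicator A x \<longrightarrow>
      (\<exists>j\<ge>Suc j0. ennreal r * emeasure lebesgue (cell j x) < emeasure (density lebesgue (indicator A)) (cell j x))"
      using r by (intro AE_cell_average_greater) auto
    then have "AE x in lebesgue. x \<in> A \<inter> Q \<longrightarrow> x \<in> ?U \<inter> Q \<inter> A"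
    proof (rule AE_mp, intro AE_I2 impI)
      fix x assume *: "ennreal r < indicator A x \<longrightarrow>
        (\<exists>j\<ge>Suc j0. ennreal r * emeasure lebesgue (cell j x) < emeasure (density lebesgue (indicator A)) (cell j x))"
        and x: "x \<in> A \<inter> Q"
      then have "ennreal r < indicator A x" using r by (simp add: ennreal_less_iff flip: ennreal_1)
      then obtain i where i: "i \<ge> Suc j0" "ennreal r * emeasure lebesgue (cell i x) < emeasure (density lebesgue (indicator A)) (cell i x)"
        using * by blast
      obtain j where j: "i = Suc j" "j0 \<le> j" using i(1) by (cases i) auto
      have "emeasure (density lebesgue (indicator A)) (cell i x) = emeasure lebesgue (cell i x \<inter> A)"
        using cells_measure(1)[of "cell i x"] A
        by (simp add: emeasure_density indicator_inter_arith[symmetric] Int_commute)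
      moreover have "cell j x \<subseteq> Q" using cell_antimono[OF j(2), of x] x cell_eq[of x j0 x0] jx0 by auto
      ultimately have "cell j x \<in> S" using i j Q unfolding S_def by auto
      then have "x \<in> \<Union>S" using cell_self[of x j] by blast
      then show "x \<in> ?U \<inter> Q \<inter> A" using x Union_tops[OF Sc] by auto
    qed
    then have "emeasure lebesgue (A \<inter> Q) \<le> emeasure lebesgue (?U \<inter> Q \<inter> A)"
      using Us Qs by (intro emeasure_mono_AE) auto
    also have "\<dots> \<le> ennreal r * emeasure lebesgue (?U \<inter> Q)"
    proof -
      let ?T = "{M \<in> tops S. M \<subseteq> Q}"
      have eq: "?U \<inter> Q = \<Union>?T"
      proof
        show "?U \<inter> Q \<subseteq> \<Union>?T"
        proof
          fix x assume x: "x \<in> ?U \<inter> Q"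
          then obtain M where M: "M \<in> tops S" "x \<in> M" by blast
          then obtain Q' where "Q' \<in> F" "M \<subseteq> Q'" using tops_subset[OF Sc] unfolding S_def by blast
          then have "Q' = Q" using F(2) Q M x unfolding disjoint_def by blast
          with M \<open>M \<subseteq> Q'\<close> show "x \<in> \<Union>?T" by blast
        qed
      qed auto
      have "emeasure lebesgue (\<Union>?T \<inter> A) \<le> ennreal r * emeasure lebesgue (\<Union>?T \<inter> UNIV)"
      proof (rule emeasure_disjoint_Union_le)
        show "countable ?T" using tops_countable[OF Sc] by auto
        show "disjoint ?T" using tops_disjoint[OF Sc] by (auto simp: disjoint_def)
        fix M assume M: "M \<in> ?T"
        then show "M \<in> sets lebesgue" using tops_cells[OF Sc] cells_measure by auto
        have "M \<noteq> Q" using M False tops_subset[OF Sc] by auto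
        then have "M \<subset> Q" using M by auto
        then obtain j x where jx: "M = cell (Suc j) x" "cell j x \<subseteq> Q" "cell j x \<notin> S"
          using tops_parent[OF Sc _ Qc] M by blast
        then have "\<not> ennreal r * emeasure lebesgue (cell (Suc j) x) < emeasure lebesgue (cell (Suc j) x \<inter> A)"
          using Q unfolding S_def by auto
        then show "emeasure lebesgue (M \<inter> A) \<le> ennreal r * emeasure lebesgue (M \<inter> UNIV)"
          by (simp add: jx(1) not_less)
      qed auto
      then show ?thesis by (simp add: eq)
    qed
    finally have "ennreal (r * \<mu>) * emeasure lebesgue Q \<le> ennreal r * emeasure lebesgue (?U \<inter> Q)"
      using dens Q by (meson order_trans)
    then have "ennreal r * (ennreal \<mu> * emeasure lebesgue Q) \<le> ennreal r * emeasure lebesgue (?U \<inter> Q)"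
      using r \<mu> by (simp add: ennreal_mult mult.assoc)
    then show ?thesis using r by (simp add: ennreal_mult_le_mult_iff)
  qed
  have "\<forall>M\<in>tops S. \<exists>p. M = cell (fst p) (snd p) \<and>
    ennreal r * emeasure lebesgue (cell (Suc (fst p)) (snd p)) < emeasure lebesgue (cell (Suc (fst p)) (snd p) \<inter> A)"
    using tops_subset[OF Sc] unfolding S_def by fastforce
  then obtain p where p: "\<And>M. M \<in> tops S \<Longrightarrow> M = cell (fst (p M)) (snd (p M))"
    "\<And>M. M \<in> tops S \<Longrightarrow> ennreal r * emeasure lebesgue (cell (Suc (fst (p M))) (snd (p M))) < emeasure lebesgue (cell (Suc (fst (p M))) (snd (p M)) \<inter> A)"
    by metis
  let ?P = "\<lambda>M. cell (Suc (fst (p M))) (snd (p M))"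
  have PM: "?P M \<subseteq> M" if "M \<in> tops S" for M
    using p(1)[OF that] cell_Suc_subset by metis
  have SF: "\<Union>S \<subseteq> \<Union>F" by (auto simp: S_def)
  have FS: "\<Union>F \<in> sets lebesgue"
    using F countable_cells cells_measure(1) by (intro sets.countable_Union) (auto intro: countable_subset)
  \<comment> \<open>Three passages, each lowering the level: from \<open>A\<close> to the dense
    children by \<open>C\<close>, from these to the maximal cells by \<open>C ^ Suc N\<close>, and
    from the union of the maximal cells, of density at least \<mu> in each \<open>Q\<close>, to
    \<open>F\<close> by \<open>K\<close>.\<close>
  have 1: "emeasure (rho q (s / C)) (\<Union>M\<in>tops S. ?P M) \<le> 1"
  proof (rule AI[unfolded set_A_infty_def, rule_format, of "?P ` tops S" A s])
    show "is_cube Q" if "Q \<in> ?P ` tops S" for Q using that is_cube_cells by auto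
    show "disjoint (?P ` tops S)"
    proof (rule disjointI)
      fix P Q assume "P \<in> ?P ` tops S" "Q \<in> ?P ` tops S" "P \<noteq> Q"
      then obtain M M' where "M \<in> tops S" "M' \<in> tops S" "M \<noteq> M'" "P \<subseteq> M" "Q \<subseteq> M'"
        using PM by auto
      then show "P \<inter> Q = {}" using disjointD[OF tops_disjoint[OF Sc], of M M'] by auto
    qed
    show "ennreal r * emeasure lebesgue Q \<le> emeasure lebesgue (A \<inter> Q)" if "Q \<in> ?P ` tops S" for Q
      using that p(2) by (auto simp: Int_commute less_imp_le)
    have "\<Union> (?P ` tops S) \<subseteq> \<Union>F" using PM tops_subset[OF Sc] SF by blast
    then have "emeasure (rho q s) (A \<inter> \<Union> (?P ` tops S)) \<le> emeasure (rho q s) (A \<inter> \<Union>F)"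
      using FS by (intro emeasure_mono) auto
    with le show "emeasure (rho q s) (A \<inter> \<Union> (?P ` tops S)) \<le> 1" by simp
  qed (use s in auto)
  have 2: "emeasure (rho q (s / C / C ^ Suc N)) ?U \<le> 1"
    by (rule parent_chain[OF AI C N _ _ _ _ 1])
       (use tops_cells[OF Sc] tops_disjoint[OF Sc] p(1) s C in auto)
  have 3: "emeasure (rho q (s / C / C ^ Suc N)) (?U \<inter> \<Union>F) \<le> 1"
    using emeasure_mono[of "?U \<inter> \<Union>F" ?U "rho q (s / C / C ^ Suc N)"] Us 2 by simp
  have "emeasure (rho q (s / C / C ^ Suc N / K)) (\<Union>F) \<le> 1"
    by (rule IH[unfolded cells_A_infty_def, rule_format, of F ?U "s / C / C ^ Suc N"])
       (use F Us s C dens' 3 in auto)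
  then show "emeasure (rho q (s / (C * C ^ Suc N * K))) (\<Union>F) \<le> 1" by (simp add: mult_ac)
qed

end

text \<open>Repeating the reduction by the factor \<open>r\<close> reaches every positive density.
  One constant serves all grids; this uniformity is needed because the grids are translated and
  their coarsest side later tends to infinity.\<close>

lemma cells_A_infty_small:
  fixes q :: "real^'n \<Rightarrow> real"
  assumes AI: "set_A_infty q r C" and r: "0 < r" "r < 1" and C: "1 \<le> C" and \<mu>: "0 < \<mu>"
  shows "\<exists>K\<ge>1. \<forall>b h. 0 < h \<longrightarrow> dyadic_grid.cells_A_infty b h q \<mu> K"
proof -
  have "(\<lambda>N. (real N / real (Suc N)) ^ CARD('n)) \<longlonglongrightarrow> 1 ^ CARD('n)"
    by (intro tendsto_power LIMSEQ_n_over_Suc_n)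
  then have "\<forall>\<^sub>F N in sequentially. r < (real N / real (Suc N)) ^ CARD('n)"
    using r by (intro order_tendstoD) auto
  then obtain N0 where N0: "\<And>N. N \<ge> N0 \<Longrightarrow> r < (real N / real (Suc N)) ^ CARD('n)"
    unfolding eventually_sequentially by blast
  have N: "r \<le> (real (Suc N0) / real (Suc (Suc N0))) ^ CARD('n)"
    using N0[of "Suc N0"] by simp
  obtain i where i: "r ^ i < \<mu>" using real_arch_pow_inv[OF \<mu> r(2)] by blast
  define K where "K = (C * C ^ Suc N0) ^ i * C"
  have "r * r ^ i \<le> r ^ i" using r by (intro mult_left_le_one_le) auto
  then have "r ^ Suc i \<le> \<mu>" using i by simp
  moreover have "1 \<le> K"
    unfolding K_def using C by (metis mult_ge1_I one_le_power)
  moreover have "dyadic_grid.cells_A_infty b h q (r ^ Suc i) K" if h: "0 < h" for b h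
  proof -
    interpret dyadic_grid b h by unfold_locales (rule h)
    have "cells_A_infty q (r ^ Suc k) ((C * C ^ Suc N0) ^ k * C)" for k
    proof (induction k)
      case 0
      show ?case
        unfolding cells_A_infty_def
        using AI[unfolded set_A_infty_def] is_cube_cells by (simp add: subset_eq)
    next
      case (Suc k)
      have "cells_A_infty q (r * r ^ Suc k) (C * C ^ Suc N0 * ((C * C ^ Suc N0) ^ k * C))"
        using r by (intro cells_A_infty_Suc[OF AI r C N Suc]) (auto intro!: mult_le_one simp: power_le_one)
      also have "r * r ^ Suc k = r ^ Suc (Suc k)" by simp
      also have "C * C ^ Suc N0 * ((C * C ^ Suc N0) ^ k * C) = (C * C ^ Suc N0) ^ Suc k * C" by simp
      finally show ?case .
    qed
    then show ?thesis by (simp add: K_def)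
  qed
  moreover have "dyadic_grid.cells_A_infty b h q \<mu> K"
    if *: "dyadic_grid.cells_A_infty b h q \<nu> K" "\<nu> \<le> \<mu>" "0 < h" for b h \<nu>
  proof -
    interpret dyadic_grid b h by unfold_locales (rule *)
    have "ennreal \<nu> * z \<le> ennreal \<mu> * z" for z using *(2) by (intro mult_right_mono ennreal_leI) auto
    then show ?thesis using *(1) unfolding cells_A_infty_def by (meson order_trans)
  qed
  ultimately show ?thesis by blast
qed

section \<open>Defects\<close>

text \<open>
  \<open>defect l c s P\<close> says that \<open>c * \<integral>\<^sub>P s\<^sup>q \<le> \<integral>\<^sub>E s\<^sup>q\<close> fails for some \<open>E \<subseteq> P\<close> with \<open>|E| \<ge> l * |P|\<close>.
  The constant \<open>coarse_const pp K\<close> is so small that disjoint cells with a defect for \<open>lam / 2\<close> have total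
  mass at most \<open>gap pp\<close>, and \<open>fine_const pp K lam\<close> is so small that a cell without such a
  defect at one level has no defect for \<open>lam\<close> at the levels to which powers of the weight can be compared.
\<close>

definition gap :: "real \<Rightarrow> real" where
  "gap pp = 16 powr (- pp)"

definition coarse_const :: "real \<Rightarrow> real \<Rightarrow> real" where
  "coarse_const pp K = 1 / (2 * (K / gap pp) powr pp)"

definition fine_const :: "real \<Rightarrow> real \<Rightarrow> real \<Rightarrow> real" where
  "fine_const pp K lam = lam * (coarse_const pp K)\<^sup>2 / 48"

text \<open>Density \<open>lam / 2\<close> in place of \<open>lam\<close>: the other half is given
  away when a subset of small weight is removed in the comparison of levels.\<close>

locale A_infty_cells = dyadic_grid b h + exponent q pp
  for b :: "real^'n" and h :: real and q :: "real^'n \<Rightarrow> real" and pp :: real +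
  fixes lam K :: real
  assumes lam: "0 < lam" "lam \<le> 1/2" and K: "1 \<le> K"
    and AI: "cells_A_infty q (lam / 2) K"
begin

abbreviation "eps \<equiv> gap pp"
abbreviation "c2 \<equiv> coarse_const pp K"
abbreviation "c0 \<equiv> fine_const pp K lam"

definition defect :: "real \<Rightarrow> real \<Rightarrow> real \<Rightarrow> (real^'n) set \<Rightarrow> bool" where
  "defect l c s P \<longleftrightarrow> (\<exists>E\<in>sets lebesgue. E \<subseteq> P \<and> ennreal l * emeasure lebesgue P \<le> emeasure lebesgue E \<and>
     emeasure (rho q s) E < ennreal c * emeasure (rho q s) P)"

lemma eps: "0 < eps" "eps \<le> 1"
  using pp_ge1 powr_mono[of "- pp" 0 16] by (auto simp: gap_def)

lemma c2: "0 < c2" "c2 \<le> 1"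
proof -
  have "1 \<le> K / eps" using K eps by (simp add: field_simps)
  then have "1 \<le> (K / eps) powr pp" using pp_ge1 by (simp add: ge_one_powr_ge_zero)
  moreover have "0 < 1 / (2 * z)" "1 / (2 * z) \<le> 1" if "1 \<le> z" for z :: real
    using that by (simp_all add: divide_le_eq)
  ultimately show "0 < c2" "c2 \<le> 1" unfolding coarse_const_def by (simp_all only:)
qed

lemma c0: "0 < c0" "c0 \<le> 1" "c0 \<le> c2"
proof -
  show "0 < c0" using c2 lam by (auto simp: fine_const_def)
  have "lam * (c2 * c2) \<le> 1 * (c2 * 1)" using c2 lam by (intro mult_mono) auto
  then show "c0 \<le> c2" using c2 by (simp add: fine_const_def power2_eq_square)
  then show "c0 \<le> 1" using c2 by simp
qed

lemma defect_weaken: "defect lam c0 s P \<Longrightarrow> defect (lam / 2) c2 s P"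
proof -
  assume "defect lam c0 s P"
  then obtain E where E: "E \<in> sets lebesgue" "E \<subseteq> P" "ennreal lam * emeasure lebesgue P \<le> emeasure lebesgue E"
    "emeasure (rho q s) E < ennreal c0 * emeasure (rho q s) P"
    unfolding defect_def by blast
  have "ennreal (lam / 2) * emeasure lebesgue P \<le> ennreal lam * emeasure lebesgue P"
    "ennreal c0 * emeasure (rho q s) P \<le> ennreal c2 * emeasure (rho q s) P"
    using lam c0 by (auto intro!: mult_right_mono ennreal_leI)
  with E show ?thesis unfolding defect_def by (meson order_trans less_le_trans)
qed

lemma cells_sets: "F \<subseteq> cells \<Longrightarrow> \<Union>F \<in> sets lebesgue"
  using countable_cells cells_measure(1) by (intro sets.countable_Union) (auto intro: countable_subset)

text \<open>Adding one cell to a family of mass at most \<open>eps\<close> gives total mass at most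
  2, which the condition for cells improves to \<open>eps\<close> again. The induction supplies the
  a priori bound on the total mass, without which smallness relative to that mass would say
  nothing.\<close>

lemma defect_mass_finite:
  assumes "finite F" "F \<subseteq> cells" "disjoint F" "0 < s"
    and "\<And>P. P \<in> F \<Longrightarrow> defect (lam / 2) c2 s P \<and> emeasure (rho q s) P \<le> 1"
  shows "emeasure (rho q s) (\<Union>F) \<le> ennreal eps"
  using assms
proof (induction F rule: finite_induct)
  case (insert P F)
  let ?F = "insert P F"
  have Fc: "?F \<subseteq> cells" "disjoint ?F" "countable ?F" using insert.prems insert.hyps by (auto intro: countable_finite)
  have "emeasure (rho q s) (\<Union>F) \<le> ennreal eps"
    using insert by (auto simp: disjoint_def)
  then have "emeasure (rho q s) (\<Union>F) \<le> 1" using eps by (meson ennreal_le_1 order_trans)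
  moreover have "emeasure (rho q s) (\<Union>?F) \<le> emeasure (rho q s) P + emeasure (rho q s) (\<Union>F)"
    using emeasure_subadditive[of P "rho q s" "\<Union>F"] cells_measure(1)[of P] cells_sets[of F] insert.prems by simp
  moreover have "emeasure (rho q s) P \<le> 1" using insert.prems by simp
  ultimately have two: "emeasure (rho q s) (\<Union>?F) \<le> 2"
    by (metis add_mono one_add_one order_trans)
  have "\<forall>P\<in>?F. \<exists>E\<in>sets lebesgue. E \<subseteq> P \<and> ennreal (lam / 2) * emeasure lebesgue P \<le> emeasure lebesgue E \<and>
     emeasure (rho q s) E < ennreal c2 * emeasure (rho q s) P"
    using insert.prems(4) unfolding defect_def by blast
  then obtain E where E: "\<And>P. P \<in> ?F \<Longrightarrow> E P \<in> sets lebesgue" "\<And>P. P \<in> ?F \<Longrightarrow> E P \<subseteq> P"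
    "\<And>P. P \<in> ?F \<Longrightarrow> ennreal (lam / 2) * emeasure lebesgue P \<le> emeasure lebesgue (E P)"
    "\<And>P. P \<in> ?F \<Longrightarrow> emeasure (rho q s) (E P) < ennreal c2 * emeasure (rho q s) P"
    by metis
  define A where "A = (\<Union>P\<in>?F. E P)"
  have A: "A \<in> sets lebesgue" unfolding A_def using E(1) Fc(3) by (intro sets.countable_UN') auto
  have AP: "P \<inter> A = E P" if "P \<in> ?F" for P
  proof
    show "P \<inter> A \<subseteq> E P"
    proof
      fix x assume x: "x \<in> P \<inter> A"
      then obtain P' where P': "P' \<in> ?F" "x \<in> E P'" unfolding A_def by blast
      then have "x \<in> P \<inter> P'" using x E(2) by blast
      then have "P' = P" using disjointD[OF Fc(2) that P'(1)] by auto
      then show "x \<in> E P" using P' by simp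
    qed
    show "E P \<subseteq> P \<inter> A" using E(2)[OF that] that unfolding A_def by blast
  qed
  have "emeasure (rho q s) (\<Union>?F \<inter> A) \<le> ennreal c2 * emeasure (rho q s) (\<Union>?F \<inter> UNIV)"
    by (rule emeasure_disjoint_Union_le)
       (use Fc A AP E(4) cells_measure(1) in \<open>auto intro: less_imp_le\<close>)
  then have A2: "emeasure (rho q s) (A \<inter> \<Union>?F) \<le> ennreal c2 * 2"
    using order_trans[OF _ mult_left_mono[OF two, of "ennreal c2"]] by (simp add: Int_commute)
  \<comment> \<open>The sets \<open>E\<close> have joint mass at most \<open>2 * c2\<close>, and
    \<open>coarse_const\<close> is chosen so that raising the level by \<open>K / eps\<close> keeps
    it at most one. The condition costs the factor \<open>K\<close>; the remaining
    \<open>1 / eps\<close> becomes the bound \<open>eps\<close> for the mass.\<close>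
  define k where "k = K / eps"
  have k: "1 \<le> k" using K eps by (simp add: k_def field_simps)
  have "emeasure (rho q (k * s)) (A \<inter> \<Union>?F) \<le> ennreal (k powr pp) * emeasure (rho q s) (A \<inter> \<Union>?F)"
    using A cells_sets[OF Fc(1)] k insert.prems by (intro rho_scale) auto
  also have "\<dots> \<le> ennreal (k powr pp) * (ennreal c2 * 2)" using A2 by (intro mult_left_mono) auto
  also have "\<dots> = ennreal (k powr pp * c2 * 2)"
    using c2 by (simp add: ennreal_mult mult.assoc)
  also have "k powr pp * c2 * 2 = 1" using k unfolding coarse_const_def k_def[symmetric] by simp
  finally have A1: "emeasure (rho q (k * s)) (A \<inter> \<Union>?F) \<le> 1" by simp
  have "emeasure (rho q (k * s / K)) (\<Union>?F) \<le> 1"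
  proof (rule AI[unfolded cells_A_infty_def, rule_format, of ?F A "k * s"])
    show "ennreal (lam / 2) * emeasure lebesgue Q \<le> emeasure lebesgue (A \<inter> Q)" if "Q \<in> ?F" for Q
      using E(3)[OF that] AP[OF that] by (simp add: Int_commute)
  qed (use Fc A A1 k insert.prems in auto)
  also have "k * s / K = (1 / eps) * s" using K by (simp add: k_def)
  finally have "emeasure (rho q ((1 / eps) * s)) (\<Union>?F) \<le> 1" .
  moreover have "ennreal (1 / eps) * emeasure (rho q s) (\<Union>?F) \<le> emeasure (rho q ((1 / eps) * s)) (\<Union>?F)"
    using eps insert.prems cells_sets[OF Fc(1)] by (intro rho_scale(2)) auto
  ultimately have "ennreal (1 / eps) * emeasure (rho q s) (\<Union>?F) \<le> 1" by (rule order_trans[rotated])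
  then have "ennreal eps * (ennreal (1 / eps) * emeasure (rho q s) (\<Union>?F)) \<le> ennreal eps * 1"
    by (rule mult_left_mono) simp
  moreover have "ennreal eps * (ennreal (1 / eps) * emeasure (rho q s) (\<Union>?F)) = emeasure (rho q s) (\<Union>?F)"
    using eps by (simp add: mult.assoc[symmetric] flip: ennreal_mult)
  ultimately show ?case by simp
qed simp

lemma defect_mass:
  assumes F: "F \<subseteq> cells" "disjoint F" and s: "0 < s"
    and D: "\<And>P. P \<in> F \<Longrightarrow> defect (lam / 2) c2 s P \<and> emeasure (rho q s) P \<le> 1"
  shows "emeasure (rho q s) (\<Union>F) \<le> ennreal eps"
proof (cases "F = {}")
  case False
  have cF: "countable F" using F countable_cells countable_subset by blast
  define G where "G n = from_nat_into F ` {..<n}" for n :: nat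
  have G: "G n \<subseteq> F" "finite (G n)" for n
    using from_nat_into[OF False] by (auto simp: G_def)
  have U: "\<Union>F = (\<Union>n. \<Union>(G n))"
  proof
    show "\<Union>F \<subseteq> (\<Union>n. \<Union>(G n))"
    proof
      fix x assume "x \<in> \<Union>F"
      then obtain P where P: "P \<in> F" "x \<in> P" by blast
      then obtain m where "P = from_nat_into F m"
        using range_from_nat_into[OF False cF] by auto
      then have "P \<in> G (Suc m)" by (auto simp: G_def)
      then show "x \<in> (\<Union>n. \<Union>(G n))" using P by blast
    qed
  qed (use G in blast)
  have "(SUP n. emeasure (rho q s) (\<Union>(G n))) = emeasure (rho q s) (\<Union>n. \<Union>(G n))"
  proof (rule SUP_emeasure_incseq)
    have "\<Union>(G n) \<in> sets lebesgue" for n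
      by (rule cells_sets) (use G F in blast)
    then show "range (\<lambda>n. \<Union>(G n)) \<subseteq> sets (rho q s)" by auto
    show "incseq (\<lambda>n. \<Union>(G n))"
      by (rule incseq_SucI) (auto simp: G_def lessThan_Suc)
  qed
  moreover have "emeasure (rho q s) (\<Union>(G n)) \<le> ennreal eps" for n
  proof (rule defect_mass_finite)
    show "disjoint (G n)" using F(2) G(1)[of n] by (auto simp: disjoint_def)
  qed (use G F s D in blast)+
  ultimately show ?thesis unfolding U by (metis SUP_least)
qed simp

lemma defect_single:
  assumes "P \<in> cells" "0 < s" "defect (lam / 2) c2 s P" "emeasure (rho q s) P \<le> 1"
  shows "emeasure (rho q s) P \<le> ennreal eps"
  using defect_mass[of "{P}" s] assms by (simp add: disjoint_def)

text \<open>A factor 16 in the level multiplies the mass by at most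
  \<open>16 powr pp = 1 / eps\<close>. So the last of the levels \<open>16 ^ r * \<tau>\<close> with
  mass at most one has mass above \<open>eps\<close>, which \<open>defect_single\<close> forbids for
  a cell with a coarse defect; and it is not \<tau> itself.\<close>

lemma raise_level:
  assumes P: "P \<in> cells" and \<tau>: "0 < \<tau>" and le: "emeasure (rho q \<tau>) P \<le> ennreal eps"
  obtains \<sigma> where "16 * \<tau> \<le> \<sigma>" "ennreal eps < emeasure (rho q \<sigma>) P" "emeasure (rho q \<sigma>) P \<le> 1"
    "\<not> defect (lam / 2) c2 \<sigma> P"
proof -
  note Pm = cells_measure[OF P]
  have pos: "0 < emeasure (rho q \<tau>) P" using rho_pos \<tau> Pm by simp
  have fin: "emeasure (rho q \<tau>) P < \<infinity>" using rho_finite \<tau> Pm by simp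
  define m where "m = enn2real (emeasure (rho q \<tau>) P)"
  have m: "emeasure (rho q \<tau>) P = ennreal m" "0 < m"
    using pos fin by (auto simp: m_def enn2real_positive_iff)
  obtain r where r: "1 / m < 16 ^ r" using real_arch_pow[of 16 "1 / m"] by auto
  have "1 < m * 16 ^ r" using r m by (simp add: field_simps)
  then have "ennreal 1 < ennreal (m * 16 ^ r)" by (intro ennreal_lessI) auto
  also have "ennreal (m * 16 ^ r) = ennreal (16 ^ r) * emeasure (rho q \<tau>) P"
    using m by (simp add: mult.commute flip: ennreal_mult)
  also have "\<dots> \<le> emeasure (rho q (16 ^ r * \<tau>)) P"
    using \<tau> Pm by (intro rho_scale) auto
  finally have ex: "1 < emeasure (rho q (16 ^ r * \<tau>)) P" by simp
  define r1 where "r1 = (LEAST r. 1 < emeasure (rho q (16 ^ r * \<tau>)) P)"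
  have r1: "1 < emeasure (rho q (16 ^ r1 * \<tau>)) P" unfolding r1_def by (rule LeastI) (rule ex)
  have up: "emeasure (rho q (16 * z)) P \<le> 1" if "emeasure (rho q z) P \<le> ennreal eps" "0 < z" for z
  proof -
    have "emeasure (rho q (16 * z)) P \<le> ennreal (16 powr pp) * emeasure (rho q z) P"
      using that Pm by (intro rho_scale) auto
    also have "\<dots> \<le> ennreal (16 powr pp) * ennreal eps" using that by (intro mult_left_mono) auto
    also have "\<dots> = 1" by (simp add: gap_def powr_minus field_simps flip: ennreal_mult)
    finally show ?thesis .
  qed
  have "r1 \<noteq> 0"
  proof
    assume "r1 = 0"
    then have "1 < ennreal eps" using r1 le less_le_trans[of 1 "emeasure (rho q \<tau>) P" "ennreal eps"] by simp
    moreover have "ennreal eps \<le> 1" using eps by (simp add: ennreal_le_1)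
    ultimately show False by simp
  qed
  moreover have "r1 \<noteq> 1" using r1 up[OF le \<tau>] by auto
  ultimately obtain r where r: "r1 = Suc (Suc r)" by (cases r1; cases "r1 - 1") auto
  let ?\<sigma> = "16 ^ Suc r * \<tau>"
  have le1: "emeasure (rho q ?\<sigma>) P \<le> 1"
    using not_less_Least[of "Suc r" "\<lambda>r. 1 < emeasure (rho q (16 ^ r * \<tau>)) P"] r unfolding r1_def[symmetric] by (simp add: not_less)
  have gt: "ennreal eps < emeasure (rho q ?\<sigma>) P"
  proof (rule ccontr)
    assume "\<not> ?thesis"
    then have "emeasure (rho q (16 * ?\<sigma>)) P \<le> 1" using up[of ?\<sigma>] \<tau> by (simp add: not_less)
    then show False using r1 r by (simp add: mult.assoc not_less[symmetric])
  qed
  show ?thesis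
  proof (rule that[OF _ gt le1])
    have "1 * \<tau> \<le> 16 ^ r * \<tau>" using \<tau> by (intro mult_right_mono) auto
    then show "16 * \<tau> \<le> ?\<sigma>" by simp
    show "\<not> defect (lam / 2) c2 ?\<sigma> P"
    proof
      assume "defect (lam / 2) c2 ?\<sigma> P"
      then have "emeasure (rho q ?\<sigma>) P \<le> ennreal eps" using defect_single[OF P _ _ le1] \<tau> by simp
      then show False using gt by (meson not_le)
    qed
  qed
qed

text \<open>Without a defect at \<open>u\<close>, the weight \<open>u powr q x\<close> exceeds
  \<open>c2 / 2 * \<kappa>\<close> outside a set of measure below \<open>lam / 2\<close> times that
  of \<open>R\<close>. This bounds integrals of its \<beta>-th power from below; \<open>le\<close>
  bounds them from above by interpolation. Letting \<beta> run from 0 to \<theta> reaches all levels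
  between 1 and \<open>u powr \<theta>\<close>.\<close>

lemma no_defect_transfer:
  assumes R: "R \<in> cells" and u: "0 < u" and nd: "\<not> defect (lam / 2) c2 u R"
    and \<beta>: "0 \<le> \<beta>" "\<beta> \<le> \<theta>" and \<theta>: "\<theta> \<le> 2"
    and \<kappa>: "0 < \<kappa>" "emeasure (rho q u) R = ennreal \<kappa> * emeasure lebesgue R"
    and le: "emeasure (rho q (u powr \<theta>)) R \<le> ennreal (4 * \<kappa> powr \<theta>) * emeasure lebesgue R"
  shows "\<not> defect lam c0 (u powr \<beta>) R"
proof
  assume "defect lam c0 (u powr \<beta>) R"
  then obtain E where E [measurable]: "E \<in> sets lebesgue" and ER: "E \<subseteq> R"
    and Elam: "ennreal lam * emeasure lebesgue R \<le> emeasure lebesgue E"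
    and Elt: "emeasure (rho q (u powr \<beta>)) E < ennreal c0 * emeasure (rho q (u powr \<beta>)) R"
    unfolding defect_def by blast
  note Rm = cells_measure[OF R]
  have Rs [measurable]: "R \<in> sets lebesgue" by (rule Rm)
  define m where "m = enn2real (emeasure lebesgue R)"
  have m: "emeasure lebesgue R = ennreal m" "0 < m"
    using Rm by (auto simp: m_def enn2real_positive_iff)
  have comm: "(u powr \<gamma>) powr q x = (u powr q x) powr \<gamma>" for \<gamma> x
    by (simp add: powr_powr mult.commute)
  have pt: "(u powr q x) powr \<beta> \<le> \<kappa> powr \<beta> + \<kappa> powr (\<beta> - \<theta>) * (u powr q x) powr \<theta>" for x
  proof (cases "u powr q x \<le> \<kappa>")
    case True
    then have "(u powr q x) powr \<beta> \<le> \<kappa> powr \<beta>" using \<beta> by (intro powr_mono2) auto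
    then show ?thesis by (simp add: add_increasing2)
  next
    case False
    let ?w = "u powr q x"
    have "?w powr \<beta> = ?w powr (\<beta> - \<theta>) * ?w powr \<theta>"
      using u by (simp flip: powr_add)
    also have "\<dots> \<le> \<kappa> powr (\<beta> - \<theta>) * ?w powr \<theta>"
      using False \<beta> \<kappa> u by (intro mult_right_mono powr_mono2') auto
    finally show ?thesis by (simp add: add_increasing)
  qed
  have up: "emeasure (rho q (u powr \<beta>)) R \<le> ennreal (5 * \<kappa> powr \<beta> * m)"
  proof -
    have "emeasure (rho q (u powr \<beta>)) R \<le>
      (\<integral>\<^sup>+x. ennreal (\<kappa> powr \<beta>) * indicator R x + ennreal (\<kappa> powr (\<beta> - \<theta>)) * (ennreal ((u powr \<theta>) powr q x) * indicator R x) \<partial>lebesgue)"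
      unfolding emeasure_rho[OF Rs]
    proof (rule nn_integral_mono)
      fix x
      have "ennreal ((u powr \<beta>) powr q x) \<le> ennreal (\<kappa> powr \<beta> + \<kappa> powr (\<beta> - \<theta>) * (u powr \<theta>) powr q x)"
        unfolding comm by (intro ennreal_leI pt)
      also have "\<dots> = ennreal (\<kappa> powr \<beta>) + ennreal (\<kappa> powr (\<beta> - \<theta>)) * ennreal ((u powr \<theta>) powr q x)"
        by (simp add: ennreal_mult)
      finally show "ennreal ((u powr \<beta>) powr q x) * indicator R x \<le>
         ennreal (\<kappa> powr \<beta>) * indicator R x + ennreal (\<kappa> powr (\<beta> - \<theta>)) * (ennreal ((u powr \<theta>) powr q x) * indicator R x)"
        by (auto simp: indicator_def)
    qed
    also have "\<dots> = ennreal (\<kappa> powr \<beta>) * emeasure lebesgue R + ennreal (\<kappa> powr (\<beta> - \<theta>)) * emeasure (rho q (u powr \<theta>)) R"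
      by (simp add: nn_integral_add nn_integral_cmult nn_integral_cmult_indicator emeasure_rho)
    also have "\<dots> \<le> ennreal (\<kappa> powr \<beta>) * ennreal m + ennreal (\<kappa> powr (\<beta> - \<theta>)) * (ennreal (4 * \<kappa> powr \<theta>) * ennreal m)"
      using le m by (intro add_mono mult_left_mono) auto
    also have "\<dots> = ennreal (\<kappa> powr \<beta> * m + \<kappa> powr (\<beta> - \<theta>) * (4 * \<kappa> powr \<theta> * m))"
      using m by (simp add: ennreal_mult)
    also have "\<kappa> powr \<beta> * m + \<kappa> powr (\<beta> - \<theta>) * (4 * \<kappa> powr \<theta> * m) = 5 * \<kappa> powr \<beta> * m"
      using \<kappa> by (simp add: powr_diff)
    finally show ?thesis .
  qed
  \<comment> \<open>Its mass is at most half of what a coarse defect allows, so its measure must be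
    below \<open>lam / 2 * m\<close>.\<close>
  define S where "S = {x \<in> R. u powr q x \<le> c2 / 2 * \<kappa>}"
  have "{x \<in> space lebesgue. x \<in> R \<and> u powr q x \<le> c2 / 2 * \<kappa>} \<in> sets lebesgue" by measurable
  then have S [measurable]: "S \<in> sets lebesgue" by (simp add: S_def)
  have "emeasure (rho q u) S \<le> (\<integral>\<^sup>+x. ennreal (c2 / 2 * \<kappa>) * indicator R x \<partial>lebesgue)"
    unfolding emeasure_rho[OF S] by (intro nn_integral_mono) (auto simp: S_def indicator_def intro!: ennreal_leI)
  also have "\<dots> = ennreal (c2 / 2 * \<kappa> * m)"
    using m \<kappa> c2 by (simp add: nn_integral_cmult_indicator flip: ennreal_mult)
  also have "\<dots> < ennreal (c2 * (\<kappa> * m))"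
    using m \<kappa> c2 by (intro ennreal_lessI) auto
  also have "\<dots> = ennreal c2 * emeasure (rho q u) R"
    using m \<kappa> c2 by (simp add: ennreal_mult)
  finally have "emeasure (rho q u) S < ennreal c2 * emeasure (rho q u) R" .
  then have "\<not> ennreal (lam / 2) * emeasure lebesgue R \<le> emeasure lebesgue S"
    using nd S unfolding defect_def by (auto simp: S_def)
  then have S_lt: "emeasure lebesgue S < ennreal (lam / 2 * m)"
    using m lam by (subst ennreal_mult) (auto simp: not_le)
  have EmS: "ennreal (lam / 2 * m) \<le> emeasure lebesgue (E - S)"
  proof -
    have "ennreal (lam * m) \<le> emeasure lebesgue E" using Elam m lam by (simp add: ennreal_mult)
    also have "\<dots> \<le> emeasure lebesgue ((E - S) \<union> S)" by (intro emeasure_mono) auto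
    also have "\<dots> \<le> emeasure lebesgue (E - S) + emeasure lebesgue S" by (intro emeasure_subadditive) auto
    also have "\<dots> \<le> emeasure lebesgue (E - S) + ennreal (lam / 2 * m)" using S_lt by (intro add_left_mono) auto
    finally have "ennreal (lam * m) \<le> emeasure lebesgue (E - S) + ennreal (lam / 2 * m)" .
    then show ?thesis
      using lam m by (cases "emeasure lebesgue (E - S)") (auto simp: ennreal_plus[symmetric] simp del: ennreal_plus)
  qed
  have "ennreal (lam * c2\<^sup>2 / 8 * \<kappa> powr \<beta> * m) = ennreal ((c2 / 2)\<^sup>2 * \<kappa> powr \<beta>) * ennreal (lam / 2 * m)"
    using lam m c2 by (simp add: power2_eq_square mult_ac flip: ennreal_mult)
  also have "\<dots> \<le> ennreal ((c2 / 2)\<^sup>2 * \<kappa> powr \<beta>) * emeasure lebesgue (E - S)"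
    by (rule mult_left_mono[OF EmS]) simp
  also have "\<dots> = (\<integral>\<^sup>+x. ennreal ((c2 / 2)\<^sup>2 * \<kappa> powr \<beta>) * indicator (E - S) x \<partial>lebesgue)"
    by (simp add: nn_integral_cmult_indicator)
  also have "\<dots> \<le> emeasure (rho q (u powr \<beta>)) E"
    unfolding emeasure_rho[OF E]
  proof (rule nn_integral_mono)
    fix x
    show "ennreal ((c2 / 2)\<^sup>2 * \<kappa> powr \<beta>) * indicator (E - S) x \<le> ennreal ((u powr \<beta>) powr q x) * indicator E x"
    proof (cases "x \<in> E - S")
      case True
      then have "c2 / 2 * \<kappa> \<le> u powr q x" using ER by (auto simp: S_def)
      then have "(c2 / 2 * \<kappa>) powr \<beta> \<le> (u powr q x) powr \<beta>" using \<beta> c2 \<kappa> by (intro powr_mono2) auto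
      moreover have "(c2 / 2 * \<kappa>) powr \<beta> = (c2 / 2) powr \<beta> * \<kappa> powr \<beta>" using powr_mult[of "c2 / 2" \<kappa> \<beta>] c2 \<kappa> by simp
      moreover have "(c2 / 2) powr 2 \<le> (c2 / 2) powr \<beta>" using \<beta> \<theta> c2 by (intro powr_mono') auto
      moreover have "(c2 / 2) powr 2 = (c2 / 2)\<^sup>2" using c2 by (simp add: powr_numeral)
      ultimately have "(c2 / 2)\<^sup>2 * \<kappa> powr \<beta> \<le> (u powr \<beta>) powr q x"
        unfolding comm by (smt (verit) mult_right_mono powr_ge_zero)
      then show ?thesis using True by (auto intro!: ennreal_leI)
    qed simp
  qed
  also note Elt
  also have "ennreal c0 * emeasure (rho q (u powr \<beta>)) R \<le> ennreal c0 * ennreal (5 * \<kappa> powr \<beta> * m)"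
    by (intro mult_left_mono up) auto
  also have "\<dots> = ennreal (c0 * (5 * \<kappa> powr \<beta> * m))"
    using c0 by (simp flip: ennreal_mult')
  finally have "lam * c2\<^sup>2 / 8 * \<kappa> powr \<beta> * m < c0 * (5 * \<kappa> powr \<beta> * m)"
    using lam m c2 by (simp add: ennreal_less_iff)
  \<comment> \<open>Origin of the 48 in \<open>fine_const\<close>: \<open>5 * c0\<close> is 5/48 of
    \<open>lam * c2\<^sup>2\<close>, below the 6/48 in the lower bound.\<close>
  moreover have "c0 * (5 * \<kappa> powr \<beta> * m) = 5 / 6 * (lam * c2\<^sup>2 / 8 * \<kappa> powr \<beta> * m)"
    by (simp add: fine_const_def)
  moreover have "0 < lam * c2\<^sup>2 / 8 * \<kappa> powr \<beta> * m" using lam c2 \<kappa> m by simp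
  ultimately show False by linarith
qed

end

section \<open>Propagation of defects through the levels\<close>

context A_infty_cells
begin

lemma average:
  assumes "P \<in> cells" "0 < s"
  obtains \<kappa> where "0 < \<kappa>" "emeasure (rho q s) P = ennreal \<kappa> * emeasure lebesgue P"
proof -
  note Pm = cells_measure[OF assms(1)]
  obtain m where m: "emeasure lebesgue P = ennreal m" "0 < m"
    using Pm by (cases "emeasure lebesgue P") auto
  have "0 < emeasure (rho q s) P" "emeasure (rho q s) P < \<infinity>"
    using rho_pos rho_finite Pm assms by auto
  then obtain r where r: "emeasure (rho q s) P = ennreal r" "0 < r"
    by (cases "emeasure (rho q s) P") auto
  have "ennreal r = ennreal (r / m) * ennreal m" using r m by (simp flip: ennreal_mult)
  with that[of "r / m"] show ?thesis using r m by simp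
qed

lemma powr_level:
  fixes s v :: real
  assumes "0 < s" "s \<noteq> 1" "0 < v"
  shows "s powr (ln v / ln s) = v"
  using assms by (simp add: powr_def)

text \<open>Otherwise the reverse Hoelder inequality outside the defective subcells, for
  \<open>\<sigma> powr q x\<close> divided by its average \<kappa>, would bound the whole mass of
  \<open>P\<close> at level \<open>t\<close> by \<open>4 * \<kappa> powr \<theta>\<close> times its
  volume. Since \<tau> lies between \<open>t = \<sigma> powr \<theta>\<close> and 1,
  \<open>no_defect_transfer\<close> would then exclude the defect at \<tau>.\<close>

lemma defect_descend:
  assumes P: "P \<in> cells" and t: "0 < t" "t \<le> \<tau>" "\<tau> \<le> \<sigma>" "\<sigma> < 1"
    and D: "defect lam c0 \<tau> P" and nd: "\<not> defect (lam / 2) c2 \<sigma> P"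
    and \<theta>: "t = \<sigma> powr \<theta>" "1 \<le> \<theta>" "\<theta> \<le> 2" "(2 ^ Suc CARD('n)) powr (\<theta> - 1) \<le> 1 + c0 / 4"
  shows "emeasure (rho q t) P \<le> 2 * emeasure (rho q t) (\<Union>{S \<in> cells. S \<subseteq> P \<and> defect lam c0 \<sigma> S})"
proof (rule ccontr)
  let ?S = "{S \<in> cells. S \<subseteq> P \<and> defect lam c0 \<sigma> S}"
  assume "\<not> ?thesis"
  then have lt: "2 * emeasure (rho q t) (\<Union>?S) < emeasure (rho q t) P" by simp
  have \<sigma>: "0 < \<sigma>" using t by simp
  note Pm = cells_measure[OF P]
  have Ss: "\<Union>?S \<in> sets lebesgue" by (rule cells_sets) auto
  obtain \<kappa> where \<kappa>: "0 < \<kappa>" "emeasure (rho q \<sigma>) P = ennreal \<kappa> * emeasure lebesgue P"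
    using average[OF P \<sigma>] by blast
  define y where "y x = \<sigma> powr q x / \<kappa>" for x
  have y [measurable]: "y \<in> borel_measurable lebesgue" unfolding y_def by measurable
  have y_pos: "0 < y x" for x using \<sigma> \<kappa> by (simp add: y_def)
  have W: "emeasure (density lebesgue (\<lambda>x. ennreal (y x))) A = ennreal (1 / \<kappa>) * emeasure (rho q \<sigma>) A"
    if "A \<in> sets lebesgue" for A
  proof -
    have "ennreal (y x) = ennreal (1 / \<kappa>) * ennreal (\<sigma> powr q x)" for x
      using \<kappa> by (simp add: y_def flip: ennreal_mult)
    then show ?thesis
      using that by (simp add: emeasure_density emeasure_rho nn_integral_cmult mult.assoc)
  qed
  have "(\<integral>\<^sup>+x. ennreal (y x powr \<theta>) * indicator (P - \<Union>?S) x \<partial>lebesgue) \<le> 2 * emeasure lebesgue P"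
  proof (rule reverse_Hoelder_outside[OF y y_pos c0(1,2) P])
    have "ennreal (1 / \<kappa>) * (ennreal \<kappa> * emeasure lebesgue P) = emeasure lebesgue P"
      using \<kappa>(1) by (simp add: mult.assoc[symmetric] flip: ennreal_mult)
    then show "emeasure (density lebesgue (\<lambda>x. ennreal (y x))) P = emeasure lebesgue P"
      using Pm by (simp add: W \<kappa>(2))
    show "?S \<subseteq> cells" by auto
    fix P' E assume P': "P' \<in> cells" "P' \<subseteq> P" "\<not> (\<exists>M\<in>?S. P' \<subseteq> M)" and E: "E \<in> sets lebesgue" "E \<subseteq> P'"
      "emeasure lebesgue P' \<le> 2 * emeasure lebesgue E"
    then have nd': "\<not> defect lam c0 \<sigma> P'" by blast
    \<comment> \<open>Here \<open>lam \<le> 1/2\<close> enters: a subset with half of the volume is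
      admissible in the definition of a defect.\<close>
    have "ennreal lam * emeasure lebesgue P' \<le> ennreal (1 / 2) * (2 * emeasure lebesgue E)"
      using lam E(3) by (intro mult_mono ennreal_leI) auto
    also have "\<dots> = emeasure lebesgue E"
    proof -
      have "ennreal (1 / 2) * 2 = 1" using ennreal_mult[of "1/2" 2] by simp
      then show ?thesis by (simp add: mult.assoc[symmetric])
    qed
    finally have "\<not> emeasure (rho q \<sigma>) E < ennreal c0 * emeasure (rho q \<sigma>) P'"
      using nd' E unfolding defect_def by blast
    then have "ennreal c0 * emeasure (rho q \<sigma>) P' \<le> emeasure (rho q \<sigma>) E" by simp
    then have "ennreal (1 / \<kappa>) * (ennreal c0 * emeasure (rho q \<sigma>) P') \<le> ennreal (1 / \<kappa>) * emeasure (rho q \<sigma>) E"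
      by (rule mult_left_mono) simp
    then show "ennreal c0 * emeasure (density lebesgue (\<lambda>x. ennreal (y x))) P' \<le> emeasure (density lebesgue (\<lambda>x. ennreal (y x))) E"
      using cells_measure(1)[OF P'(1)] E(1) by (simp add: W mult.left_commute)
  qed (use \<theta> in auto)
  then have "ennreal (\<kappa> powr \<theta>) * (\<integral>\<^sup>+x. ennreal (y x powr \<theta>) * indicator (P - \<Union>?S) x \<partial>lebesgue)
      \<le> ennreal (\<kappa> powr \<theta>) * (2 * emeasure lebesgue P)"
    by (rule mult_left_mono) simp
  moreover have "ennreal (\<kappa> powr \<theta>) * (\<integral>\<^sup>+x. ennreal (y x powr \<theta>) * indicator (P - \<Union>?S) x \<partial>lebesgue)
      = emeasure (rho q t) (P - \<Union>?S)"
  proof -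
    have "ennreal (\<kappa> powr \<theta>) * ennreal (y x powr \<theta>) = ennreal (t powr q x)" for x
    proof -
      have "\<kappa> powr \<theta> * y x powr \<theta> = (\<kappa> * y x) powr \<theta>"
        using \<kappa> y_pos[of x] by (simp add: powr_mult)
      also have "\<dots> = t powr q x"
        using \<kappa> by (simp add: y_def \<theta>(1) powr_powr mult.commute)
      finally show ?thesis by (simp flip: ennreal_mult)
    qed
    then have "ennreal (\<kappa> powr \<theta>) * (ennreal (y x powr \<theta>) * indicator A x) = ennreal (t powr q x) * indicator A x" for x A
      by (simp add: mult.assoc[symmetric])
    then show ?thesis
      using Pm Ss by (simp add: emeasure_rho flip: nn_integral_cmult)
  qed
  ultimately have out: "emeasure (rho q t) (P - \<Union>?S) \<le> ennreal (\<kappa> powr \<theta>) * (2 * emeasure lebesgue P)" by simp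
  have "emeasure (rho q t) P \<le> 2 * emeasure (rho q t) (P - \<Union>?S)"
  proof -
    have "emeasure (rho q t) (P - \<Union>?S) + emeasure (rho q t) (\<Union>?S) = emeasure (rho q t) ((P - \<Union>?S) \<union> \<Union>?S)"
      using Pm Ss by (intro plus_emeasure) auto
    moreover have "(P - \<Union>?S) \<union> \<Union>?S = P" by auto
    ultimately have eq: "emeasure (rho q t) P = emeasure (rho q t) (P - \<Union>?S) + emeasure (rho q t) (\<Union>?S)"
      by simp
    have "p \<le> 2 * v" if uv: "2 * u < p" "p = v + u" "p < \<infinity>" for p u v :: ennreal
    proof -
      obtain a b where ab: "u = ennreal a" "v = ennreal b" "0 \<le> a" "0 \<le> b"
        using uv(2,3) by (cases u; cases v) auto
      then have p: "p = ennreal (b + a)" using uv by simp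
      have *: "ennreal (2 * a) < ennreal (b + a)"
        using uv(1) ab unfolding p by (simp add: ennreal_mult)
      have "a \<le> b"
      proof (rule ccontr)
        assume "\<not> a \<le> b"
        then have "ennreal (b + a) \<le> ennreal (2 * a)" by (intro ennreal_leI) simp
        with * show False by (meson not_le)
      qed
      then have "ennreal (b + a) \<le> ennreal (2 * b)" by (intro ennreal_leI) simp
      then show ?thesis using ab p by (simp add: ennreal_mult)
    qed
    from this[OF lt eq] show ?thesis using rho_finite[of t P] t Pm by simp
  qed
  also have "\<dots> \<le> 2 * (ennreal (\<kappa> powr \<theta>) * (2 * emeasure lebesgue P))" using out by (intro mult_left_mono) auto
  also have "\<dots> = ennreal (4 * \<kappa> powr \<theta>) * emeasure lebesgue P"
  proof -
    have "2 * (a * (2 * z)) = (2 * 2) * a * z" for a z :: ennreal by (simp only: mult_ac)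
    then show ?thesis by (simp add: ennreal_mult)
  qed
  finally have le: "emeasure (rho q (\<sigma> powr \<theta>)) P \<le> ennreal (4 * \<kappa> powr \<theta>) * emeasure lebesgue P"
    using \<theta>(1) by simp
  define \<beta> where "\<beta> = ln \<tau> / ln \<sigma>"
  have ln: "ln \<sigma> < 0" "ln \<tau> < 0" "ln t \<le> ln \<tau>" using t \<sigma> by auto
  have \<beta>: "0 \<le> \<beta>" using ln by (simp add: \<beta>_def divide_nonpos_neg)
  have "ln t = \<theta> * ln \<sigma>" using \<theta>(1) \<sigma> by (simp add: ln_powr)
  then have "\<beta> \<le> \<theta>" using ln by (simp add: \<beta>_def field_simps)
  moreover have "\<sigma> powr \<beta> = \<tau>" unfolding \<beta>_def using t \<sigma> by (intro powr_level) auto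
  ultimately show False
    using no_defect_transfer[OF P \<sigma> nd \<beta> _ \<theta>(3) \<kappa> le] D by simp
qed

text \<open>From \<open>t \<ge> 1\<close>, \<open>raise_level\<close> moves away from 1, so
  \<open>t = \<sigma> powr \<beta>\<close> with \<open>\<beta> \<le> 1\<close>. Then exponent 1
  suffices in \<open>no_defect_transfer\<close>, and its integral bound follows from the definition
  of the average.\<close>

lemma no_defect_ge1:
  assumes P: "P \<in> cells" and t: "1 \<le> t" and le: "emeasure (rho q t) P \<le> 1"
  shows "\<not> defect lam c0 t P"
proof
  assume D: "defect lam c0 t P"
  then have "emeasure (rho q t) P \<le> ennreal eps"
    using defect_single[OF P _ defect_weaken le] t by simp
  then obtain \<sigma> where \<sigma>: "16 * t \<le> \<sigma>" "\<not> defect (lam / 2) c2 \<sigma> P"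
    using raise_level[OF P, of t] t by (metis less_le_trans zero_less_one)
  have \<sigma>1: "1 < \<sigma>" using \<sigma> t by linarith
  obtain \<kappa> where \<kappa>: "0 < \<kappa>" "emeasure (rho q \<sigma>) P = ennreal \<kappa> * emeasure lebesgue P"
    using average[OF P, of \<sigma>] \<sigma>1 by auto
  define \<beta> where "\<beta> = ln t / ln \<sigma>"
  have "0 \<le> \<beta>" "\<beta> \<le> 1" using t \<sigma> \<sigma>1 by (auto simp: \<beta>_def)
  moreover have "\<sigma> powr \<beta> = t" unfolding \<beta>_def using t \<sigma>1 by (intro powr_level) auto
  moreover have "emeasure (rho q (\<sigma> powr 1)) P \<le> ennreal (4 * \<kappa> powr 1) * emeasure lebesgue P"
    using \<kappa> \<sigma>1 by (auto intro!: mult_right_mono ennreal_leI)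
  ultimately show False
    using no_defect_transfer[OF P _ \<sigma>(2) _ _ _ \<kappa>, of \<beta> 1] D \<sigma>1 by simp
qed

context
  fixes t u \<theta> :: real
  assumes t: "0 < t" and u: "u < 1" "0 < u" and tu: "t = u powr \<theta>"
    and \<theta>: "1 \<le> \<theta>" "\<theta> \<le> 2" "(2 ^ Suc CARD('n)) powr (\<theta> - 1) \<le> 1 + c0 / 4"
begin

lemma t_le_u: "t \<le> u"
  using powr_mono'[of 1 \<theta> u] \<theta> u tu by simp

text \<open>At level \<open>u\<close> the maximal cells have total mass at most \<open>eps\<close>,
  and since \<open>q \<ge> 1\<close>, going down to \<open>t\<close> multiplies the mass by at most
  \<open>t / u = t powr (1 - 1 / \<theta>)\<close>. This is where the power of \<open>t\<close> is
  gained.\<close>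

lemma defect_mass_ratio:
  assumes S: "S \<subseteq> cells" and D: "\<And>P. P \<in> S \<Longrightarrow> defect (lam / 2) c2 u P \<and> emeasure (rho q u) P \<le> 1"
  shows "emeasure (rho q t) (\<Union>S) \<le> ennreal (eps * (t / u))"
proof -
  have "emeasure (rho q t) (\<Union>S) \<le> ennreal (t / u) * emeasure (rho q u) (\<Union>S)"
    using cells_sets[OF S] t_le_u t by (intro rho_le_ratio) auto
  also have "emeasure (rho q u) (\<Union>S) = emeasure (rho q u) (\<Union>(tops S))"
    by (simp add: Union_tops[OF S])
  also have "ennreal (t / u) * \<dots> \<le> ennreal (t / u) * ennreal eps"
    using tops_cells[OF S] tops_disjoint[OF S] tops_subset[OF S] D u
    by (intro mult_left_mono defect_mass) auto
  also have "\<dots> = ennreal (eps * (t / u))"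
    using t u eps by (simp add: mult.commute flip: ennreal_mult)
  finally show ?thesis .
qed

text \<open>
  Each step of the induction replaces a cell of mass above one at the level \<open>u\<close> by subcells that are
  defective at a level at least 16 times higher, at the cost of a factor 2.
\<close>

lemma defect_family:
  assumes "F \<subseteq> cells" "disjoint F"
    and "\<And>P. P \<in> F \<Longrightarrow> \<exists>\<tau>. t \<le> \<tau> \<and> \<tau> \<le> u \<and> defect lam c0 \<tau> P \<and> emeasure (rho q \<tau>) P \<le> 1 \<and> u \<le> 16 ^ i * \<tau>"
  shows "emeasure (rho q t) (\<Union>F) \<le> ennreal (4 * 4 ^ i * (eps * (t / u)))"
  using assms
proof (induction i arbitrary: F)
  case 0
  have "defect (lam / 2) c2 u P \<and> emeasure (rho q u) P \<le> 1" if "P \<in> F" for P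
    using 0(3)[OF that] defect_weaken by (metis antisym mult_1 power_0)
  then have "emeasure (rho q t) (\<Union>F) \<le> ennreal (eps * (t / u))"
    using 0(1) by (rule defect_mass_ratio[rotated])
  also have "\<dots> \<le> ennreal (4 * 4 ^ 0 * (eps * (t / u)))"
  proof (rule ennreal_leI)
    have "0 \<le> eps * (t / u)" using eps t u by simp
    then show "eps * (t / u) \<le> 4 * 4 ^ 0 * (eps * (t / u))" unfolding power_0 by linarith
  qed
  finally show ?case .
next
  case (Suc i)
  have Fs: "countable G" "disjoint G" "G \<subseteq> cells" if "G \<subseteq> F" for G
  proof -
    show "disjoint G" using that Suc.prems(2) by (auto simp: disjoint_def)
    show "G \<subseteq> cells" using that Suc.prems(1) by blast
    then show "countable G" using countable_cells countable_subset by blast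
  qed
  define X where "X = eps * (t / u)"
  have X: "0 \<le> X" using eps t u by (simp add: X_def)
  obtain \<tau> where \<tau>: "\<And>P. P \<in> F \<Longrightarrow> t \<le> \<tau> P \<and> \<tau> P \<le> u \<and> defect lam c0 (\<tau> P) P \<and> emeasure (rho q (\<tau> P)) P \<le> 1 \<and> u \<le> 16 ^ Suc i * \<tau> P"
    using Suc.prems(3) by metis
  \<comment> \<open>Three cases at \<open>u\<close>: a coarse defect is covered by
    \<open>defect_mass_ratio\<close>; mass at most one without such a defect permits a descent
    directly to \<open>u\<close>; mass above one forces \<open>raise_level\<close> to stop below
    \<open>u\<close>, and only this case uses the induction hypothesis.\<close>
  define Fa where "Fa = {P \<in> F. emeasure (rho q u) P \<le> 1 \<and> defect (lam / 2) c2 u P}"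
  define Fb where "Fb = {P \<in> F. emeasure (rho q u) P \<le> 1 \<and> \<not> defect (lam / 2) c2 u P}"
  define Fc where "Fc = {P \<in> F. \<not> emeasure (rho q u) P \<le> 1}"
  have sub: "Fa \<subseteq> F" "Fb \<subseteq> F" "Fc \<subseteq> F" by (auto simp: Fa_def Fb_def Fc_def)
  have cover: "emeasure (rho q t) (\<Union>G) \<le> 2 * emeasure (rho q t) (\<Union>S)"
    if G: "G \<subseteq> F" and S: "S \<subseteq> cells"
      and le: "\<And>P. P \<in> G \<Longrightarrow> \<exists>S' \<subseteq> S. \<Union>S' \<subseteq> P \<and> emeasure (rho q t) P \<le> 2 * emeasure (rho q t) (\<Union>S')" for G S
  proof -
    have "emeasure (rho q t) (\<Union>G \<inter> UNIV) \<le> 2 * emeasure (rho q t) (\<Union>G \<inter> \<Union>S)"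
    proof (rule emeasure_disjoint_Union_le)
      fix P assume P: "P \<in> G"
      then show Ps: "P \<in> sets (rho q t)" using Fs(3)[OF G] cells_measure by auto
      obtain S' where S': "S' \<subseteq> S" "\<Union>S' \<subseteq> P" "emeasure (rho q t) P \<le> 2 * emeasure (rho q t) (\<Union>S')"
        using le[OF P] by blast
      have "emeasure (rho q t) (\<Union>S') \<le> emeasure (rho q t) (P \<inter> \<Union>S)"
        using S' Ps cells_sets[OF S] by (intro emeasure_mono) auto
      then show "emeasure (rho q t) (P \<inter> UNIV) \<le> 2 * emeasure (rho q t) (P \<inter> \<Union>S)"
        using S'(3) mult_left_mono[of _ _ "2::ennreal"] by (simp add: order_trans[OF S'(3)])
    qed (use Fs[OF G] cells_sets[OF S] in auto)
    also have "\<dots> \<le> 2 * emeasure (rho q t) (\<Union>S)"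
      using cells_sets[OF S] by (intro mult_left_mono emeasure_mono) auto
    finally show ?thesis by simp
  qed
  have a: "emeasure (rho q t) (\<Union>Fa) \<le> ennreal X"
    unfolding X_def using Fs[OF sub(1)] by (intro defect_mass_ratio) (auto simp: Fa_def)
  have b: "emeasure (rho q t) (\<Union>Fb) \<le> 2 * ennreal X"
  proof -
    let ?S = "{S \<in> cells. defect lam c0 u S \<and> (\<exists>P\<in>Fb. S \<subseteq> P)}"
    have "emeasure (rho q t) (\<Union>Fb) \<le> 2 * emeasure (rho q t) (\<Union>?S)"
    proof (rule cover[OF sub(2)])
      fix P assume P: "P \<in> Fb"
      then have "P \<in> F" using sub by auto
      have "emeasure (rho q t) P \<le> 2 * emeasure (rho q t) (\<Union>{S \<in> cells. S \<subseteq> P \<and> defect lam c0 u S})"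
        using \<tau>[OF \<open>P \<in> F\<close>] P Suc.prems(1) \<open>P \<in> F\<close> t u tu \<theta>
        by (intro defect_descend[of P t "\<tau> P" u]) (auto simp: Fb_def)
      moreover have "{S \<in> cells. S \<subseteq> P \<and> defect lam c0 u S} \<subseteq> ?S" using P by auto
      ultimately show "\<exists>S' \<subseteq> ?S. \<Union>S' \<subseteq> P \<and> emeasure (rho q t) P \<le> 2 * emeasure (rho q t) (\<Union>S')"
        by (intro exI[of _ "{S \<in> cells. S \<subseteq> P \<and> defect lam c0 u S}"]) auto
    qed auto
    also have "\<dots> \<le> 2 * ennreal X"
      unfolding X_def
    proof (intro mult_left_mono defect_mass_ratio)
      fix S assume "S \<in> ?S"
      then obtain P where P: "P \<in> Fb" "S \<subseteq> P" "defect lam c0 u S" by auto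
      have "emeasure (rho q u) S \<le> emeasure (rho q u) P"
        using P Fs[OF sub(2)] cells_measure by (intro emeasure_mono) auto
      then show "defect (lam / 2) c2 u S \<and> emeasure (rho q u) S \<le> 1"
        using P defect_weaken by (auto simp: Fb_def)
    qed auto
    finally show ?thesis .
  qed
  have "\<forall>P\<in>Fc. \<exists>\<sigma>. t \<le> \<sigma> \<and> \<sigma> \<le> u \<and> u \<le> 16 ^ i * \<sigma> \<and> emeasure (rho q \<sigma>) P \<le> 1 \<and>
      emeasure (rho q t) P \<le> 2 * emeasure (rho q t) (\<Union>{S \<in> cells. S \<subseteq> P \<and> defect lam c0 \<sigma> S})"
  proof
    fix P assume P: "P \<in> Fc"
    have PF: "P \<in> F" "P \<in> cells" and Pu: "1 < emeasure (rho q u) P" using P Suc.prems(1) by (auto simp: Fc_def)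
    note T = \<tau>[OF PF(1)]
    then have "0 < \<tau> P" using t by linarith
    moreover have "emeasure (rho q (\<tau> P)) P \<le> ennreal eps"
      using defect_single[OF PF(2) calculation defect_weaken] T by blast
    ultimately obtain \<sigma> where \<sigma>: "16 * \<tau> P \<le> \<sigma>" "emeasure (rho q \<sigma>) P \<le> 1" "\<not> defect (lam / 2) c2 \<sigma> P"
      using raise_level[OF PF(2)] by metis
    have \<sigma>u: "\<sigma> < u"
    proof (rule ccontr)
      assume "\<not> \<sigma> < u"
      then have "emeasure (rho q u) P \<le> emeasure (rho q \<sigma>) P"
        using u PF(2) cells_measure by (intro rho_mono) auto
      then show False using \<sigma>(2) Pu by simp
    qed
    have "t \<le> \<tau> P" using T by blast
    then have \<sigma>0: "0 < \<sigma>" "t \<le> \<sigma>" "\<tau> P \<le> \<sigma>" using \<sigma>(1) t by linarith+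
    \<comment> \<open>The exponent that leads from \<sigma> to \<open>t\<close>. From
      \<open>t \<le> \<sigma> < u\<close> follows \<open>1 \<le> \<theta>' \<le> \<theta>\<close>,
      so the smallness condition on \<theta> is inherited.\<close>
    define \<theta>' where "\<theta>' = ln t / ln \<sigma>"
    have ln: "ln \<sigma> < 0" "ln t \<le> ln \<sigma>" "ln \<sigma> < ln u" using \<sigma>0 \<sigma>u u t by auto
    have lt: "ln t = \<theta> * ln u" using tu u by (simp add: ln_powr)
    have "1 \<le> \<theta>'" using ln by (simp add: \<theta>'_def field_simps)
    moreover have "\<theta>' \<le> \<theta>"
    proof -
      have "\<theta> * ln \<sigma> \<le> ln t" unfolding lt using ln \<theta> by (intro mult_left_mono) auto
      then show ?thesis using ln by (simp add: \<theta>'_def field_simps)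
    qed
    moreover have "t = \<sigma> powr \<theta>'" unfolding \<theta>'_def using powr_level[of \<sigma> t] \<sigma>0 \<sigma>u u t by simp
    moreover have "(2 ^ Suc CARD('n)) powr (\<theta>' - 1) \<le> (2 ^ Suc CARD('n)) powr (\<theta> - 1)"
      using \<open>\<theta>' \<le> \<theta>\<close> one_le_power[of "2::real" "Suc CARD('n)"] by (intro powr_mono) (auto simp del: power_Suc)
    ultimately have "emeasure (rho q t) P \<le> 2 * emeasure (rho q t) (\<Union>{S \<in> cells. S \<subseteq> P \<and> defect lam c0 \<sigma> S})"
      using T \<sigma>0 \<sigma>u u \<theta> t \<sigma>(3) PF(2) by (intro defect_descend[of P t "\<tau> P" \<sigma> \<theta>']) auto
    moreover have "u \<le> 16 ^ i * \<sigma>"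
    proof -
      have "u \<le> 16 ^ i * (16 * \<tau> P)" using T by (simp add: mult_ac)
      also have "\<dots> \<le> 16 ^ i * \<sigma>" using \<sigma>(1) by (intro mult_left_mono) auto
      finally show ?thesis .
    qed
    ultimately show "\<exists>\<sigma>. t \<le> \<sigma> \<and> \<sigma> \<le> u \<and> u \<le> 16 ^ i * \<sigma> \<and> emeasure (rho q \<sigma>) P \<le> 1 \<and>
      emeasure (rho q t) P \<le> 2 * emeasure (rho q t) (\<Union>{S \<in> cells. S \<subseteq> P \<and> defect lam c0 \<sigma> S})"
      using \<sigma>0 \<sigma>u \<sigma>(2) by (intro exI[of _ \<sigma>]) auto
  qed
  from bchoice[OF this] obtain \<sigma> where \<sigma>: "\<And>P. P \<in> Fc \<Longrightarrow> t \<le> \<sigma> P \<and> \<sigma> P \<le> u \<and> u \<le> 16 ^ i * \<sigma> P \<and> emeasure (rho q (\<sigma> P)) P \<le> 1 \<and>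
      emeasure (rho q t) P \<le> 2 * emeasure (rho q t) (\<Union>{S \<in> cells. S \<subseteq> P \<and> defect lam c0 (\<sigma> P) S})"
    by blast
  have c: "emeasure (rho q t) (\<Union>Fc) \<le> 2 * ennreal (4 * 4 ^ i * X)"
  proof -
    let ?S = "{S \<in> cells. \<exists>P\<in>Fc. S \<subseteq> P \<and> defect lam c0 (\<sigma> P) S}"
    have Sc: "?S \<subseteq> cells" by auto
    have "emeasure (rho q t) (\<Union>Fc) \<le> 2 * emeasure (rho q t) (\<Union>?S)"
    proof (rule cover[OF sub(3) Sc])
      fix P assume P: "P \<in> Fc"
      have "{S \<in> cells. S \<subseteq> P \<and> defect lam c0 (\<sigma> P) S} \<subseteq> ?S" using P by auto
      then show "\<exists>S' \<subseteq> ?S. \<Union>S' \<subseteq> P \<and> emeasure (rho q t) P \<le> 2 * emeasure (rho q t) (\<Union>S')"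
        using \<sigma>[OF P] by (intro exI[of _ "{S \<in> cells. S \<subseteq> P \<and> defect lam c0 (\<sigma> P) S}"]) auto
    qed
    also have "\<Union>?S = \<Union>(tops ?S)" by (simp add: Union_tops[OF Sc])
    also have "2 * emeasure (rho q t) (\<Union>(tops ?S)) \<le> 2 * ennreal (4 * 4 ^ i * X)"
      unfolding X_def
    proof (intro mult_left_mono Suc.IH)
      show "tops ?S \<subseteq> cells" using tops_cells[OF Sc] by auto
      show "disjoint (tops ?S)" by (rule tops_disjoint[OF Sc])
      fix S assume "S \<in> tops ?S"
      then obtain P where P: "P \<in> Fc" "S \<subseteq> P" "defect lam c0 (\<sigma> P) S"
        using tops_subset[OF Sc] by blast
      have "emeasure (rho q (\<sigma> P)) S \<le> emeasure (rho q (\<sigma> P)) P"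
        using P Fs[OF sub(3)] cells_measure by (intro emeasure_mono) auto
      then show "\<exists>\<tau>. t \<le> \<tau> \<and> \<tau> \<le> u \<and> defect lam c0 \<tau> S \<and> emeasure (rho q \<tau>) S \<le> 1 \<and> u \<le> 16 ^ i * \<tau>"
        using \<sigma>[OF P(1)] P by (intro exI[of _ "\<sigma> P"]) auto
    qed auto
    finally show ?thesis .
  qed
  have sets: "\<Union>Fa \<in> sets lebesgue" "\<Union>Fb \<in> sets lebesgue" "\<Union>Fc \<in> sets lebesgue"
    using Fs[OF sub(1)] Fs[OF sub(2)] Fs[OF sub(3)] cells_sets by auto
  have "\<Union>F = (\<Union>Fa \<union> \<Union>Fb) \<union> \<Union>Fc" by (auto simp: Fa_def Fb_def Fc_def)
  then have "emeasure (rho q t) (\<Union>F) \<le> emeasure (rho q t) (\<Union>Fa \<union> \<Union>Fb) + emeasure (rho q t) (\<Union>Fc)"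
    using sets by (simp add: emeasure_subadditive)
  also have "\<dots> \<le> (emeasure (rho q t) (\<Union>Fa) + emeasure (rho q t) (\<Union>Fb)) + emeasure (rho q t) (\<Union>Fc)"
    using sets by (intro add_right_mono emeasure_subadditive) auto
  also have "\<dots> \<le> (ennreal X + 2 * ennreal X) + 2 * ennreal (4 * 4 ^ i * X)"
    by (intro add_mono a b c)
  also have "\<dots> = ennreal (X + 2 * X + 2 * (4 * 4 ^ i * X))"
  proof -
    have two: "2 * ennreal z = ennreal (2 * z)" if "0 \<le> z" for z
      using that by (simp add: ennreal_mult)
    have "ennreal X + 2 * ennreal X + 2 * ennreal Y = ennreal (X + 2 * X + 2 * Y)" if "0 \<le> Y" for Y
      using X that by (simp only: two ennreal_plus[symmetric] add_nonneg_nonneg mult_nonneg_nonneg zero_le_numeral)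
    then show ?thesis using X by simp
  qed
  also have "\<dots> \<le> ennreal (4 * 4 ^ Suc i * X)"
  proof (rule ennreal_leI)
    have "1 * X \<le> 4 ^ i * X" using X by (intro mult_right_mono) auto
    moreover have "X + 2 * X + 2 * (4 * 4 ^ i * X) = 3 * X + 8 * (4 ^ i * X)" "4 * 4 ^ Suc i * X = 16 * (4 ^ i * X)"
      by simp_all
    ultimately show "X + 2 * X + 2 * (4 * 4 ^ i * X) \<le> 4 * 4 ^ Suc i * X" using X by linarith
  qed
  finally show ?case by (simp add: X_def)
qed

text \<open>The least number \<open>i\<close> of factors 16 leading from \<open>t\<close> to
  \<open>u\<close> or beyond satisfies \<open>4 ^ i \<le> 4 * sqrt (u / t)\<close>. Against the gain
  \<open>t / u\<close> there remains \<open>sqrt (t / u)\<close>, a power of \<open>t\<close> with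
  positive exponent when \<open>\<theta> > 1\<close>.\<close>

lemma defect_family_mass:
  assumes F: "F \<subseteq> cells" "disjoint F"
    and D: "\<And>P. P \<in> F \<Longrightarrow> defect lam c0 t P \<and> emeasure (rho q t) P \<le> 1"
  shows "emeasure (rho q t) (\<Union>F) \<le> ennreal (16 * t powr ((1 - 1 / \<theta>) / 2))"
proof -
  define i where "i = (LEAST i. u \<le> 16 ^ i * t)"
  obtain i0 where "u / t < 16 ^ i0" using real_arch_pow[of 16 "u / t"] by auto
  then have "u \<le> 16 ^ i0 * t" using t by (simp add: field_simps)
  then have i: "u \<le> 16 ^ i * t" unfolding i_def by (rule LeastI)
  have "emeasure (rho q t) (\<Union>F) \<le> ennreal (4 * 4 ^ i * (eps * (t / u)))"
    using D t_le_u i by (intro defect_family[OF F]) blast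
  also have "\<dots> \<le> ennreal (16 * t powr ((1 - 1 / \<theta>) / 2))"
  proof (rule ennreal_leI)
    have r: "0 < t / u" "t / u \<le> 1" using t u t_le_u by auto
    have "4 ^ i \<le> 4 * sqrt (u / t)"
    proof (cases i)
      case 0
      have "1 \<le> u / t" using t t_le_u by simp
      then have "1 \<le> sqrt (u / t)" by simp
      then show ?thesis unfolding 0 power_0 by linarith
    next
      case (Suc k)
      have "\<not> u \<le> 16 ^ k * t" using not_less_Least[of k "\<lambda>i. u \<le> 16 ^ i * t"] Suc by (simp add: i_def)
      then have "(4 ^ k)\<^sup>2 \<le> u / t" using t by (simp add: field_simps power2_eq_square flip: power_mult_distrib)
      then have "4 ^ k \<le> sqrt (u / t)" by (rule real_le_rsqrt)
      then show ?thesis using Suc by simp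
    qed
    then have "4 * 4 ^ i * (eps * (t / u)) \<le> 4 * (4 * sqrt (u / t)) * (1 * (t / u))"
      using eps r t u by (intro mult_mono) auto
    also have "\<dots> = 16 * (sqrt (u / t) * (t / u))" by simp
    also have "sqrt (u / t) * (t / u) = sqrt (t / u)"
    proof -
      have "t / u = sqrt (t / u) * sqrt (t / u)"
        using r(1) by (simp only: real_sqrt_mult_self abs_of_pos)
      moreover have "sqrt (u / t) * sqrt (t / u) = 1" using t u by (simp flip: real_sqrt_mult)
      ultimately show ?thesis by (metis mult.assoc mult_1)
    qed
    also have "sqrt (t / u) = t powr ((1 - 1 / \<theta>) / 2)"
    proof -
      have "t powr (1 / \<theta>) = u" using tu u \<theta> by (simp add: powr_powr)
      then have "t / u = t powr (1 - 1 / \<theta>)" using t by (simp add: powr_diff)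
      then have "sqrt (t / u) = (t powr (1 - 1 / \<theta>)) powr (1 / 2)" using r by (simp add: powr_half_sqrt)
      then show ?thesis by (simp add: powr_powr)
    qed
    finally show "4 * 4 ^ i * (eps * (t / u)) \<le> 16 * t powr ((1 - 1 / \<theta>) / 2)" .
  qed
  finally show ?thesis .
qed

end

end

section \<open>Level sets of the maximal function\<close>

text \<open>The terms with \<open>J - real i \<ge> L\<close> form an initial segment of zeros,
  stripped off by the induction with varying \<open>J\<close>. The bound depends on neither
  \<open>J\<close> nor \<open>N\<close>; it serves with \<open>L = log 2 (g x)\<close> for the
  levels below \<open>g x\<close> and with \<open>L = 0\<close> for the negative levels.\<close>

lemma truncated_geometric_sum:
  fixes \<gamma> J L :: real
  assumes "0 < \<gamma>"
  shows "(\<Sum>i<N. if J - real i < L then 2 powr (\<gamma> * (J - real i)) else 0) \<le> 2 powr (\<gamma> * L) / (1 - 2 powr (- \<gamma>))"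
proof (induction N arbitrary: J)
  case 0
  have "2 powr (- \<gamma>) < 2 powr (0::real)" using assms by (intro powr_less_mono) auto
  then show ?case by simp
next
  case (Suc N)
  define r where "r = 2 powr (- \<gamma>)"
  have r: "0 < r" "r < 1" using assms powr_less_mono[of "-\<gamma>" 0 2] by (auto simp: r_def)
  show ?case
  proof (cases "J < L")
    case True
    have "(\<Sum>i<Suc N. if J - real i < L then 2 powr (\<gamma> * (J - real i)) else 0) \<le> (\<Sum>i<Suc N. 2 powr (\<gamma> * J) * r ^ i)"
    proof (rule sum_mono)
      fix i
      have "r ^ i = 2 powr (- \<gamma> * real i)" by (simp add: r_def powr_powr flip: powr_realpow)
      then have "2 powr (\<gamma> * (J - real i)) = 2 powr (\<gamma> * J) * r ^ i"
        by (simp add: right_diff_distrib flip: powr_add)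
      then show "(if J - real i < L then 2 powr (\<gamma> * (J - real i)) else 0) \<le> 2 powr (\<gamma> * J) * r ^ i"
        using r by simp
    qed
    also have "\<dots> = 2 powr (\<gamma> * J) * ((1 - r ^ Suc N) / (1 - r))"
      using r sum_gp_strict[of r "Suc N"] by (simp only: sum_distrib_left[symmetric]) simp
    also have "\<dots> \<le> 2 powr (\<gamma> * L) * (1 / (1 - r))"
    proof -
      have "r ^ Suc N \<le> 1" "0 \<le> r ^ Suc N" using r power_le_one[of r "Suc N"] by simp_all
      then show ?thesis
        using r True assms by (intro mult_mono divide_right_mono powr_mono mult_left_mono) auto
    qed
    finally show ?thesis by (simp add: r_def)
  next
    case False
    have "(\<Sum>i<Suc N. if J - real i < L then 2 powr (\<gamma> * (J - real i)) else 0) =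
        (\<Sum>i<N. if (J - 1) - real i < L then 2 powr (\<gamma> * ((J - 1) - real i)) else 0)"
    proof -
      have "J - real (Suc i) = (J - 1) - real i" for i by simp
      then show ?thesis using False by (simp only: sum.lessThan_Suc_shift) simp
    qed
    then show ?thesis using Suc[of "J - 1"] by simp
  qed
qed

lemma suminf_le_ennreal_const:
  fixes f :: "nat \<Rightarrow> ennreal"
  assumes "\<And>N. (\<Sum>i<N. f i) \<le> c"
  shows "(\<Sum>i. f i) \<le> c"
  unfolding suminf_eq_SUP by (rule SUP_least) (rule assms)

lemma superlevel_sets:
  fixes g :: "real^'n \<Rightarrow> real"
  assumes "g \<in> borel_measurable lebesgue"
  shows "{x. c < g x} \<in> sets lebesgue"
  using borel_measurable_less[of "\<lambda>_. c" lebesgue g] assms by simp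

context A_infty_cells
begin

definition level :: "(real^'n \<Rightarrow> real) \<Rightarrow> real \<Rightarrow> (real^'n) set" where
  "level g k = \<Union>{R \<in> cells. ennreal lam * emeasure lebesgue R \<le> emeasure lebesgue (R \<inter> {x. 2 powr k < g x})}"

lemma level_sets [measurable]: "level g k \<in> sets lebesgue"
  unfolding level_def by (rule cells_sets) auto

text \<open>The factor \<open>K\<close> in \<open>mass\<close> makes the condition applicable to
  each single cell: the superlevel set has mass at most one at level \<open>K * 2 powr k\<close>,
  hence the cell has mass at most one at \<open>2 powr k\<close>, as the results on defects require.
  The last term comes from the defective maximal cells.\<close>

lemma level_mass:
  assumes g [measurable]: "g \<in> borel_measurable lebesgue"
    and mass: "(\<integral>\<^sup>+x. ennreal ((K * g x) powr q x) \<partial>lebesgue) \<le> 1"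
    and \<theta>: "1 < \<theta>" "\<theta> \<le> 2" "(2 ^ Suc CARD('n)) powr (\<theta> - 1) \<le> 1 + c0 / 4"
  shows "emeasure (rho q (2 powr k)) (level g k) \<le> ennreal (1 / c0) * emeasure (rho q (2 powr k)) {x. 2 powr k < g x} +
    ennreal (16 * (if k < 0 then 2 powr ((1 - 1 / \<theta>) / 2 * k) else 0))"
proof -
  define G where "G = {x. 2 powr k < g x}"
  let ?t = "2 powr k"
  have Gs [measurable]: "G \<in> sets lebesgue" unfolding G_def by (rule superlevel_sets[OF g])
  define S where "S = {R \<in> cells. ennreal lam * emeasure lebesgue R \<le> emeasure lebesgue (R \<inter> G)}"
  have Sc: "S \<subseteq> cells" by (auto simp: S_def)
  have lev: "level g k = \<Union>(tops S)" unfolding level_def G_def[symmetric] S_def[symmetric] by (simp add: Union_tops[OF Sc])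
  have "emeasure (rho q (K * ?t)) G \<le> (\<integral>\<^sup>+x. ennreal ((K * g x) powr q x) \<partial>lebesgue)"
    unfolding emeasure_rho[OF Gs]
  proof (rule nn_integral_mono)
    fix x
    show "ennreal ((K * ?t) powr q x) * indicator G x \<le> ennreal ((K * g x) powr q x)"
    proof (cases "x \<in> G")
      case True
      then have "(K * ?t) powr q x \<le> (K * g x) powr q x"
        using K q_ge1[of x] unfolding G_def by (intro powr_mono2 mult_left_mono) auto
      then show ?thesis using True by (simp add: ennreal_leI)
    qed simp
  qed
  then have G1: "emeasure (rho q (K * ?t)) G \<le> 1" using mass by (rule order_trans)
  have R1: "emeasure (rho q ?t) R \<le> 1" if "R \<in> S" for R
  proof -
    have R: "R \<in> cells" "ennreal lam * emeasure lebesgue R \<le> emeasure lebesgue (R \<inter> G)"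
      using that by (auto simp: S_def)
    have "emeasure (rho q (K * ?t / K)) (\<Union>{R}) \<le> 1"
    proof (rule AI[unfolded cells_A_infty_def, rule_format, of "{R}" G "K * ?t"])
      show "disjoint {R}" by (simp add: disjoint_def)
      have "ennreal (lam / 2) * emeasure lebesgue R \<le> ennreal lam * emeasure lebesgue R"
        using lam by (intro mult_right_mono ennreal_leI) auto
      then show "ennreal (lam / 2) * emeasure lebesgue Q \<le> emeasure lebesgue (G \<inter> Q)" if "Q \<in> {R}" for Q
        using R that by (auto simp: Int_commute)
      have "emeasure (rho q (K * ?t)) (G \<inter> \<Union>{R}) \<le> emeasure (rho q (K * ?t)) G"
        using Gs by (intro emeasure_mono) auto
      then show "emeasure (rho q (K * ?t)) (G \<inter> \<Union>{R}) \<le> 1" using G1 by (rule order_trans)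
    qed (use R K Gs in auto)
    then show ?thesis using K by simp
  qed
  define Fd where "Fd = {P \<in> tops S. defect lam c0 ?t P}"
  define Fn where "Fn = {P \<in> tops S. \<not> defect lam c0 ?t P}"
  have F: "countable H" "disjoint H" "H \<subseteq> cells" if "H \<subseteq> tops S" for H
  proof -
    show "disjoint H" using that tops_disjoint[OF Sc] by (auto simp: disjoint_def)
    show "H \<subseteq> cells" using that tops_cells[OF Sc] by blast
    then show "countable H" using countable_cells countable_subset by blast
  qed
  have sub: "Fd \<subseteq> tops S" "Fn \<subseteq> tops S" by (auto simp: Fd_def Fn_def)
  have "emeasure (rho q ?t) (\<Union>Fn \<inter> UNIV) \<le> ennreal (1 / c0) * emeasure (rho q ?t) (\<Union>Fn \<inter> G)"
  proof (rule emeasure_disjoint_Union_le)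
    fix P assume P: "P \<in> Fn"
    then have Pc: "P \<in> cells" using F[OF sub(2)] by auto
    then show Ps: "P \<in> sets (rho q ?t)" using cells_measure by auto
    have "\<not> emeasure (rho q ?t) (P \<inter> G) < ennreal c0 * emeasure (rho q ?t) P"
    proof
      assume *: "emeasure (rho q ?t) (P \<inter> G) < ennreal c0 * emeasure (rho q ?t) P"
      have "P \<in> S" using P sub tops_subset[OF Sc] by auto
      then have "defect lam c0 ?t P"
        unfolding defect_def using * Ps by (intro bexI[of _ "P \<inter> G"]) (auto simp: S_def)
      then show False using P by (auto simp: Fn_def)
    qed
    then have "ennreal (1 / c0) * (ennreal c0 * emeasure (rho q ?t) P) \<le> ennreal (1 / c0) * emeasure (rho q ?t) (P \<inter> G)"
      by (intro mult_left_mono) auto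
    moreover have "ennreal (1 / c0) * (ennreal c0 * emeasure (rho q ?t) P) = emeasure (rho q ?t) P"
      using c0 by (simp add: mult.assoc[symmetric] flip: ennreal_mult)
    ultimately show "emeasure (rho q ?t) (P \<inter> UNIV) \<le> ennreal (1 / c0) * emeasure (rho q ?t) (P \<inter> G)" by simp
  qed (use F[OF sub(2)] Gs in auto)
  also have "\<dots> \<le> ennreal (1 / c0) * emeasure (rho q ?t) G"
    using Gs by (intro mult_left_mono emeasure_mono) auto
  finally have n: "emeasure (rho q ?t) (\<Union>Fn) \<le> ennreal (1 / c0) * emeasure (rho q ?t) G" by simp
  have D: "defect lam c0 ?t P \<and> emeasure (rho q ?t) P \<le> 1" if "P \<in> Fd" for P
    using that R1 sub tops_subset[OF Sc] by (auto simp: Fd_def)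
  have d: "emeasure (rho q ?t) (\<Union>Fd) \<le> ennreal (16 * (if k < 0 then 2 powr ((1 - 1 / \<theta>) / 2 * k) else 0))"
  proof (cases "k < 0")
    case True
    define u where "u = 2 powr (k / \<theta>)"
    have u: "u < 1" "0 < u" using True \<theta> powr_less_mono[of "k / \<theta>" 0 2] by (auto simp: u_def divide_neg_pos)
    have "?t = u powr \<theta>" using \<theta> by (simp add: u_def powr_powr)
    then have "emeasure (rho q ?t) (\<Union>Fd) \<le> ennreal (16 * ?t powr ((1 - 1 / \<theta>) / 2))"
      using u \<theta> F[OF sub(1)] D by (intro defect_family_mass[of ?t u \<theta>]) auto
    then show ?thesis using True by (simp add: powr_powr mult.commute)
  next
    case False
    then have "1 \<le> ?t" by (simp add: ge_one_powr_ge_zero)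
    then have "Fd = {}" using D no_defect_ge1 F[OF sub(1)] by blast
    then show ?thesis by simp
  qed
  have "level g k = \<Union>Fn \<union> \<Union>Fd" unfolding lev by (auto simp: Fn_def Fd_def)
  then have "emeasure (rho q ?t) (level g k) \<le> emeasure (rho q ?t) (\<Union>Fn) + emeasure (rho q ?t) (\<Union>Fd)"
    using cells_sets F(3)[OF sub(1)] F(3)[OF sub(2)] by (simp add: emeasure_subadditive)
  also have "\<dots> \<le> ennreal (1 / c0) * emeasure (rho q ?t) G + ennreal (16 * (if k < 0 then 2 powr ((1 - 1 / \<theta>) / 2 * k) else 0))"
    by (intro add_mono n d)
  finally show ?thesis unfolding G_def .
qed

text \<open>Since \<open>q \<ge> 1\<close>, the numbers \<open>(2 powr k) powr q x\<close> with
  \<open>2 powr k < g x\<close> are dominated by a geometric progression of sum at most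
  \<open>2 * g x powr q x\<close>. The levels are enumerated downwards from \<open>J\<close>;
  independence of \<open>J\<close> is what the later passage to the limit requires.\<close>

lemma level_mass_sum:
  assumes g [measurable]: "g \<in> borel_measurable lebesgue"
    and mass: "(\<integral>\<^sup>+x. ennreal ((K * g x) powr q x) \<partial>lebesgue) \<le> 1" and g_nn: "\<And>x. 0 \<le> g x"
    and \<theta>: "1 < \<theta>" "\<theta> \<le> 2" "(2 ^ Suc CARD('n)) powr (\<theta> - 1) \<le> 1 + c0 / 4"
  shows "(\<Sum>i. emeasure (rho q (2 powr (J - real i))) (level g (J - real i)))
    \<le> ennreal (2 / c0 + 16 / (1 - 2 powr (- ((1 - 1 / \<theta>) / 2))))"
proof -
  define \<gamma> where "\<gamma> = (1 - 1 / \<theta>) / 2"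
  have \<gamma>: "0 < \<gamma>" using \<theta> by (simp add: \<gamma>_def)
  have "2 powr (- \<gamma>) < 2 powr (0::real)" using \<gamma> by (intro powr_less_mono) auto
  then have den: "0 < 1 - 2 powr (- \<gamma>)" by simp
  define G where "G k = {x. 2 powr k < g x}" for k :: real
  have Gs [measurable]: "G k \<in> sets lebesgue" for k unfolding G_def by (rule superlevel_sets[OF g])
  have pt: "(\<Sum>i<N. ennreal ((2 powr (J - real i)) powr q x) * indicator (G (J - real i)) x) \<le> 2 * ennreal ((K * g x) powr q x)" for N x
  proof (cases "g x = 0")
    case False
    then have gp: "0 < g x" using g_nn[of x] by simp
    have pti: "ennreal ((2 powr (J - real i)) powr q x) * indicator (G (J - real i)) x
      \<le> ennreal (g x powr (q x - 1) * (if J - real i < log 2 (g x) then 2 powr (1 * (J - real i)) else 0))" for i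
    proof (cases "2 powr (J - real i) < g x")
      case True
      let ?t = "2 powr (J - real i)"
      have "?t powr q x = ?t powr (q x - 1) * ?t" by (simp add: powr_diff)
      also have "\<dots> \<le> g x powr (q x - 1) * ?t"
        using True q_ge1[of x] by (intro mult_right_mono powr_mono2) auto
      finally have "?t powr q x \<le> g x powr (q x - 1) * ?t" .
      moreover have "J - real i < log 2 (g x)" using True gp by (simp add: less_log_iff)
      ultimately show ?thesis using True by (simp add: G_def ennreal_leI)
    qed (simp add: G_def)
    have "(\<Sum>i<N. ennreal ((2 powr (J - real i)) powr q x) * indicator (G (J - real i)) x) \<le>
      (\<Sum>i<N. ennreal (g x powr (q x - 1) * (if J - real i < log 2 (g x) then 2 powr (1 * (J - real i)) else 0)))"
      by (intro sum_mono pti)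
    also have "\<dots> = ennreal (g x powr (q x - 1) * (\<Sum>i<N. if J - real i < log 2 (g x) then 2 powr (1 * (J - real i)) else 0))"
      by (subst sum_ennreal) (auto simp: sum_distrib_left)
    also have "\<dots> \<le> ennreal (g x powr (q x - 1) * (2 powr (1 * log 2 (g x)) / (1 - 2 powr (- 1))))"
      by (intro ennreal_leI mult_left_mono truncated_geometric_sum) auto
    also have "g x powr (q x - 1) * (2 powr (1 * log 2 (g x)) / (1 - 2 powr (- 1))) = 2 * g x powr q x"
      using gp by (simp add: powr_diff powr_minus)
    also have "ennreal (2 * g x powr q x) \<le> ennreal (2 * (K * g x) powr q x)"
    proof (rule ennreal_leI)
      have "1 * g x \<le> K * g x" using K gp by (intro mult_right_mono) auto
      then show "2 * g x powr q x \<le> 2 * (K * g x) powr q x"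
        using gp q_ge1[of x] by (intro mult_left_mono powr_mono2) auto
    qed
    finally show ?thesis by (simp add: ennreal_mult)
  qed (use g_nn in \<open>simp add: G_def\<close>)
  have "(\<Sum>i<N. emeasure (rho q (2 powr (J - real i))) (level g (J - real i))) \<le>
    ennreal (2 / c0 + 16 / (1 - 2 powr (- \<gamma>)))" for N
  proof -
    have "(\<Sum>i<N. emeasure (rho q (2 powr (J - real i))) (level g (J - real i))) \<le>
      (\<Sum>i<N. ennreal (1 / c0) * emeasure (rho q (2 powr (J - real i))) (G (J - real i)) +
        ennreal (16 * (if J - real i < 0 then 2 powr (\<gamma> * (J - real i)) else 0)))"
      unfolding \<gamma>_def G_def by (intro sum_mono level_mass[OF g mass \<theta>])
    also have "\<dots> = ennreal (1 / c0) * (\<Sum>i<N. emeasure (rho q (2 powr (J - real i))) (G (J - real i))) +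
       ennreal (16 * (\<Sum>i<N. if J - real i < 0 then 2 powr (\<gamma> * (J - real i)) else 0))"
    proof -
      have "(\<Sum>i<N. ennreal (16 * c i)) = ennreal (16 * (\<Sum>i<N. c i))" if "\<And>i. 0 \<le> c i" for c :: "nat \<Rightarrow> real"
        using that by (subst sum_ennreal) (auto simp: sum_distrib_left)
      moreover have "0 \<le> (if J - real i < 0 then 2 powr (\<gamma> * (J - real i)) else 0)" for i by simp
      ultimately show ?thesis unfolding sum.distrib sum_distrib_left[symmetric] by simp
    qed
    also have "\<dots> \<le> ennreal (1 / c0) * 2 + ennreal (16 * (2 powr (\<gamma> * 0) / (1 - 2 powr (- \<gamma>))))"
    proof (intro add_mono mult_left_mono ennreal_leI)
      have "(\<Sum>i<N. emeasure (rho q (2 powr (J - real i))) (G (J - real i))) =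
        (\<integral>\<^sup>+x. (\<Sum>i<N. ennreal ((2 powr (J - real i)) powr q x) * indicator (G (J - real i)) x) \<partial>lebesgue)"
        by (subst nn_integral_sum) (measurable, simp add: emeasure_rho)
      also have "\<dots> \<le> (\<integral>\<^sup>+x. 2 * ennreal ((K * g x) powr q x) \<partial>lebesgue)"
        by (intro nn_integral_mono pt)
      also have "\<dots> = 2 * (\<integral>\<^sup>+x. ennreal ((K * g x) powr q x) \<partial>lebesgue)"
      proof (rule nn_integral_cmult)
        have "(\<lambda>x. (K * g x) powr q x) \<in> borel_measurable lebesgue" by measurable
        then show "(\<lambda>x. ennreal ((K * g x) powr q x)) \<in> borel_measurable lebesgue" by measurable
      qed
      also have "\<dots> \<le> 2 * 1" using mass by (intro mult_left_mono) auto
      finally show "(\<Sum>i<N. emeasure (rho q (2 powr (J - real i))) (G (J - real i))) \<le> 2" by simp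
      show "(\<Sum>i<N. if J - real i < 0 then 2 powr (\<gamma> * (J - real i)) else 0) \<le> 2 powr (\<gamma> * 0) / (1 - 2 powr (- \<gamma>))"
        by (rule truncated_geometric_sum[OF \<gamma>])
    qed auto
    also have "ennreal (1 / c0) * 2 = ennreal (2 / c0)"
      using c0 ennreal_mult[of "1 / c0" 2] by simp
    also have "ennreal (2 / c0) + ennreal (16 * (2 powr (\<gamma> * 0) / (1 - 2 powr (- \<gamma>)))) =
        ennreal (2 / c0 + 16 / (1 - 2 powr (- \<gamma>)))"
      using c0 den by simp
    finally show ?thesis .
  qed
  then show ?thesis unfolding \<gamma>_def by (rule suminf_le_ennreal_const)
qed

end

text \<open>
  One-third trick: in each coordinate, a short interval that meets an end point of a dyadic interval
  of length \<open>S\<close> cannot meet an end point of the translate by a third of a larger dyadic length.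
\<close>

lemma third_shift:
  fixes a l S :: real
  assumes S: "0 < S" and l: "0 < l" "3 * l < S"
  shows "\<exists>\<sigma>\<in>{0, S * 2 ^ j / 3}. \<exists>m::int. \<sigma> + of_int m * S \<le> a \<and> a + l < \<sigma> + (of_int m + 1) * S"
proof (rule ccontr)
  assume neg: "\<not> ?thesis"
  have P: "\<exists>m::int. a < \<sigma> + of_int m * S \<and> \<sigma> + of_int m * S \<le> a + l" if "\<sigma> \<in> {0, S * 2 ^ j / 3}" for \<sigma>
  proof -
    obtain m :: int where "of_int m \<le> (a - \<sigma>) / S" "(a - \<sigma>) / S < of_int m + 1"
      using floor_exists[of "(a - \<sigma>) / S"] by (auto simp: add.commute)
    then have "of_int m * S \<le> a - \<sigma>" "a - \<sigma> < (of_int m + 1) * S"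
      using S by (simp_all add: pos_le_divide_eq pos_divide_less_eq)
    moreover have "\<not> (\<sigma> + of_int m * S \<le> a \<and> a + l < \<sigma> + (of_int m + 1) * S)"
      using neg that by blast
    ultimately show ?thesis by (intro exI[of _ "m + 1"]) auto
  qed
  obtain m where m: "a < of_int m * S" "of_int m * S \<le> a + l"
    using P[of 0] by auto
  obtain m' where m': "a < S * 2 ^ j / 3 + of_int m' * S" "S * 2 ^ j / 3 + of_int m' * S \<le> a + l"
    using P[of "S * 2 ^ j / 3"] by auto
  \<comment> \<open>The two end points differ by \<open>A = of_int d * S / 3\<close>, and
    \<open>\<bar>A\<bar> < l < S / 3\<close>. So the integer \<open>d\<close> vanishes, and 3 would
    divide \<open>2 ^ j\<close>.\<close>
  define d where "d = 3 * (m - m') - 2 ^ j"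
  define A where "A = of_int m * S - (S * 2 ^ j / 3 + of_int m' * S)"
  have "of_int d * S = 3 * A"
    by (simp add: d_def A_def algebra_simps)
  moreover have "\<bar>A\<bar> < l"
    using m m' unfolding A_def by linarith
  ultimately have "\<bar>of_int d * S\<bar> < S" using l by linarith
  then have "\<bar>of_int d\<bar> < (1::real)" using S by (simp add: abs_mult)
  then have "d = 0" by linarith
  then have "(2::int) ^ j = 3 * (m - m')" by (simp add: d_def)
  then have "(2::int) ^ j mod 3 = 0" by simp
  moreover have "(2::int) ^ j mod 3 = 1 \<or> (2::int) ^ j mod 3 = 2"
  proof (induction j)
    case (Suc j)
    then show ?case unfolding power_Suc by presburger
  qed simp
  ultimately show False by simp
qed

text \<open>Coordinates are translated independently, which gives one grid for each set of
  coordinates.\<close>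

definition shift :: "nat \<Rightarrow> 'n set \<Rightarrow> real^'n" where
  "shift J \<alpha> = (\<chi> i. if i \<in> \<alpha> then 2 ^ J / 3 else 0)"

text \<open>The cell comes from the generation whose side satisfies
  \<open>3 * l < S \<le> 6 * l\<close>, available because the coarsest side exceeds
  \<open>6 * l\<close>. The lower bound feeds \<open>third_shift\<close> in each coordinate, the
  upper one gives \<open>6 ^ CARD('n)\<close>.\<close>

lemma cube_in_shifted_cell:
  fixes Q :: "(real^'n) set"
  assumes l: "0 < l" and Q: "box a (\<chi> i. a $ i + l) \<subseteq> Q" "Q \<subseteq> cbox a (\<chi> i. a $ i + l)" and J: "6 * l < 2 ^ J"
  shows "\<exists>\<alpha>. \<exists>R \<in> dyadic_grid.cells (shift J \<alpha>) (2 ^ J). Q \<subseteq> R \<and> emeasure lebesgue R \<le> ennreal (6 ^ CARD('n)) * emeasure lebesgue Q"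
proof -
  define j where "j = (LEAST j. (2::real) ^ J / 2 ^ Suc j \<le> 3 * l)"
  obtain j0 where "2 ^ J / (3 * l) < (2::real) ^ j0" using real_arch_pow[of 2] by auto
  then have "2 ^ J / 2 ^ j0 \<le> 3 * l" using l by (simp add: field_simps)
  moreover have "(2::real) ^ J / 2 ^ Suc j0 \<le> 2 ^ J / 2 ^ j0" by (simp add: field_simps)
  ultimately have "(2::real) ^ J / 2 ^ Suc j0 \<le> 3 * l" by linarith
  then have j1: "(2::real) ^ J / 2 ^ Suc j \<le> 3 * l" unfolding j_def by (rule LeastI)
  define S where "S = (2::real) ^ J / 2 ^ j"
  have S6: "S \<le> 6 * l" using j1 by (simp add: S_def)
  have S3: "3 * l < S"
  proof (cases j)
    case 0
    then show ?thesis using J l by (simp add: S_def)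
  next
    case (Suc i)
    then have "\<not> (2::real) ^ J / 2 ^ Suc i \<le> 3 * l"
      using not_less_Least[of i "\<lambda>j. (2::real) ^ J / 2 ^ Suc j \<le> 3 * l"] by (simp add: j_def)
    then show ?thesis using Suc by (simp add: S_def)
  qed
  have S: "0 < S" by (simp add: S_def)
  have SJ: "S * 2 ^ j / 3 = 2 ^ J / 3" by (simp add: S_def)
  have "\<forall>i. \<exists>\<sigma>\<in>{0, 2 ^ J / 3}. \<exists>m::int. \<sigma> + of_int m * S \<le> a $ i \<and> a $ i + l < \<sigma> + (of_int m + 1) * S"
    using third_shift[OF S l S3, of j] unfolding SJ by blast
  then obtain \<sigma> m where \<sigma>: "\<And>i. \<sigma> i \<in> {0, 2 ^ J / 3}"
    "\<And>i. \<sigma> i + of_int (m i :: int) * S \<le> a $ i \<and> a $ i + l < \<sigma> i + (of_int (m i) + 1) * S"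
    by metis
  define \<alpha> where "\<alpha> = {i. \<sigma> i \<noteq> 0}"
  have sh: "shift J \<alpha> $ i = \<sigma> i" for i using \<sigma>(1)[of i] by (auto simp: shift_def \<alpha>_def)
  interpret dyadic_grid "shift J \<alpha>" "2 ^ J" by unfold_locales simp
  have "idx j y i = m i" if "a $ i \<le> y $ i" "y $ i \<le> a $ i + l" for y i
  proof -
    have "of_int (m i) \<le> (y $ i - \<sigma> i) / S" "(y $ i - \<sigma> i) / S < of_int (m i) + 1"
      using \<sigma>(2)[of i] that S by (simp_all add: field_simps)
    moreover have "(y $ i - shift J \<alpha> $ i) * 2 ^ j / 2 ^ J = (y $ i - \<sigma> i) / S"
      by (simp add: sh S_def)
    ultimately show ?thesis by (simp add: idx_def floor_eq_iff)
  qed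
  then have "idx j y = m" if "y \<in> cbox a (\<chi> i. a $ i + l)" for y
    using that by (auto simp: mem_box_cart)
  moreover have "a \<in> cbox a (\<chi> i. a $ i + l)" using l by (auto simp: mem_box_cart)
  ultimately have "Q \<subseteq> cell j a" using Q by (auto simp: cell_def)
  moreover have "emeasure lebesgue (cell j a) \<le> ennreal (6 ^ CARD('n)) * emeasure lebesgue Q"
  proof -
    have "emeasure lebesgue (cell j a) = ennreal (S ^ CARD('n))" by (simp add: emeasure_cell S_def)
    also have "\<dots> \<le> ennreal ((6 * l) ^ CARD('n))" using S S6 by (intro ennreal_leI power_mono) auto
    also have "\<dots> = ennreal (6 ^ CARD('n)) * ennreal (l ^ CARD('n))"
      using l by (simp add: power_mult_distrib ennreal_mult)
    finally show ?thesis using cube_between_boxes(2)[OF l Q] by simp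
  qed
  ultimately show ?thesis by (intro exI[of _ \<alpha>] bexI[of _ "cell j a"]) auto
qed

section \<open>Luxemburg norms\<close>

lemma ennpow_mono: "a \<le> b \<Longrightarrow> ennpow a p \<le> ennpow b p"
proof (cases "b = \<infinity>")
  case False
  assume ab: "a \<le> b"
  then have "enn2real a \<le> enn2real b" "a \<noteq> \<infinity>" using False by (auto simp: enn2real_mono less_top top_unique)
  then show ?thesis
    using ab False by (auto simp: ennpow_def intro!: ennreal_leI powr_mono2)
qed (auto simp: ennpow_def top_unique split: if_splits)

lemma ennpow_ennreal: "0 \<le> y \<Longrightarrow> 0 \<le> r \<Longrightarrow> ennpow (ennreal y) (ennreal r) = ennreal (y powr r)"
  by (simp add: ennpow_def)

lemma Lp_ext_norm_cong_AE:
  assumes "AE x in lebesgue. p x = p' x"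
  shows "Lp_ext_norm p g = Lp_ext_norm p' g"
proof -
  have "(\<integral>\<^sup>+x. ennpow (g x / ennreal \<mu>) (p x) \<partial>lebesgue) = (\<integral>\<^sup>+x. ennpow (g x / ennreal \<mu>) (p' x) \<partial>lebesgue)" for \<mu>
    using assms by (intro nn_integral_cong_AE) auto
  then show ?thesis unfolding Lp_ext_norm_def by simp
qed

lemma Lp_ext_norm_mono:
  assumes "\<And>x. g x \<le> g' x"
  shows "Lp_ext_norm p g \<le> Lp_ext_norm p g'"
  unfolding Lp_ext_norm_def
proof (rule Inf_superset_mono, safe)
  fix \<mu> :: real assume \<mu>: "0 < \<mu>" and le: "(\<integral>\<^sup>+x. ennpow (g' x / ennreal \<mu>) (p x) \<partial>lebesgue) \<le> 1"
  have "(\<integral>\<^sup>+x. ennpow (g x / ennreal \<mu>) (p x) \<partial>lebesgue) \<le> (\<integral>\<^sup>+x. ennpow (g' x / ennreal \<mu>) (p x) \<partial>lebesgue)"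
    by (intro nn_integral_mono ennpow_mono divide_right_mono_ennreal assms)
  then show "\<exists>\<mu>'. ennreal \<mu> = ennreal \<mu>' \<and> \<mu>' > 0 \<and> (\<integral>\<^sup>+x. ennpow (g x / ennreal \<mu>') (p x) \<partial>lebesgue) \<le> 1"
    using \<mu> le by (intro exI[of _ \<mu>]) auto
qed

lemma infsum_disjoint:
  fixes t :: "'a set \<Rightarrow> real"
  assumes F: "disjoint F" and E: "\<And>Q. Q \<in> F \<Longrightarrow> E Q \<subseteq> Q"
  shows "Q \<in> F \<Longrightarrow> x \<in> E Q \<Longrightarrow> (\<Sum>\<^sub>\<infinity>Q\<in>F. t Q * indicator (E Q) x) = t Q"
    and "x \<notin> \<Union>(E ` F) \<Longrightarrow> (\<Sum>\<^sub>\<infinity>Q\<in>F. t Q * indicator (E Q) x) = 0"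
proof -
  show "(\<Sum>\<^sub>\<infinity>Q\<in>F. t Q * indicator (E Q) x) = 0" if "x \<notin> \<Union>(E ` F)"
    using that by (intro infsum_0) (auto simp: indicator_def)
  assume Q: "Q \<in> F" "x \<in> E Q"
  have "(\<Sum>\<^sub>\<infinity>Q\<in>F. t Q * indicator (E Q) x) = (\<Sum>\<^sub>\<infinity>Q\<in>{Q}. t Q * indicator (E Q) x)"
  proof (rule infsum_cong_neutral)
    fix Q' assume "Q' \<in> F - {Q}"
    then have "Q' \<inter> Q = {}" using disjointD[OF F, of Q' Q] Q by auto
    then have "x \<notin> E Q'" using E[of Q'] E[of Q] Q \<open>Q' \<in> F - {Q}\<close> by blast
    then show "t Q' * indicator (E Q') x = 0" by simp
  qed (use Q in auto)
  then show "(\<Sum>\<^sub>\<infinity>Q\<in>F. t Q * indicator (E Q) x) = t Q" using Q by simp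
qed

context exponent
begin

lemma modular_indicator:
  assumes "0 < s" "0 < \<mu>" "A \<in> sets lebesgue"
  shows "(\<integral>\<^sup>+x. ennpow (ennreal \<bar>s * indicator A x\<bar> / ennreal \<mu>) (ennreal (q x)) \<partial>lebesgue) = emeasure (rho q (s / \<mu>)) A"
  unfolding emeasure_rho[OF assms(3)]
proof (rule nn_integral_cong)
  fix x
  have "0 \<le> q x" using q_ge1[of x] by simp
  then show "ennpow (ennreal \<bar>s * indicator A x\<bar> / ennreal \<mu>) (ennreal (q x)) = ennreal ((s / \<mu>) powr q x) * indicator A x"
    using assms by (cases "x \<in> A") (simp_all add: divide_ennreal ennpow_ennreal ennpow_ennreal[of 0, simplified])
qed

lemma set_A_inftyI:
  assumes "A_infty (\<lambda>x. ennreal (q x))"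
  obtains r C where "0 < r" "r < 1" "1 \<le> C" "set_A_infty q r C"
proof -
  let ?p = "\<lambda>x. ennreal (q x)"
  obtain r C where r: "0 < r" "r < 1" and C: "C > 0"
    and A: "\<And>F t E. (\<forall>Q\<in>F. is_cube Q) \<Longrightarrow> disjoint F \<Longrightarrow> (\<forall>Q\<in>F. t Q \<ge> 0) \<Longrightarrow>
          (\<forall>Q\<in>F. E Q \<in> sets lebesgue \<and> E Q \<subseteq> Q \<and> emeasure lebesgue (E Q) \<ge> ennreal r * emeasure lebesgue Q) \<Longrightarrow>
          Lp_norm ?p (\<lambda>x. \<Sum>\<^sub>\<infinity>Q\<in>F. t Q * indicator Q x)
            \<le> ennreal C * Lp_norm ?p (\<lambda>x. \<Sum>\<^sub>\<infinity>Q\<in>F. t Q * indicator (E Q) x)"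
    using assms unfolding A_infty_def by blast
  \<comment> \<open>Enlarging \<open>C\<close> makes the norm strictly smaller than the new
    constant, so some admissible \<mu> lies below it, and monotonicity in the level does the
    rest.\<close>
  have "set_A_infty q r (C + 1)"
    unfolding set_A_infty_def
  proof (intro allI impI)
    fix F A s
    assume F: "\<forall>Q\<in>F. is_cube Q" "disjoint F" and As: "A \<in> sets lebesgue" and s: "0 < s"
      and dens: "\<forall>Q\<in>F. ennreal r * emeasure lebesgue Q \<le> emeasure lebesgue (A \<inter> Q)"
      and le: "emeasure (rho q s) (A \<inter> \<Union>F) \<le> 1"
    have cF: "countable F" using F countable_disjoint_cubes by blast
    have Fs: "\<Union>F \<in> sets lebesgue" using cF F is_cube_measure(1) by (intro sets.countable_Union) auto
    have step: "(\<lambda>x. \<Sum>\<^sub>\<infinity>Q\<in>F. s * indicator (B \<inter> Q) x) = (\<lambda>x. s * indicator (B \<inter> \<Union>F) x :: real)" for B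
    proof
      fix x
      show "(\<Sum>\<^sub>\<infinity>Q\<in>F. s * indicator (B \<inter> Q) x) = s * indicator (B \<inter> \<Union>F) x"
      proof (cases "x \<in> B \<inter> \<Union>F")
        case True
        then obtain Q where "Q \<in> F" "x \<in> B \<inter> Q" by blast
        then show ?thesis
          using infsum_disjoint(1)[OF F(2), of "\<lambda>Q. B \<inter> Q" Q x "\<lambda>_. s"] True by simp
      next
        case False
        then show ?thesis
          using infsum_disjoint(2)[OF F(2), of "\<lambda>Q. B \<inter> Q" x "\<lambda>_. s"] by auto
      qed
    qed
    have "Lp_norm ?p (\<lambda>x. \<Sum>\<^sub>\<infinity>Q\<in>F. s * indicator Q x)
            \<le> ennreal C * Lp_norm ?p (\<lambda>x. \<Sum>\<^sub>\<infinity>Q\<in>F. s * indicator (A \<inter> Q) x)"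
    proof (rule A[of F "\<lambda>_. s" "\<lambda>Q. A \<inter> Q"])
      show "\<forall>Q\<in>F. A \<inter> Q \<in> sets lebesgue \<and> A \<inter> Q \<subseteq> Q \<and> ennreal r * emeasure lebesgue Q \<le> emeasure lebesgue (A \<inter> Q)"
        using As F is_cube_measure(1) dens by blast
    qed (use F s in auto)
    then have norm: "Lp_norm ?p (\<lambda>x. s * indicator (\<Union>F) x) \<le> ennreal C * Lp_norm ?p (\<lambda>x. s * indicator (A \<inter> \<Union>F) x)"
      using step[of A] step[of UNIV] by simp
    have "(\<integral>\<^sup>+x. ennpow (ennreal \<bar>s * indicator (A \<inter> \<Union>F) x\<bar> / ennreal 1) (?p x) \<partial>lebesgue) \<le> 1"
      using le s As Fs by (subst modular_indicator) auto
    then have "Lp_norm ?p (\<lambda>x. s * indicator (A \<inter> \<Union>F) x) \<le> ennreal 1"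
      unfolding Lp_norm_def Lp_ext_norm_def by (intro Inf_lower CollectI exI[of _ 1]) auto
    then have "ennreal C * Lp_norm ?p (\<lambda>x. s * indicator (A \<inter> \<Union>F) x) \<le> ennreal C * ennreal 1"
      by (rule mult_left_mono) simp
    also have "\<dots> < ennreal (C + 1)" using C by (simp add: ennreal_lessI)
    finally have "Lp_norm ?p (\<lambda>x. s * indicator (\<Union>F) x) < ennreal (C + 1)"
      using norm by (rule le_less_trans[rotated])
    then obtain \<mu> where \<mu>: "0 < \<mu>" "ennreal \<mu> < ennreal (C + 1)"
      "(\<integral>\<^sup>+x. ennpow (ennreal \<bar>s * indicator (\<Union>F) x\<bar> / ennreal \<mu>) (?p x) \<partial>lebesgue) \<le> 1"
      unfolding Lp_norm_def Lp_ext_norm_def Inf_less_iff by blast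
    have "\<mu> < C + 1" using \<mu>(1,2) by (simp add: ennreal_less_iff)
    then have "emeasure (rho q (s / (C + 1))) (\<Union>F) \<le> emeasure (rho q (s / \<mu>)) (\<Union>F)"
      using s C \<mu>(1) Fs by (intro rho_mono divide_left_mono) auto
    also have "\<dots> \<le> 1" using \<mu>(3) unfolding modular_indicator[OF s \<mu>(1) Fs] .
    finally show "emeasure (rho q (s / (C + 1))) (\<Union>F) \<le> 1" .
  qed
  with that[of r "C + 1"] r C show ?thesis by simp
qed

end

lemma rearr_less_imp:
  assumes "ennreal \<alpha> < rearr r f Q" "0 < \<alpha>"
  shows "ennreal r * emeasure lebesgue Q < emeasure lebesgue {x \<in> Q. \<bar>f x\<bar> > \<alpha>}"
proof (rule ccontr)
  assume "\<not> ?thesis"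
  then have "rearr r f Q \<le> ennreal \<alpha>"
    unfolding rearr_def using assms(2) by (intro Inf_lower CollectI exI[of _ \<alpha>]) auto
  with assms(1) show False by simp
qed

section \<open>Boundedness of the median maximal operator implies the condition\<close>

lemma median_max_bounded_imp_A_infty:
  fixes p :: "real^'n \<Rightarrow> ennreal"
  assumes t: "0 < t" "t < 1" and bd: "median_max_bounded t p"
  shows "A_infty p"
proof -
  obtain C where C: "C > 0" "\<And>f. f \<in> Lp_space p \<Longrightarrow> Lp_ext_norm p (median_max t f) \<le> ennreal C * Lp_norm p f"
    using bd unfolding median_max_bounded_def by blast
  \<comment> \<open>Any density strictly between \<open>t\<close> and 1 would do: for
    \<open>\<alpha> < s Q\<close> the set \<open>E Q\<close> alone then makes \<alpha> inadmissible
    in \<open>rearr t f Q\<close>.\<close>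
  define r where "r = (1 + t) / 2"
  have r: "0 < r" "r < 1" "t < r" using t by (auto simp: r_def)
  show ?thesis
    unfolding A_infty_def
  proof (rule exI[of _ r], rule exI[of _ C], intro conjI allI impI)
    fix F :: "(real^'n) set set" and s :: "(real^'n) set \<Rightarrow> real" and E :: "(real^'n) set \<Rightarrow> (real^'n) set"
    assume F: "\<forall>Q\<in>F. is_cube Q" "disjoint F" and s: "\<forall>Q\<in>F. s Q \<ge> 0"
      and E: "\<forall>Q\<in>F. E Q \<in> sets lebesgue \<and> E Q \<subseteq> Q \<and> emeasure lebesgue (E Q) \<ge> ennreal r * emeasure lebesgue Q"
    define f where "f x = (\<Sum>\<^sub>\<infinity>Q\<in>F. s Q * indicator (E Q) x)" for x
    define g where "g x = (\<Sum>\<^sub>\<infinity>Q\<in>F. s Q * indicator Q x)" for x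
    have f_in: "f x = s Q" if "Q \<in> F" "x \<in> E Q" for x Q
      unfolding f_def using infsum_disjoint(1)[OF F(2), of E Q x s] E that by auto
    have f_out: "f x = 0" if "x \<notin> \<Union>(E ` F)" for x
      unfolding f_def using infsum_disjoint(2)[OF F(2), of E x s] E that by auto
    have g_in: "g x = s Q" if "Q \<in> F" "x \<in> Q" for x Q
      unfolding g_def using infsum_disjoint(1)[OF F(2), of "\<lambda>Q. Q" Q x s] that by auto
    have g_out: "g x = 0" if "x \<notin> \<Union>F" for x
      unfolding g_def using infsum_disjoint(2)[OF F(2), of "\<lambda>Q. Q" x s] that by auto
    have cF: "countable F" using F countable_disjoint_cubes by blast
    have f_meas [measurable]: "f \<in> borel_measurable lebesgue"
      unfolding borel_measurable_iff_greater
    proof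
      fix a
      show "{x \<in> space lebesgue. a < f x} \<in> sets lebesgue"
      proof (cases "a < 0")
        case True
        have "0 \<le> f x" for x using f_in f_out s by (cases "x \<in> \<Union>(E ` F)") auto
        then have "{x \<in> space lebesgue. a < f x} = space lebesgue" using True by (auto intro: less_le_trans)
        then show ?thesis by simp
      next
        case False
        have "{x \<in> space lebesgue. a < f x} = (\<Union>Q\<in>{Q \<in> F. a < s Q}. E Q)"
        proof
          show "{x \<in> space lebesgue. a < f x} \<subseteq> (\<Union>Q\<in>{Q \<in> F. a < s Q}. E Q)"
          proof
            fix x assume x: "x \<in> {x \<in> space lebesgue. a < f x}"
            then have "x \<in> \<Union>(E ` F)" using f_out[of x] False by auto
            then obtain Q where "Q \<in> F" "x \<in> E Q" by blast
            then show "x \<in> (\<Union>Q\<in>{Q \<in> F. a < s Q}. E Q)" using f_in x by auto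
          qed
        qed (use f_in in auto)
        moreover have "(\<Union>Q\<in>{Q \<in> F. a < s Q}. E Q) \<in> sets lebesgue"
          using cF E by (intro sets.countable_UN') auto
        ultimately show ?thesis by simp
      qed
    qed
    have pt: "ennreal \<bar>g x\<bar> \<le> median_max t f x" for x
    proof (cases "x \<in> \<Union>F")
      case True
      then obtain Q where Q: "Q \<in> F" "x \<in> Q" by blast
      then have Qc: "is_cube Q" using F by auto
      note Qm = is_cube_measure[OF Qc]
      have "ennreal (s Q) \<le> rearr t f Q"
        unfolding rearr_def
      proof (rule Inf_greatest, safe)
        fix \<alpha> :: real assume \<alpha>: "0 < \<alpha>" "emeasure lebesgue {x \<in> Q. \<alpha> < \<bar>f x\<bar>} \<le> ennreal t * emeasure lebesgue Q"
        show "ennreal (s Q) \<le> ennreal \<alpha>"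
        proof (rule ccontr)
          assume "\<not> ennreal (s Q) \<le> ennreal \<alpha>"
          then have "\<alpha> < s Q" using ennreal_leI not_le by blast
          then have sub: "E Q \<subseteq> {x \<in> Q. \<alpha> < \<bar>f x\<bar>}" using f_in[OF Q(1)] E Q(1) s by fastforce
          have "{x \<in> Q. \<alpha> < \<bar>f x\<bar>} = Q \<inter> {x. \<alpha> < \<bar>f x\<bar>}" by auto
          also have "\<dots> \<in> sets lebesgue" using Qm superlevel_sets[of "\<lambda>x. \<bar>f x\<bar>" \<alpha>] f_meas by auto
          finally have "emeasure lebesgue (E Q) \<le> emeasure lebesgue {x \<in> Q. \<alpha> < \<bar>f x\<bar>}"
            using sub by (intro emeasure_mono) auto
          then have "ennreal r * emeasure lebesgue Q \<le> ennreal t * emeasure lebesgue Q"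
            using \<alpha>(2) E Q(1) by (meson order_trans)
          moreover have "ennreal t * emeasure lebesgue Q < ennreal r * emeasure lebesgue Q"
            using Qm r t by (intro ennreal_mult_strict_right_mono) (auto simp: ennreal_lessI)
          ultimately show False by simp
        qed
      qed
      also have "\<dots> \<le> median_max t f x"
        unfolding median_max_def using Q Qc by (intro SUP_upper) auto
      finally show ?thesis using g_in[OF Q] s Q by simp
    qed (simp add: g_out)
    show "Lp_norm p (\<lambda>x. \<Sum>\<^sub>\<infinity>Q\<in>F. s Q * indicator Q x)
            \<le> ennreal C * Lp_norm p (\<lambda>x. \<Sum>\<^sub>\<infinity>Q\<in>F. s Q * indicator (E Q) x)"
    proof (cases "Lp_norm p f < \<infinity>")
      case True
      then have "f \<in> Lp_space p" by (simp add: Lp_space_def)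
      have "Lp_norm p g \<le> Lp_ext_norm p (median_max t f)"
        unfolding Lp_norm_def by (rule Lp_ext_norm_mono) (rule pt)
      also have "\<dots> \<le> ennreal C * Lp_norm p f" by (rule C(2)) fact
      finally show ?thesis unfolding f_def g_def .
    next
      case False
      then have "ennreal C * Lp_norm p f = \<infinity>" using C(1) by (simp add: not_less top_unique ennreal_mult_top)
      then show ?thesis unfolding f_def by simp
    qed
  qed (use r C in auto)
qed

section \<open>The condition implies boundedness of the median maximal operator\<close>

lemma ennreal_less_divideD:
  fixes m :: ennreal
  assumes "ennreal a < m / ennreal c" "0 \<le> a" "0 < c"
  shows "ennreal (a * c) < m"
proof (cases m)
  case (real r)
  then have "a < r / c" using assms by (simp add: divide_ennreal ennreal_less_iff)
  then show ?thesis using real assms by (simp add: field_simps ennreal_less_iff)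
qed simp

context exponent
begin

text \<open>By \<open>q \<ge> 1\<close>, division by \<open>k\<close> gains at least the factor
  \<open>1 / k\<close>. This converts a bound of the modular by some constant into a bound by one,
  that is, into a bound of the norm.\<close>

lemma ennpow_divide_le:
  assumes "1 \<le> k"
  shows "ennpow (w / ennreal k) (ennreal (q x)) \<le> ennreal (1 / k) * ennpow w (ennreal (q x))"
proof (cases w)
  case (real y)
  have "(y / k) powr q x = y powr q x * (1 / k) powr q x"
    using real assms powr_mult[of y "1 / k" "q x"] by simp
  also have "\<dots> \<le> y powr q x * (1 / k) powr 1"
    using assms q_ge1[of x] by (intro mult_left_mono powr_mono') auto
  finally have "(y / k) powr q x \<le> 1 / k * y powr q x" using assms by simp
  moreover have "0 \<le> q x" using q_ge1[of x] by simp
  ultimately show ?thesis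
    using real assms by (simp add: divide_ennreal ennpow_ennreal ennreal_leI flip: ennreal_mult)
next
  case top
  have "ennreal (1 / k) \<noteq> 0" using assms by simp
  then show ?thesis using top by (simp add: ennpow_def ennreal_mult_top)
qed

text \<open>
  Below, \<open>J\<close> bounds both the sides of the cells and the levels; a given cube and level are admitted
  for all large \<open>J\<close>. Since the maximal function need not be monotonically approximated, the passage
  \<open>J \<rightarrow> \<infinity>\<close> uses Fatou's lemma.
\<close>

lemma median_modular_bound:
  assumes AI: "set_A_infty q r C" and r: "0 < r" "r < 1" and C: "1 \<le> C"
  shows "\<exists>D>0. \<forall>f\<in>borel_measurable lebesgue. \<forall>\<mu>>0.
    (\<integral>\<^sup>+x. ennpow (ennreal \<bar>f x\<bar> / ennreal \<mu>) (ennreal (q x)) \<partial>lebesgue) \<le> 1 \<longrightarrow>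
    (\<integral>\<^sup>+x. ennpow (median_max (1/2) f x / ennreal (D * \<mu>)) (ennreal (q x)) \<partial>lebesgue) \<le> 1"
proof -
  \<comment> \<open>The cell around \<open>Q\<close> has at most \<open>6 ^ CARD('n)\<close> times
    its volume, so density one half in \<open>Q\<close> becomes density at least \<open>lam\<close>
    in the cell.\<close>
  define lam :: real where "lam = (1 / 6 ^ CARD('n)) / 2"
  have "(1::real) \<le> 6 ^ CARD('n)" by (rule one_le_power) simp
  then have lam: "0 < lam" "lam \<le> 1 / 2" by (simp_all add: lam_def field_simps)
  have "0 < lam / 2" using lam by simp
  then obtain K where K: "1 \<le> K" "\<And>b h. 0 < h \<Longrightarrow> dyadic_grid.cells_A_infty b h q (lam / 2) K"
    using cells_A_infty_small[OF AI r C, of "lam / 2"] by blast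
  have ac: "A_infty_cells b h q pp lam K" if "0 < h" for b h
    by (intro A_infty_cells.intro dyadic_grid.intro A_infty_cells_axioms.intro exponent_axioms that lam K)
  define c0 where "c0 = fine_const pp K lam"
  have c0: "0 < c0" "c0 \<le> 1" unfolding c0_def using A_infty_cells.c0[OF ac[of 1 0]] by auto
  define A :: real where "A = 2 ^ Suc CARD('n)"
  have A2: "2 \<le> A" unfolding A_def using one_le_power[of "2::real" "CARD('n)"] by simp
  define \<theta> where "\<theta> = 1 + log A (1 + c0 / 4)"
  have \<theta>: "1 < \<theta>" "\<theta> \<le> 2" "A powr (\<theta> - 1) \<le> 1 + c0 / 4"
    using A2 c0 by (auto simp: \<theta>_def)
  define \<gamma> where "\<gamma> = (1 - 1 / \<theta>) / 2"
  define B where "B = 2 / c0 + 16 / (1 - 2 powr (- \<gamma>))"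
  have "0 < \<gamma>" using \<theta> by (simp add: \<gamma>_def)
  then have "2 powr (- \<gamma>) < 2 powr (0::real)" by (intro powr_less_mono) auto
  then have B: "0 \<le> B" using c0 by (simp add: B_def)
  \<comment> \<open>One summand for each of the \<open>2 ^ CARD('n)\<close> grids;
    \<open>2 powr pp\<close> pays for replacing a value between two powers of 2 by the larger
    one.\<close>
  define M where "M = 2 ^ CARD('n) * (2 powr pp * B)"
  define k0 where "k0 = max 1 M"
  have k0: "1 \<le> k0" "M \<le> k0" by (auto simp: k0_def)
  show ?thesis
  proof (intro exI[of _ "K * k0"] conjI ballI allI impI)
    show "0 < K * k0" using K k0 by simp
    fix f :: "real^'n \<Rightarrow> real" and \<mu> :: real
    assume f [measurable]: "f \<in> borel_measurable lebesgue" and \<mu>: "0 < \<mu>"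
      and mod: "(\<integral>\<^sup>+x. ennpow (ennreal \<bar>f x\<bar> / ennreal \<mu>) (ennreal (q x)) \<partial>lebesgue) \<le> 1"
    define g where "g x = \<bar>f x\<bar> / (K * \<mu>)" for x
    have g [measurable]: "g \<in> borel_measurable lebesgue" unfolding g_def by measurable
    have g_nn: "0 \<le> g x" for x using K \<mu> by (simp add: g_def)
    have mass: "(\<integral>\<^sup>+x. ennreal ((K * g x) powr q x) \<partial>lebesgue) \<le> 1"
    proof -
      have "ennreal ((K * g x) powr q x) = ennpow (ennreal \<bar>f x\<bar> / ennreal \<mu>) (ennreal (q x))" for x
      proof -
        have "K * g x = \<bar>f x\<bar> / \<mu>" using K by (simp add: g_def)
        moreover have "0 \<le> q x" using q_ge1[of x] by simp
        ultimately show ?thesis using \<mu> by (simp add: divide_ennreal ennpow_ennreal)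
      qed
      then show ?thesis using mod by simp
    qed
    define lev where "lev J \<alpha> k = A_infty_cells.level (shift J \<alpha>) (2 ^ J) lam g k" for J and \<alpha> :: "'n set" and k
    have acJ: "A_infty_cells (shift J \<alpha>) (2 ^ J) q pp lam K" for J and \<alpha> :: "'n set" by (rule ac) simp
    have lev_sets [measurable]: "lev J \<alpha> k \<in> sets lebesgue" for J \<alpha> k
      unfolding lev_def by (rule A_infty_cells.level_sets[OF acJ])
    have sum: "(\<Sum>i. emeasure (rho q (2 powr (real J - real i))) (lev J \<alpha> (real J - real i))) \<le> ennreal B" for J \<alpha>
      unfolding lev_def B_def \<gamma>_def c0_def
      by (rule A_infty_cells.level_mass_sum[OF acJ g mass g_nn \<theta>(1,2) \<theta>(3)[unfolded A_def c0_def]])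
    define \<Phi> where "\<Phi> J x = (\<Sum>\<alpha>\<in>(UNIV::'n set set). \<Sum>i.
       ennreal ((2 * 2 powr (real J - real i)) powr q x) * indicator (lev J \<alpha> (real J - real i)) x)" for J x
    have \<Phi>_meas [measurable]: "\<Phi> J \<in> borel_measurable lebesgue" for J
      unfolding \<Phi>_def by measurable
    have \<Phi>_int: "(\<integral>\<^sup>+x. \<Phi> J x \<partial>lebesgue) \<le> ennreal M" for J
    proof -
      have "(\<integral>\<^sup>+x. \<Phi> J x \<partial>lebesgue) = (\<Sum>\<alpha>\<in>(UNIV::'n set set). \<Sum>i.
         emeasure (rho q (2 * 2 powr (real J - real i))) (lev J \<alpha> (real J - real i)))"
        unfolding \<Phi>_def emeasure_rho[OF lev_sets]
        by (subst nn_integral_sum, measurable, subst nn_integral_suminf, measurable)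
      also have "\<dots> \<le> (\<Sum>\<alpha>\<in>(UNIV::'n set set). ennreal (2 powr pp * B))"
      proof (rule sum_mono)
        fix \<alpha> :: "'n set"
        have "(\<Sum>i. emeasure (rho q (2 * 2 powr (real J - real i))) (lev J \<alpha> (real J - real i))) \<le>
          (\<Sum>i. ennreal (2 powr pp) * emeasure (rho q (2 powr (real J - real i))) (lev J \<alpha> (real J - real i)))"
          by (intro suminf_le rho_scale lev_sets) auto
        also have "\<dots> = ennreal (2 powr pp) * (\<Sum>i. emeasure (rho q (2 powr (real J - real i))) (lev J \<alpha> (real J - real i)))"
          by (rule ennreal_suminf_cmult)
        also have "\<dots> \<le> ennreal (2 powr pp) * ennreal B" by (intro mult_left_mono sum) auto
        also have "\<dots> = ennreal (2 powr pp * B)" using B by (simp add: ennreal_mult)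
        finally show "(\<Sum>i. emeasure (rho q (2 * 2 powr (real J - real i))) (lev J \<alpha> (real J - real i))) \<le> ennreal (2 powr pp * B)" .
      qed
      also have "\<dots> = ennreal M"
      proof -
        have "card (UNIV :: 'n set set) = 2 ^ CARD('n)"
          using card_Pow[of "UNIV :: 'n set"] by simp
        then show ?thesis using B by (simp add: M_def ennreal_mult flip: ennreal_power)
      qed
      finally show ?thesis .
    qed
    define w where "w x = median_max (1/2) f x / ennreal (K * \<mu>)" for x
    \<comment> \<open>A cube that realizes the level at \<open>x\<close> fits into a cell of some
      translated grid for every large \<open>J\<close>, and the level occurs in the enumeration once
      \<open>J \<ge> k\<close>. How large \<open>J\<close> must be depends on the point, so the
      bound is only eventual.\<close>
    have key: "\<forall>\<^sub>F J in sequentially. ennreal ((2 * 2 powr of_int k) powr q x) \<le> \<Phi> J x"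
      if "ennreal (2 powr of_int k) < w x" for k :: int and x
    proof -
      have "ennreal (2 powr of_int k * (K * \<mu>)) < median_max (1/2) f x"
        using that K \<mu> unfolding w_def by (intro ennreal_less_divideD) auto
      then obtain Q where Q: "is_cube Q" "x \<in> Q" "ennreal (2 powr of_int k * (K * \<mu>)) < rearr (1/2) f Q"
        unfolding median_max_def less_SUP_iff by auto
      have "{y \<in> Q. \<bar>f y\<bar> > 2 powr of_int k * (K * \<mu>)} = Q \<inter> {y. 2 powr of_int k < g y}"
        using K \<mu> by (auto simp: g_def pos_less_divide_eq)
      then have half: "ennreal (1/2) * emeasure lebesgue Q < emeasure lebesgue (Q \<inter> {y. 2 powr of_int k < g y})"
        using rearr_less_imp[OF Q(3)] K \<mu> by simp
      obtain a l where l: "0 < l" "box a (\<chi> i. a $ i + l) \<subseteq> Q" "Q \<subseteq> cbox a (\<chi> i. a $ i + l)"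
        using is_cube_boxE[OF Q(1)] .
      obtain J0 where J0: "6 * l < 2 ^ J0" using real_arch_pow[of 2 "6 * l"] by auto
      show ?thesis
        unfolding eventually_sequentially
      proof (intro exI[of _ "max J0 (nat k)"] allI impI)
        fix J assume J: "max J0 (nat k) \<le> J"
        have "(2::real) ^ J0 \<le> 2 ^ J" using J by (intro power_increasing) auto
        then have "6 * l < 2 ^ J" using J0 by linarith
        then obtain \<alpha> R where R: "R \<in> dyadic_grid.cells (shift J \<alpha>) (2 ^ J)" "Q \<subseteq> R"
          "emeasure lebesgue R \<le> ennreal (6 ^ CARD('n)) * emeasure lebesgue Q"
          using cube_in_shifted_cell[OF l] by blast
        have Rs: "R \<in> sets lebesgue"
          by (rule dyadic_grid.cells_measure(1)[OF _ R(1)]) (simp add: dyadic_grid_def)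
        have "ennreal lam * emeasure lebesgue R \<le> ennreal lam * (ennreal (6 ^ CARD('n)) * emeasure lebesgue Q)"
          by (intro mult_left_mono R) auto
        also have "\<dots> = ennreal (1/2) * emeasure lebesgue Q"
        proof -
          have "ennreal lam * ennreal (6 ^ CARD('n)) = ennreal (lam * 6 ^ CARD('n))"
            using lam by (subst ennreal_mult) auto
          also have "lam * 6 ^ CARD('n) = 1/2" by (simp add: lam_def)
          finally show ?thesis by (simp only: mult.assoc[symmetric])
        qed
        also have "\<dots> \<le> emeasure lebesgue (R \<inter> {y. 2 powr of_int k < g y})"
          using half R(2) Rs superlevel_sets[OF g]
          by (intro order_trans[OF less_imp_le[OF half]] emeasure_mono) auto
        finally have "ennreal lam * emeasure lebesgue R \<le> emeasure lebesgue (R \<inter> {y. 2 powr of_int k < g y})" .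
        then have "x \<in> lev J \<alpha> (of_int k)"
          using R Q(2) unfolding lev_def A_infty_cells.level_def[OF acJ] by blast
        moreover define i where "i = nat (int J - k)"
        have "k \<le> int J" using J by linarith
        then have "real J - real i = of_int k" by (simp add: i_def of_nat_nat)
        moreover define \<phi> where "\<phi> \<beta> m = ennreal ((2 * 2 powr (real J - real m)) powr q x) * indicator (lev J \<beta> (real J - real m)) x" for \<beta> m
        ultimately have "ennreal ((2 * 2 powr of_int k) powr q x) = sum (\<phi> \<alpha>) {i}" by simp
        also have "\<dots> \<le> suminf (\<phi> \<alpha>)"
          by (intro sum_le_suminf) auto
        also have "\<dots> \<le> (\<Sum>\<beta>\<in>UNIV. suminf (\<phi> \<beta>))"
          by (rule member_le_sum[of \<alpha> UNIV "\<lambda>\<beta>. suminf (\<phi> \<beta>)"]) auto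
        also have "\<dots> = \<Phi> J x" unfolding \<Phi>_def \<phi>_def[abs_def] ..
        finally show "ennreal ((2 * 2 powr of_int k) powr q x) \<le> \<Phi> J x" .
      qed
    qed
    have pt: "ennpow (w x) (ennreal (q x)) \<le> liminf (\<lambda>J. \<Phi> J x)" for x
    proof -
      have qx: "0 \<le> q x" using q_ge1[of x] by simp
      have low: "ennreal ((2 * 2 powr of_int k) powr q x) \<le> liminf (\<lambda>J. \<Phi> J x)"
        if "ennreal (2 powr of_int k) < w x" for k :: int
        by (rule Liminf_bounded[OF key[OF that]])
      consider (zero) "w x = 0" | (top) "w x = \<infinity>" | (pos) y where "w x = ennreal y" "0 < y"
        by (cases "w x") (auto simp: less_le)
      then show ?thesis
      proof cases
        case zero
        then show ?thesis using qx by (simp add: ennpow_def)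
      next
        case top
        have "liminf (\<lambda>J. \<Phi> J x) = \<infinity>"
        proof (rule ccontr)
          assume "liminf (\<lambda>J. \<Phi> J x) \<noteq> \<infinity>"
          then obtain z where z: "liminf (\<lambda>J. \<Phi> J x) = ennreal z" "0 \<le> z"
            by (cases "liminf (\<lambda>J. \<Phi> J x)") auto
          obtain k where k: "z < 2 ^ k" using real_arch_pow[of 2 z] by auto
          have one: "(1::real) \<le> 2 ^ k" by (rule one_le_power) simp
          then have "(1::real) \<le> 2 * 2 ^ k" by linarith
          with q_ge1[of x] have "(2 * 2 ^ k) powr 1 \<le> (2 * 2 ^ k :: real) powr q x" by (rule powr_mono)
          moreover have "(2 * 2 ^ k :: real) powr 1 = 2 * 2 ^ k" by simp
          ultimately have "z < (2 * 2 ^ k) powr q x" using k one by linarith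
          moreover have "ennreal ((2 * 2 powr of_int (int k)) powr q x) \<le> ennreal z"
            using low[of "int k"] top z by simp
          ultimately show False using z(2) by (simp add: powr_realpow ennreal_le_iff)
        qed
        then show ?thesis by simp
      next
        case pos
        \<comment> \<open>This gives \<open>2 powr k < y \<le> 2 powr (k + 1)\<close>, strict at the
          lower end as \<open>low\<close> demands.\<close>
        define k where "k = \<lceil>log 2 y\<rceil> - 1"
        have "of_int k < log 2 y" "log 2 y \<le> of_int k + 1" unfolding k_def by linarith+
        then have k: "2 powr of_int k < y" "y \<le> 2 powr (of_int k + 1)"
          using pos(2) by (simp_all add: less_log_iff log_le_iff)
        have "y powr q x \<le> (2 * 2 powr of_int k) powr q x"
          using k(2) pos(2) qx by (intro powr_mono2) (auto simp: powr_add)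
        then have "ennpow (w x) (ennreal (q x)) \<le> ennreal ((2 * 2 powr of_int k) powr q x)"
          using pos qx by (simp add: ennpow_ennreal ennreal_leI)
        also have "\<dots> \<le> liminf (\<lambda>J. \<Phi> J x)"
          using k(1) pos by (intro low) (simp add: ennreal_lessI)
        finally show ?thesis .
      qed
    qed
    have liminf_int: "(\<integral>\<^sup>+x. liminf (\<lambda>J. \<Phi> J x) \<partial>lebesgue) \<le> ennreal M"
    proof -
      have "(\<integral>\<^sup>+x. liminf (\<lambda>J. \<Phi> J x) \<partial>lebesgue) \<le> liminf (\<lambda>J. \<integral>\<^sup>+x. \<Phi> J x \<partial>lebesgue)"
        by (rule nn_integral_liminf) (rule \<Phi>_meas)
      also have "\<dots> \<le> liminf (\<lambda>J::nat. ennreal M)"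
        by (intro Liminf_mono always_eventually allI \<Phi>_int)
      finally show ?thesis by (simp add: Liminf_const)
    qed
    have "median_max (1/2) f x / ennreal (K * k0 * \<mu>) = w x / ennreal k0" for x
    proof -
      have "median_max (1/2) f x / ennreal (K * \<mu> * k0) = w x / ennreal k0"
        unfolding w_def divide_ennreal_def using K \<mu> k0
        by (simp add: mult.assoc inverse_ennreal flip: ennreal_mult)
      then show ?thesis by (simp add: mult_ac)
    qed
    then have "(\<integral>\<^sup>+x. ennpow (median_max (1/2) f x / ennreal (K * k0 * \<mu>)) (ennreal (q x)) \<partial>lebesgue) \<le>
      (\<integral>\<^sup>+x. ennreal (1 / k0) * liminf (\<lambda>J. \<Phi> J x) \<partial>lebesgue)"
      using order_trans[OF ennpow_divide_le[OF k0(1)] mult_left_mono[OF pt]] by (intro nn_integral_mono) simp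
    also have "\<dots> = ennreal (1 / k0) * (\<integral>\<^sup>+x. liminf (\<lambda>J. \<Phi> J x) \<partial>lebesgue)"
      by (intro nn_integral_cmult borel_measurable_liminf \<Phi>_meas)
    also have "\<dots> \<le> ennreal (1 / k0) * ennreal k0"
      using liminf_int k0 by (intro mult_left_mono order_trans[OF liminf_int] ennreal_leI) auto
    also have "\<dots> = 1" using k0 by (simp flip: ennreal_mult)
    finally show "(\<integral>\<^sup>+x. ennpow (median_max (1/2) f x / ennreal (K * k0 * \<mu>)) (ennreal (q x)) \<partial>lebesgue) \<le> 1" .
  qed
qed

text \<open>The parameter one half works for every such exponent because the condition is available
  at arbitrarily small densities. The modular bound holds for each admissible \<mu> and so passes to
  the infimum.\<close>

lemma A_infty_imp_median_max_bounded:
  assumes "A_infty (\<lambda>x. ennreal (q x))"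
  shows "median_max_bounded (1/2) (\<lambda>x. ennreal (q x))"
proof -
  let ?p = "\<lambda>x. ennreal (q x)"
  obtain r C where rC: "0 < r" "r < 1" "1 \<le> C" "set_A_infty q r C"
    using set_A_inftyI[OF assms] .
  obtain D where D: "D > 0" "\<forall>f\<in>borel_measurable lebesgue. \<forall>\<mu>>0.
    (\<integral>\<^sup>+x. ennpow (ennreal \<bar>f x\<bar> / ennreal \<mu>) (?p x) \<partial>lebesgue) \<le> 1 \<longrightarrow>
    (\<integral>\<^sup>+x. ennpow (median_max (1/2) f x / ennreal (D * \<mu>)) (?p x) \<partial>lebesgue) \<le> 1"
    using median_modular_bound[OF rC(4,1,2,3)] by blast
  show ?thesis
    unfolding median_max_bounded_def
  proof (intro exI[of _ D] conjI ballI)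
    fix f assume "f \<in> Lp_space ?p"
    then have f: "f \<in> borel_measurable lebesgue" by (simp add: Lp_space_def)
    let ?N = "Lp_ext_norm ?p (median_max (1/2) f)"
    have cancel: "ennreal (1 / D) * (ennreal D * a) = a" "ennreal D * (ennreal (1 / D) * a) = a" for a
      using D by (simp_all add: mult.assoc[symmetric] flip: ennreal_mult)
    have "ennreal (1 / D) * ?N \<le> Lp_norm ?p f"
      unfolding Lp_norm_def Lp_ext_norm_def[of ?p "\<lambda>x. ennreal \<bar>f x\<bar>"]
    proof (rule Inf_greatest, safe)
      fix \<mu> :: real assume \<mu>: "0 < \<mu>" "(\<integral>\<^sup>+x. ennpow (ennreal \<bar>f x\<bar> / ennreal \<mu>) (?p x) \<partial>lebesgue) \<le> 1"
      have "?N \<le> ennreal (D * \<mu>)"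
        unfolding Lp_ext_norm_def using D(1) D(2)[rule_format, OF f \<mu>] \<mu>(1)
        by (intro Inf_lower CollectI exI[of _ "D * \<mu>"]) auto
      then have "ennreal (1 / D) * ?N \<le> ennreal (1 / D) * ennreal (D * \<mu>)" by (rule mult_left_mono) simp
      then show "ennreal (1 / D) * ?N \<le> ennreal \<mu>" using D(1) \<mu>(1) cancel(1)[of "ennreal \<mu>"] by (simp add: ennreal_mult)
    qed
    then have "ennreal D * (ennreal (1 / D) * ?N) \<le> ennreal D * Lp_norm ?p f" by (rule mult_left_mono) simp
    then show "?N \<le> ennreal D * Lp_norm ?p f" by (simp only: cancel)
  qed (rule D(1))
qed

end

text \<open>Clipping \<open>p\<close> to \<open>[1, pp]\<close> changes it at most on the null set
  where it exceeds its essential supremum; the bounds then hold at every point, as the locale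
  \<open>exponent\<close> requires.\<close>

lemma finite_exponent:
  fixes p :: "real^'n \<Rightarrow> ennreal"
  assumes p [measurable]: "p \<in> borel_measurable lebesgue" and p1: "\<And>x. 1 \<le> p x" and sup: "esssup lebesgue p < \<infinity>"
  obtains q pp where "exponent q pp" "AE x in lebesgue. p x = ennreal (q x)"
proof -
  define pp where "pp = max 1 (enn2real (esssup lebesgue p))"
  define q where "q x = max 1 (min (enn2real (p x)) pp)" for x
  have "q \<in> borel_measurable lebesgue" unfolding q_def by measurable
  then have "exponent q pp" by unfold_locales (auto simp: q_def pp_def)
  moreover have "AE x in lebesgue. p x = ennreal (q x)"
    using esssup_AE[of p lebesgue]
  proof (rule AE_mp, intro AE_I2 impI)
    fix x assume le: "p x \<le> esssup lebesgue p"
    then have fin: "p x < \<infinity>" using sup by (rule le_less_trans)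
    have "enn2real (p x) \<le> enn2real (esssup lebesgue p)" using le sup by (intro enn2real_mono) auto
    moreover have "1 \<le> enn2real (p x)"
      using enn2real_mono[OF p1[of x]] fin by simp
    ultimately have "q x = enn2real (p x)" by (simp add: q_def pp_def)
    then show "p x = ennreal (q x)" using fin by simp
  qed
  ultimately show ?thesis using that by blast
qed

theorem theorem1p5:
  fixes p :: "real^'n \<Rightarrow> ennreal"
  assumes "p \<in> borel_measurable lebesgue"
    and "\<And>x. 1 \<le> p x"
    and "essinf lebesgue p \<ge> 1"
    and "esssup lebesgue p < \<infinity>"
  shows "A_infty p \<longleftrightarrow> (\<exists>t. 0 < t \<and> t < 1 \<and> median_max_bounded t p)"
proof
  assume A: "A_infty p"
  obtain q pp where q: "exponent q pp" and eq: "AE x in lebesgue. p x = ennreal (q x)"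
    using finite_exponent[OF assms(1,2,4)] .
  interpret exponent q pp by (rule q)
  \<comment> \<open>The exponent enters both properties only through the norm, so they pass between
    \<open>p\<close> and its representative.\<close>
  have norms: "Lp_ext_norm p = Lp_ext_norm (\<lambda>x. ennreal (q x))"
    by (intro ext Lp_ext_norm_cong_AE[OF eq])
  have "A_infty (\<lambda>x. ennreal (q x))"
    using A unfolding A_infty_def Lp_norm_def norms .
  then have "median_max_bounded (1/2) (\<lambda>x. ennreal (q x))" by (rule A_infty_imp_median_max_bounded)
  then have "median_max_bounded (1/2) p"
    unfolding median_max_bounded_def Lp_space_def Lp_norm_def norms .
  then show "\<exists>t. 0 < t \<and> t < 1 \<and> median_max_bounded t p" by (intro exI[of _ "1/2"]) simp
next
  assume "\<exists>t. 0 < t \<and> t < 1 \<and> median_max_bounded t p"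
  then show "A_infty p" using median_max_bounded_imp_A_infty by blast
qed

end
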